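(* Let $R$ be a left noetherian ring and let $T \subset R$ be a countable multiplicative subset consisting of (some) central elements of $R$. Consider the right $R$-module $M = T^{-1}R/R$. Then $\varinjlim \operatorname{add} M = \varinjlim \operatorname{Add} M$.
   Context: $T^{-1}R$ is the localization of $R$ at the central multiplicative subset $T$, and $T^{-1}R/R$ denotes the cokernel of the localization map $R\to T^{-1}R$ (which need not be injective). $\operatorname{add} M$ (resp. $\operatorname{Add} M$) is the class of all direct summands of finite (resp. arbitrary) direct sums of copies of $M$. For a class $\mathcal C$ of right $R$-modules, $\varinjlim \mathcal C$ is the class of all direct limits of direct systems (indexed by directed posets) of modules from $\mathcal C$. *)

theory Defs
  imports "HOL-Algebra.AbelCoset" "HOL-Library.Countable_Set"
begin

section \<open>Right modules over a (not necessarily commutative) ring\<close>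

text \<open>HOL-Algebra only has modules over commutative rings. As with its record for those,
  the multiplicative fields inherited from the ring record are irrelevant in a module.\<close>

record ('a, 'b) rmodule = "'b ring" +
  ract :: "'b \<Rightarrow> 'a \<Rightarrow> 'b"  (infixl \<open>\<star>\<index>\<close> 70)

locale right_module = R?: ring R + M?: abelian_group M
  for R :: "('r, 'k) ring_scheme" (structure) and M :: "('r, 'a, 'm) rmodule_scheme" (structure) +
  assumes ract_closed [simp, intro]:
      "\<lbrakk>x \<in> carrier M; a \<in> carrier R\<rbrakk> \<Longrightarrow> x \<star>\<^bsub>M\<^esub> a \<in> carrier M"
    and ract_l_distr:
      "\<lbrakk>x \<in> carrier M; y \<in> carrier M; a \<in> carrier R\<rbrakk> \<Longrightarrow>
        (x \<oplus>\<^bsub>M\<^esub> y) \<star>\<^bsub>M\<^esub> a = x \<star>\<^bsub>M\<^esub> a \<oplus>\<^bsub>M\<^esub> y \<star>\<^bsub>M\<^esub> a"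
    and ract_r_distr:
      "\<lbrakk>x \<in> carrier M; a \<in> carrier R; b \<in> carrier R\<rbrakk> \<Longrightarrow>
        x \<star>\<^bsub>M\<^esub> (a \<oplus>\<^bsub>R\<^esub> b) = x \<star>\<^bsub>M\<^esub> a \<oplus>\<^bsub>M\<^esub> x \<star>\<^bsub>M\<^esub> b"
    and ract_assoc:
      "\<lbrakk>x \<in> carrier M; a \<in> carrier R; b \<in> carrier R\<rbrakk> \<Longrightarrow>
        x \<star>\<^bsub>M\<^esub> (a \<otimes>\<^bsub>R\<^esub> b) = (x \<star>\<^bsub>M\<^esub> a) \<star>\<^bsub>M\<^esub> b"
    and ract_one [simp]: "x \<in> carrier M \<Longrightarrow> x \<star>\<^bsub>M\<^esub> \<one>\<^bsub>R\<^esub> = x"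

definition rmod_hom ::
    "('r, 'k) ring_scheme \<Rightarrow> ('r, 'a, 'm) rmodule_scheme \<Rightarrow> ('r, 'b, 'n) rmodule_scheme \<Rightarrow> ('a \<Rightarrow> 'b) set"
  where "rmod_hom R M N = {h \<in> carrier M \<rightarrow> carrier N.
    (\<forall>x\<in>carrier M. \<forall>y\<in>carrier M. h (x \<oplus>\<^bsub>M\<^esub> y) = h x \<oplus>\<^bsub>N\<^esub> h y) \<and>
    (\<forall>x\<in>carrier M. \<forall>a\<in>carrier R. h (x \<star>\<^bsub>M\<^esub> a) = h x \<star>\<^bsub>N\<^esub> a)}"

definition rmod_isomorphic ::
    "('r, 'k) ring_scheme \<Rightarrow> ('r, 'a, 'm) rmodule_scheme \<Rightarrow> ('r, 'b, 'n) rmodule_scheme \<Rightarrow> bool"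
  where "rmod_isomorphic R M N \<longleftrightarrow> (\<exists>h\<in>rmod_hom R M N. bij_betw h (carrier M) (carrier N))"

definition rsubmodule :: "('r, 'k) ring_scheme \<Rightarrow> 'a set \<Rightarrow> ('r, 'a, 'm) rmodule_scheme \<Rightarrow> bool"
  where "rsubmodule R H M \<longleftrightarrow>
    subgroup H (add_monoid M) \<and> (\<forall>x\<in>H. \<forall>a\<in>carrier R. x \<star>\<^bsub>M\<^esub> a \<in> H)"

definition quotient_rmodule :: "('r, 'a, 'm) rmodule_scheme \<Rightarrow> 'a set \<Rightarrow> ('r, 'a set) rmodule"
  where "quotient_rmodule M H =
    \<lparr>carrier = a_rcosets\<^bsub>M\<^esub> H, mult = undefined, one = undefined,
     zero = H, add = (\<lambda>X Y. X <+>\<^bsub>M\<^esub> Y),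
     ract = (\<lambda>X a. \<Union>x\<in>X. H +>\<^bsub>M\<^esub> (x \<star>\<^bsub>M\<^esub> a))\<rparr>"


section \<open>Left noetherian rings\<close>

definition left_ideal :: "'r set \<Rightarrow> ('r, 'k) ring_scheme \<Rightarrow> bool"
  where "left_ideal I R \<longleftrightarrow>
    subgroup I (add_monoid R) \<and> (\<forall>a\<in>carrier R. \<forall>x\<in>I. a \<otimes>\<^bsub>R\<^esub> x \<in> I)"

definition left_noetherian :: "('r, 'k) ring_scheme \<Rightarrow> bool"
  where "left_noetherian R \<longleftrightarrow> ring R \<and>
    (\<forall>I. left_ideal I R \<longrightarrow>
      (\<exists>A\<subseteq>carrier R. finite A \<and> I = \<Inter>{J. left_ideal J R \<and> A \<subseteq> J}))"


section \<open>Localization at a central multiplicative subset\<close>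

definition central_mult_subset :: "'r set \<Rightarrow> ('r, 'k) ring_scheme \<Rightarrow> bool"
  where "central_mult_subset T R \<longleftrightarrow>
    submonoid T R \<and> (\<forall>t\<in>T. \<forall>a\<in>carrier R. t \<otimes>\<^bsub>R\<^esub> a = a \<otimes>\<^bsub>R\<^esub> t)"

text \<open>No element of \<open>T\<close> is assumed to be regular (zero is allowed in \<open>T\<close>), whence the factor \<open>u\<close>.\<close>

definition frac_rel :: "('r, 'k) ring_scheme \<Rightarrow> 'r set \<Rightarrow> ('r \<times> 'r) rel"
  where "frac_rel R T = {((a, s), (b, t)). a \<in> carrier R \<and> b \<in> carrier R \<and> s \<in> T \<and> t \<in> T \<and>
    (\<exists>u\<in>T. u \<otimes>\<^bsub>R\<^esub> (a \<otimes>\<^bsub>R\<^esub> t) = u \<otimes>\<^bsub>R\<^esub> (b \<otimes>\<^bsub>R\<^esub> s))}"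

definition frac :: "('r, 'k) ring_scheme \<Rightarrow> 'r set \<Rightarrow> 'r \<Rightarrow> 'r \<Rightarrow> ('r \<times> 'r) set"
  where "frac R T a s = frac_rel R T `` {(a, s)}"

text \<open>The operations on classes are unions over representatives of the class obtained from
  them; by compatibility with \<^const>\<open>frac_rel\<close> this is a union of equal classes.\<close>

definition localization :: "('r, 'k) ring_scheme \<Rightarrow> 'r set \<Rightarrow> ('r \<times> 'r) set ring"
  where "localization R T =
    \<lparr>carrier = (carrier R \<times> T) // frac_rel R T,
     mult = (\<lambda>X Y. \<Union>(a, s)\<in>X. \<Union>(b, t)\<in>Y. frac R T (a \<otimes>\<^bsub>R\<^esub> b) (s \<otimes>\<^bsub>R\<^esub> t)),
     one = frac R T \<one>\<^bsub>R\<^esub> \<one>\<^bsub>R\<^esub>,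
     zero = frac R T \<zero>\<^bsub>R\<^esub> \<one>\<^bsub>R\<^esub>,
     add = (\<lambda>X Y. \<Union>(a, s)\<in>X. \<Union>(b, t)\<in>Y.
       frac R T (a \<otimes>\<^bsub>R\<^esub> t \<oplus>\<^bsub>R\<^esub> b \<otimes>\<^bsub>R\<^esub> s) (s \<otimes>\<^bsub>R\<^esub> t))\<rparr>"

definition loc_map :: "('r, 'k) ring_scheme \<Rightarrow> 'r set \<Rightarrow> 'r \<Rightarrow> ('r \<times> 'r) set"
  where "loc_map R T a = frac R T a \<one>\<^bsub>R\<^esub>"

definition loc_rmodule :: "('r, 'k) ring_scheme \<Rightarrow> 'r set \<Rightarrow> ('r, ('r \<times> 'r) set) rmodule"
  where "loc_rmodule R T =
    ring.extend (localization R T) \<lparr>ract = (\<lambda>X a. X \<otimes>\<^bsub>localization R T\<^esub> loc_map R T a)\<rparr>"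

definition loc_cokernel :: "('r, 'k) ring_scheme \<Rightarrow> 'r set \<Rightarrow> ('r, ('r \<times> 'r) set set) rmodule"
  where "loc_cokernel R T = quotient_rmodule (loc_rmodule R T) (loc_map R T ` carrier R)"


section \<open>Direct sums of copies, \<open>add\<close> and \<open>Add\<close>\<close>

definition direct_sum_copies :: "'x set \<Rightarrow> ('r, 'a, 'm) rmodule_scheme \<Rightarrow> ('r, 'x \<Rightarrow> 'a) rmodule"
  where "direct_sum_copies X M =
    \<lparr>carrier = {f \<in> X \<rightarrow>\<^sub>E carrier M. finite {x \<in> X. f x \<noteq> \<zero>\<^bsub>M\<^esub>}},
     mult = undefined, one = undefined,
     zero = (\<lambda>x\<in>X. \<zero>\<^bsub>M\<^esub>), add = (\<lambda>f g. \<lambda>x\<in>X. f x \<oplus>\<^bsub>M\<^esub> g x),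
     ract = (\<lambda>f a. \<lambda>x\<in>X. f x \<star>\<^bsub>M\<^esub> a)\<rparr>"

definition is_direct_summand ::
    "('r, 'k) ring_scheme \<Rightarrow> ('r, 'a, 'm) rmodule_scheme \<Rightarrow> ('r, 'b) rmodule \<Rightarrow> bool"
  where "is_direct_summand R L N \<longleftrightarrow>
    (\<exists>A B. rsubmodule R A N \<and> rsubmodule R B N \<and> A \<inter> B = {\<zero>\<^bsub>N\<^esub>} \<and> A <+>\<^bsub>N\<^esub> B = carrier N \<and>
      rmod_isomorphic R L (N\<lparr>carrier := A\<rparr>))"

text \<open>
  HOL has no proper classes and no quantification over types inside formulas, so classes of
  modules are rendered relative to a type \<open>'u\<close> in the role of a universe: the members of
  \<open>addM\<close> and \<open>AddM\<close> are modules carried by subsets of \<open>'u\<close>, the sets \<open>X\<close> indexing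
  direct sums of copies are subsets of \<open>'u\<close>, and so are the posets indexing direct systems
  below. All these classes are closed under isomorphism.
\<close>

definition addM :: "('r, 'k) ring_scheme \<Rightarrow> ('r, 'm) rmodule \<Rightarrow> ('r, 'u) rmodule set"
  where "addM R M = {L. right_module R L \<and>
    (\<exists>n::nat. is_direct_summand R L (direct_sum_copies {..<n} M))}"

definition AddM :: "('r, 'k) ring_scheme \<Rightarrow> ('r, 'm) rmodule \<Rightarrow> ('r, 'u) rmodule set"
  where "AddM R M = {L. right_module R L \<and>
    (\<exists>X::'u set. is_direct_summand R L (direct_sum_copies X M))}"


section \<open>Direct limits\<close>

definition directed_poset :: "'i set \<Rightarrow> 'i rel \<Rightarrow> bool"
  where "directed_poset I r \<longleftrightarrow> partial_order_on I r \<and> I \<noteq> {} \<and>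
    (\<forall>i\<in>I. \<forall>j\<in>I. \<exists>k. (i, k) \<in> r \<and> (j, k) \<in> r)"

definition direct_system ::
    "('r, 'k) ring_scheme \<Rightarrow> 'i set \<Rightarrow> 'i rel \<Rightarrow> ('i \<Rightarrow> ('r, 'a) rmodule) \<Rightarrow> ('i \<Rightarrow> 'i \<Rightarrow> 'a \<Rightarrow> 'a) \<Rightarrow> bool"
  where "direct_system R I r D f \<longleftrightarrow> directed_poset I r \<and>
    (\<forall>i\<in>I. right_module R (D i)) \<and>
    (\<forall>(i, j)\<in>r. f i j \<in> rmod_hom R (D i) (D j)) \<and>
    (\<forall>i\<in>I. \<forall>x\<in>carrier (D i). f i i x = x) \<and>
    (\<forall>i j k. (i, j) \<in> r \<longrightarrow> (j, k) \<in> r \<longrightarrow> (\<forall>x\<in>carrier (D i). f j k (f i j x) = f i k x))"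

text \<open>The direct limit is the disjoint union of the modules \<open>D i\<close> modulo eventual equality; the
  operations are again unions over representatives.\<close>

definition dirlim_rel ::
    "'i set \<Rightarrow> 'i rel \<Rightarrow> ('i \<Rightarrow> ('r, 'a) rmodule) \<Rightarrow> ('i \<Rightarrow> 'i \<Rightarrow> 'a \<Rightarrow> 'a) \<Rightarrow> ('i \<times> 'a) rel"
  where "dirlim_rel I r D f = {((i, x), (j, y)). i \<in> I \<and> x \<in> carrier (D i) \<and> j \<in> I \<and> y \<in> carrier (D j) \<and>
    (\<exists>k. (i, k) \<in> r \<and> (j, k) \<in> r \<and> f i k x = f j k y)}"

definition direct_limit ::
    "'i set \<Rightarrow> 'i rel \<Rightarrow> ('i \<Rightarrow> ('r, 'a) rmodule) \<Rightarrow> ('i \<Rightarrow> 'i \<Rightarrow> 'a \<Rightarrow> 'a) \<Rightarrow> ('r, ('i \<times> 'a) set) rmodule"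
  where "direct_limit I r D f =
    \<lparr>carrier = (SIGMA i:I. carrier (D i)) // dirlim_rel I r D f,
     mult = undefined, one = undefined,
     zero = (\<Union>i\<in>I. dirlim_rel I r D f `` {(i, \<zero>\<^bsub>D i\<^esub>)}),
     add = (\<lambda>X Y. \<Union>(i, x)\<in>X. \<Union>(j, y)\<in>Y. \<Union>k\<in>{k. (i, k) \<in> r \<and> (j, k) \<in> r}.
       dirlim_rel I r D f `` {(k, f i k x \<oplus>\<^bsub>D k\<^esub> f j k y)}),
     ract = (\<lambda>X a. \<Union>(i, x)\<in>X. dirlim_rel I r D f `` {(i, x \<star>\<^bsub>D i\<^esub> a)})\<rparr>"

definition direct_limits :: "('r, 'k) ring_scheme \<Rightarrow> ('r, 'u) rmodule set \<Rightarrow> ('r, 'n) rmodule set"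
  where "direct_limits R C = {N. right_module R N \<and>
    (\<exists>(I::'u set) r D f. direct_system R I r D f \<and> (\<forall>i\<in>I. D i \<in> C) \<and>
      rmod_isomorphic R N (direct_limit I r D f))}"

text \<open>
  For every \<open>'v\<close> the universe \<open>('r, 'v) univ\<close> is infinite, is at least as large as \<open>'r\<close>, and
  its cardinality \<open>\<kappa>\<close> satisfies \<open>\<kappa> ^ \<lambda> = \<kappa>\<close> for \<open>\<lambda> = max \<aleph>\<^sub>0 (card 'r)\<close>. Since \<open>'v\<close> is arbitrary,
  any given direct system, together with the index sets of the direct sums involved, has an
  isomorphic copy in such a universe: take for \<open>'v\<close> the product of all types involved.
\<close>

type_synonym ('r, 'v) univ = "('r \<times> nat \<times> 'v) set"

end

theory Submission
  imports Defs
begin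

text \<open>Write \<open>M\<close> for \<open>T\<^sup>-\<^sup>1R/R\<close>. A finite direct sum is a direct sum, so one inclusion is clear
  (\<open>addM_subset_AddM\<close>). For the other one, let \<open>N\<close> be the direct limit of modules \<open>D\<^sub>i\<close> that
  are direct summands of possibly infinite direct sums of copies of \<open>M\<close>. Dividing \<open>R\<close> by its
  \<open>T\<close>-torsion does not change \<open>M\<close>, so suppose for the moment that \<open>T\<close> consists of nonzerodivisors.
  Left multiplication makes \<open>M\<close> a bimodule, so \<open>Hom(M, D\<^sub>i)\<close> is a right \<open>R\<close>-module. It is flat: for
  a direct sum of copies of \<open>M\<close> it is the completion of a free module with respect to the ideals
  \<open>sR\<close> with \<open>s \<in> T\<close>, and such completions are flat over a left noetherian ring.
  Evaluation identifies \<open>Hom(M, D\<^sub>i) \<otimes> M\<close> with \<open>D\<^sub>i\<close>. Hence \<open>N = F \<otimes> M\<close> for the flat module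
  \<open>F = lim Hom(M, D\<^sub>i)\<close>; writing \<open>F\<close> as a direct limit of free modules \<open>R\<^sup>n\<close> of finite rank, as
  in Lazard's theorem, turns \<open>N\<close> into a direct limit of modules \<open>M\<^sup>n\<close>.

  The proof below carries this out without tensor products, flat modules or completions, and without
  passing to a quotient of \<open>R\<close>.

  The flatness becomes a factorization property (\<open>exact_factorization\<close>): if a homomorphism
  \<open>h: M\<^sup>n\<^sup>' \<rightarrow> M\<^sup>(\<^sup>X\<^sup>)\<close> satisfies \<open>h \<circ> \<beta>\<^sub>1 = h \<circ> \<beta>\<^sub>2\<close> for two maps given by matrices over
  \<open>R\<close>, then \<open>h\<close> factors through a map \<open>\<Gamma>: M\<^sup>n\<^sup>' \<rightarrow> M\<^sup>p\<close> that is also given by a matrix and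
  satisfies \<open>\<Gamma> \<circ> \<beta>\<^sub>1 = \<Gamma> \<circ> \<beta>\<^sub>2\<close>. The rows of \<open>\<Gamma>\<close> generate the left module of all row
  vectors that satisfy the relation up to torsion, which is where \<open>R\<close> being left noetherian
  enters. The factorization is first achieved modulo an arbitrary \<open>s \<in> T\<close>
  (\<open>approximate_factorization\<close>); this uses that the torsion of a finitely generated left module
  is killed by a single element of \<open>T\<close>, again by noetherianity. As
  \<open>T\<close> is countable, the approximations can be repeated along a cofinal sequence of denominators,
  and they add up to a series that is finite on every element of \<open>M\<^sup>p\<close>. The property passes to
  direct summands of \<open>M\<^sup>(\<^sup>X\<^sup>)\<close>, and it implies that an element killed by \<open>h\<close> is killed by some
  such \<open>\<Gamma>\<close> through which \<open>h\<close> factors (\<open>factor_kill\<close>).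

  Now consider all homomorphisms \<open>h: M\<^sup>n \<rightarrow> D\<^sub>i\<close> for all \<open>n\<close> and \<open>i\<close>. With the matrices that
  are compatible with the homomorphisms at some later stage of the system as arrows, they form a
  filtered category, and the modules \<open>M\<^sup>n\<close> form a diagram over it whose colimit is \<open>N\<close>
  (\<open>filtered\<close>). A filtered category is replaced by a directed poset of finite subdiagrams with a
  chosen terminal object (\<open>stages_system\<close>, \<open>stages_cocone\<close>). Finally this poset and the modules
  \<open>M\<^sup>n\<close> are small enough to be copied into the universe: as \<open>T\<close> is countable, a homomorphism out of
  \<open>M\<^sup>n\<close> is determined by a sequence of values (\<open>limit_of_Add_in_limit_of_add\<close>).\<close>

section \<open>Homomorphisms of right modules\<close>

lemma rmod_homD:
  assumes "h \<in> rmod_hom R A B"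
  shows "x \<in> carrier A \<Longrightarrow> h x \<in> carrier B"
    and "\<lbrakk>x \<in> carrier A; y \<in> carrier A\<rbrakk> \<Longrightarrow> h (x \<oplus>\<^bsub>A\<^esub> y) = h x \<oplus>\<^bsub>B\<^esub> h y"
    and "\<lbrakk>x \<in> carrier A; a \<in> carrier R\<rbrakk> \<Longrightarrow> h (x \<star>\<^bsub>A\<^esub> a) = h x \<star>\<^bsub>B\<^esub> a"
  using assms by (auto simp: rmod_hom_def)

lemma rmod_homI:
  assumes "\<And>x. x \<in> carrier A \<Longrightarrow> h x \<in> carrier B"
    and "\<And>x y. \<lbrakk>x \<in> carrier A; y \<in> carrier A\<rbrakk> \<Longrightarrow> h (x \<oplus>\<^bsub>A\<^esub> y) = h x \<oplus>\<^bsub>B\<^esub> h y"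
    and "\<And>x a. \<lbrakk>x \<in> carrier A; a \<in> carrier R\<rbrakk> \<Longrightarrow> h (x \<star>\<^bsub>A\<^esub> a) = h x \<star>\<^bsub>B\<^esub> a"
  shows "h \<in> rmod_hom R A B"
  using assms by (auto simp: rmod_hom_def)

lemma rmod_hom_comp:
  assumes "h \<in> rmod_hom R A B" "g \<in> rmod_hom R B C"
  shows "(\<lambda>x. g (h x)) \<in> rmod_hom R A C"
  using assms by (auto simp: rmod_hom_def Pi_iff)

context right_module
begin

lemma zero_ract [simp]:
  assumes "a \<in> carrier R" shows "\<zero>\<^bsub>M\<^esub> \<star>\<^bsub>M\<^esub> a = \<zero>\<^bsub>M\<^esub>"
proof -
  have "\<zero>\<^bsub>M\<^esub> \<star>\<^bsub>M\<^esub> a \<oplus>\<^bsub>M\<^esub> \<zero>\<^bsub>M\<^esub> \<star>\<^bsub>M\<^esub> a = \<zero>\<^bsub>M\<^esub> \<star>\<^bsub>M\<^esub> a"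
    using ract_l_distr[of "\<zero>\<^bsub>M\<^esub>" "\<zero>\<^bsub>M\<^esub>" a] assms by simp
  then show ?thesis using assms by (metis M.zero_closed M.add.r_cancel_one' ract_closed)
qed

lemma ract_zero [simp]:
  assumes "x \<in> carrier M" shows "x \<star>\<^bsub>M\<^esub> \<zero>\<^bsub>R\<^esub> = \<zero>\<^bsub>M\<^esub>"
proof -
  have "x \<star>\<^bsub>M\<^esub> \<zero>\<^bsub>R\<^esub> \<oplus>\<^bsub>M\<^esub> x \<star>\<^bsub>M\<^esub> \<zero>\<^bsub>R\<^esub> = x \<star>\<^bsub>M\<^esub> \<zero>\<^bsub>R\<^esub>"
    using ract_r_distr[of x "\<zero>\<^bsub>R\<^esub>" "\<zero>\<^bsub>R\<^esub>"] assms by simp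
  then show ?thesis using assms by (metis R.zero_closed M.add.r_cancel_one' ract_closed)
qed

lemma minus_ract:
  assumes "x \<in> carrier M" "a \<in> carrier R"
  shows "(\<ominus>\<^bsub>M\<^esub> x) \<star>\<^bsub>M\<^esub> a = \<ominus>\<^bsub>M\<^esub> (x \<star>\<^bsub>M\<^esub> a)"
proof -
  have "(\<ominus>\<^bsub>M\<^esub> x) \<star>\<^bsub>M\<^esub> a \<oplus>\<^bsub>M\<^esub> x \<star>\<^bsub>M\<^esub> a = \<zero>\<^bsub>M\<^esub>"
    using ract_l_distr[of "\<ominus>\<^bsub>M\<^esub> x" x a] assms by (simp add: M.l_neg)
  then show ?thesis using assms by (metis M.a_inv_closed M.minus_equality ract_closed)
qed

lemma ract_minus:
  assumes "x \<in> carrier M" "a \<in> carrier R"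
  shows "x \<star>\<^bsub>M\<^esub> (\<ominus>\<^bsub>R\<^esub> a) = \<ominus>\<^bsub>M\<^esub> (x \<star>\<^bsub>M\<^esub> a)"
proof -
  have "x \<star>\<^bsub>M\<^esub> (\<ominus>\<^bsub>R\<^esub> a) \<oplus>\<^bsub>M\<^esub> x \<star>\<^bsub>M\<^esub> a = \<zero>\<^bsub>M\<^esub>"
    using ract_r_distr[of x "\<ominus>\<^bsub>R\<^esub> a" a] assms by (simp add: R.l_neg)
  then show ?thesis using assms by (metis R.a_inv_closed M.minus_equality ract_closed)
qed

lemma diff_eq_zero_iff:
  assumes "x \<in> carrier M" "y \<in> carrier M"
  shows "x \<ominus>\<^bsub>M\<^esub> y = \<zero>\<^bsub>M\<^esub> \<longleftrightarrow> x = y"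
  using assms by (metis M.a_inv_closed M.minus_equality M.minus_minus M.r_neg a_minus_def)

lemma add_conj_cancel [simp]:
  assumes "x \<in> carrier M" "y \<in> carrier M"
  shows "y \<oplus>\<^bsub>M\<^esub> (x \<oplus>\<^bsub>M\<^esub> \<ominus>\<^bsub>M\<^esub> y) = x"
  using assms by (metis M.a_comm M.a_inv_closed M.a_lcomm M.add.m_closed M.r_neg M.r_zero)

lemma add_conj_cancel' [simp]:
  assumes "x \<in> carrier M" "y \<in> carrier M" "z \<in> carrier M"
  shows "y \<oplus>\<^bsub>M\<^esub> (x \<oplus>\<^bsub>M\<^esub> (\<ominus>\<^bsub>M\<^esub> y \<oplus>\<^bsub>M\<^esub> z)) = x \<oplus>\<^bsub>M\<^esub> z"
  using assms by (metis M.a_inv_closed M.a_lcomm M.add.m_closed M.r_neg2)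

lemma diff_ract:
  assumes "x \<in> carrier M" "y \<in> carrier M" "a \<in> carrier R"
  shows "(x \<ominus>\<^bsub>M\<^esub> y) \<star>\<^bsub>M\<^esub> a = x \<star>\<^bsub>M\<^esub> a \<ominus>\<^bsub>M\<^esub> y \<star>\<^bsub>M\<^esub> a"
  using assms by (simp add: a_minus_def ract_l_distr minus_ract)

end

lemma rmod_hom_zero:
  assumes "h \<in> rmod_hom R A B" "right_module R A" "right_module R B"
  shows "h \<zero>\<^bsub>A\<^esub> = \<zero>\<^bsub>B\<^esub>"
proof -
  interpret A: right_module R A by fact
  interpret B: right_module R B by fact
  have "h \<zero>\<^bsub>A\<^esub> \<oplus>\<^bsub>B\<^esub> h \<zero>\<^bsub>A\<^esub> = h \<zero>\<^bsub>A\<^esub>"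
    using rmod_homD(2)[OF assms(1), of "\<zero>\<^bsub>A\<^esub>" "\<zero>\<^bsub>A\<^esub>"] by simp
  then show ?thesis using rmod_homD(1)[OF assms(1)]
    by (metis A.M.zero_closed B.M.add.r_cancel_one')
qed

lemma rmod_hom_minus:
  assumes "h \<in> rmod_hom R A B" "right_module R A" "right_module R B" "x \<in> carrier A"
  shows "h (\<ominus>\<^bsub>A\<^esub> x) = \<ominus>\<^bsub>B\<^esub> h x"
proof -
  interpret A: right_module R A by fact
  interpret B: right_module R B by fact
  have "h (\<ominus>\<^bsub>A\<^esub> x) \<oplus>\<^bsub>B\<^esub> h x = \<zero>\<^bsub>B\<^esub>"
    using rmod_homD(2)[OF assms(1), of "\<ominus>\<^bsub>A\<^esub> x" x] assms(4)
    by (simp add: A.M.l_neg rmod_hom_zero[OF assms(1-3)])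
  then show ?thesis using rmod_homD(1)[OF assms(1)] assms(4)
    by (metis A.M.a_inv_closed B.M.minus_equality)
qed

lemma rmod_hom_diff:
  assumes "h \<in> rmod_hom R A B" "right_module R A" "right_module R B" "x \<in> carrier A" "y \<in> carrier A"
  shows "h (x \<ominus>\<^bsub>A\<^esub> y) = h x \<ominus>\<^bsub>B\<^esub> h y"
proof -
  interpret A: right_module R A by fact
  show ?thesis using assms
    by (simp add: a_minus_def rmod_homD(2)[OF assms(1)] rmod_hom_minus[OF assms(1-3)])
qed

lemma rmod_hom_zero_map:
  assumes "right_module R A" "right_module R B"
  shows "(\<lambda>x. \<zero>\<^bsub>B\<^esub>) \<in> rmod_hom R A B"
proof -
  interpret B: right_module R B by fact
  show ?thesis by (rule rmod_homI) auto
qed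

lemma rmod_hom_add:
  assumes "right_module R B" "h \<in> rmod_hom R A B" "g \<in> rmod_hom R A B"
  shows "(\<lambda>x. h x \<oplus>\<^bsub>B\<^esub> g x) \<in> rmod_hom R A B"
proof -
  interpret B: right_module R B by fact
  show ?thesis
    by (rule rmod_homI)
      (simp_all add: rmod_homD[OF assms(2)] rmod_homD[OF assms(3)] B.ract_l_distr B.M.a_ac)
qed

lemma rmod_hom_sub:
  assumes "right_module R B" "h \<in> rmod_hom R A B" "g \<in> rmod_hom R A B"
  shows "(\<lambda>x. h x \<ominus>\<^bsub>B\<^esub> g x) \<in> rmod_hom R A B"
proof -
  interpret B: right_module R B by fact
  show ?thesis
    by (rule rmod_homI)
      (simp_all add: rmod_homD[OF assms(2)] rmod_homD[OF assms(3)] B.ract_l_distr B.minus_ract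
        a_minus_def B.M.minus_add B.M.a_ac)
qed

lemma rmod_hom_cong:
  assumes "right_module R A" "h \<in> rmod_hom R A B" "\<And>x. x \<in> carrier A \<Longrightarrow> g x = h x"
  shows "g \<in> rmod_hom R A B"
proof -
  interpret A: right_module R A by fact
  show ?thesis by (rule rmod_homI) (simp_all add: assms(3) rmod_homD[OF assms(2)])
qed

lemma rmod_hom_compose:
  assumes "right_module R A" "u \<in> rmod_hom R A B" "v \<in> rmod_hom R B C"
  shows "compose (carrier A) v u \<in> rmod_hom R A C"
  by (rule rmod_hom_cong[OF assms(1) rmod_hom_comp[OF assms(2,3)]]) (simp add: compose_def)

lemma rmod_hom_inv_into:
  assumes "right_module R A" "h \<in> rmod_hom R A B" "bij_betw h (carrier A) (carrier B)"
  shows "inv_into (carrier A) h \<in> rmod_hom R B A"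
proof -
  interpret A: right_module R A by fact
  have im: "h ` carrier A = carrier B" and inj: "inj_on h (carrier A)"
    using assms(3) by (auto simp: bij_betw_def)
  show ?thesis
  proof (rule rmod_homI)
    fix x assume "x \<in> carrier B"
    then show "inv_into (carrier A) h x \<in> carrier A" using im by (metis inv_into_into)
  next
    fix x y assume x: "x \<in> carrier B" and y: "y \<in> carrier B"
    from x[folded im] obtain x' where x': "x' \<in> carrier A" "h x' = x" by auto
    from y[folded im] obtain y' where y': "y' \<in> carrier A" "h y' = y" by auto
    have "x \<oplus>\<^bsub>B\<^esub> y = h (x' \<oplus>\<^bsub>A\<^esub> y')" using x' y' rmod_homD(2)[OF assms(2)] by simp
    then show "inv_into (carrier A) h (x \<oplus>\<^bsub>B\<^esub> y) = inv_into (carrier A) h x \<oplus>\<^bsub>A\<^esub> inv_into (carrier A) h y"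
      using x' y' inj by (metis A.M.a_closed inv_into_f_f)
  next
    fix x a assume x: "x \<in> carrier B" and a: "a \<in> carrier R"
    from x[folded im] obtain x' where x': "x' \<in> carrier A" "h x' = x" by auto
    have "x \<star>\<^bsub>B\<^esub> a = h (x' \<star>\<^bsub>A\<^esub> a)" using x' a rmod_homD(3)[OF assms(2)] by simp
    then show "inv_into (carrier A) h (x \<star>\<^bsub>B\<^esub> a) = inv_into (carrier A) h x \<star>\<^bsub>A\<^esub> a"
      using x' a inj by (metis A.ract_closed inv_into_f_f)
  qed
qed

lemma rsubmodule_closed:
  assumes "rsubmodule R A N"
  shows "A \<subseteq> carrier N" and "\<zero>\<^bsub>N\<^esub> \<in> A"
    and "\<lbrakk>x \<in> A; y \<in> A\<rbrakk> \<Longrightarrow> x \<oplus>\<^bsub>N\<^esub> y \<in> A"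
    and "\<lbrakk>x \<in> A; a \<in> carrier R\<rbrakk> \<Longrightarrow> x \<star>\<^bsub>N\<^esub> a \<in> A"
    and "x \<in> A \<Longrightarrow> \<ominus>\<^bsub>N\<^esub> x \<in> A"
  using assms subgroup.subset[of A "add_monoid N"] subgroup.one_closed[of A "add_monoid N"]
    subgroup.m_closed[of A "add_monoid N" x y] subgroup.m_inv_closed[of A "add_monoid N" x]
  by (auto simp: rsubmodule_def a_inv_def)

lemma rsubmoduleI:
  assumes "right_module R N" "A \<subseteq> carrier N" "\<zero>\<^bsub>N\<^esub> \<in> A"
    and "\<And>x y. \<lbrakk>x \<in> A; y \<in> A\<rbrakk> \<Longrightarrow> x \<oplus>\<^bsub>N\<^esub> y \<in> A"
    and ract: "\<And>x a. \<lbrakk>x \<in> A; a \<in> carrier R\<rbrakk> \<Longrightarrow> x \<star>\<^bsub>N\<^esub> a \<in> A"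
  shows "rsubmodule R A N"
proof -
  interpret N: right_module R N by fact
  have "\<ominus>\<^bsub>N\<^esub> x \<in> A" if x: "x \<in> A" for x
  proof -
    have "x \<star>\<^bsub>N\<^esub> (\<ominus>\<^bsub>R\<^esub> \<one>\<^bsub>R\<^esub>) \<in> A" using ract x by simp
    moreover have "x \<in> carrier N" using x assms by blast
    ultimately show ?thesis by (simp add: N.ract_minus)
  qed
  then have "subgroup A (add_monoid N)"
    using assms by (intro N.M.add.subgroupI) (auto simp: a_inv_def)
  then show ?thesis using ract by (simp add: rsubmodule_def)
qed

text \<open>Retracts compose and transport along isomorphisms without any bookkeeping of
  complements, so all later arguments about summands go through this characterization.\<close>

lemma is_direct_summand_iff_retract:
  fixes L :: "('r, 'a) rmodule" and N :: "('r, 'b) rmodule"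
  assumes L: "right_module R L" and N: "right_module R N"
  shows "is_direct_summand R L N \<longleftrightarrow>
    (\<exists>i\<in>rmod_hom R L N. \<exists>p\<in>rmod_hom R N L. \<forall>x\<in>carrier L. p (i x) = x)"
proof
  interpret N: right_module R N by fact
  interpret L: right_module R L by fact
  assume "is_direct_summand R L N"
  then obtain A B h where A: "rsubmodule R A N" and B: "rsubmodule R B N"
    and AB: "A \<inter> B = {\<zero>\<^bsub>N\<^esub>}" "A <+>\<^bsub>N\<^esub> B = carrier N"
    and h: "h \<in> rmod_hom R L (N\<lparr>carrier := A\<rparr>)" "bij_betw h (carrier L) A"
    by (auto simp: is_direct_summand_def rmod_isomorphic_def)
  have inA: "x \<in> carrier N" if "x \<in> A" for x using that rsubmodule_closed(1)[OF A] by blast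
  have inB: "x \<in> carrier N" if "x \<in> B" for x using that rsubmodule_closed(1)[OF B] by blast
  define P where "P x a \<longleftrightarrow> a \<in> A \<and> (\<exists>b\<in>B. x = a \<oplus>\<^bsub>N\<^esub> b)" for x a
  have ex: "\<exists>a. P x a" if "x \<in> carrier N" for x
    using that unfolding AB(2)[symmetric] by (auto simp: P_def set_add_def set_mult_def)
  have un: "a = a'" if "P x a" "P x a'" for x a a'
  proof -
    obtain b b' where b: "b \<in> B" "b' \<in> B" "a \<oplus>\<^bsub>N\<^esub> b = a' \<oplus>\<^bsub>N\<^esub> b'" and a: "a \<in> A" "a' \<in> A"
      using \<open>P x a\<close> \<open>P x a'\<close> by (auto simp: P_def)
    note c = inA[OF a(1)] inA[OF a(2)] inB[OF b(1)] inB[OF b(2)]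
    have "a \<ominus>\<^bsub>N\<^esub> a' = (a \<oplus>\<^bsub>N\<^esub> b) \<ominus>\<^bsub>N\<^esub> (a' \<oplus>\<^bsub>N\<^esub> b)"
      using c by (simp add: a_minus_def N.M.minus_add N.M.a_assoc)
    also have "\<dots> = b' \<ominus>\<^bsub>N\<^esub> b"
      unfolding b(3) using c by (simp add: a_minus_def N.M.minus_add N.M.a_assoc)
    finally have eq: "a \<ominus>\<^bsub>N\<^esub> a' = b' \<ominus>\<^bsub>N\<^esub> b" .
    moreover have "a \<ominus>\<^bsub>N\<^esub> a' \<in> A" using a rsubmodule_closed(3,5)[OF A] by (simp add: a_minus_def)
    moreover have "b' \<ominus>\<^bsub>N\<^esub> b \<in> B" using b rsubmodule_closed(3,5)[OF B] by (simp add: a_minus_def)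
    ultimately have "a \<ominus>\<^bsub>N\<^esub> a' = \<zero>\<^bsub>N\<^esub>" using AB(1) by auto
    then show ?thesis using c by (simp add: N.diff_eq_zero_iff)
  qed
  define pr where "pr x = (SOME a. P x a)" for x
  have prP: "P x (pr x)" if "x \<in> carrier N" for x
    unfolding pr_def using ex[OF that] by (rule someI_ex)
  have pr_eq: "pr x = a" if "P x a" "x \<in> carrier N" for x a
    using un prP that by blast
  have pr_hom: "pr \<in> rmod_hom R N (N\<lparr>carrier := A\<rparr>)"
  proof (rule rmod_homI)
    fix x assume "x \<in> carrier N"
    then show "pr x \<in> carrier (N\<lparr>carrier := A\<rparr>)" using prP[of x] by (simp add: P_def)
  next
    fix x y assume x: "x \<in> carrier N" and y: "y \<in> carrier N"
    obtain b where b: "b \<in> B" "x = pr x \<oplus>\<^bsub>N\<^esub> b" "pr x \<in> A" using prP[OF x] by (auto simp: P_def)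
    obtain b' where b': "b' \<in> B" "y = pr y \<oplus>\<^bsub>N\<^esub> b'" "pr y \<in> A" using prP[OF y] by (auto simp: P_def)
    have "x \<oplus>\<^bsub>N\<^esub> y = (pr x \<oplus>\<^bsub>N\<^esub> b) \<oplus>\<^bsub>N\<^esub> (pr y \<oplus>\<^bsub>N\<^esub> b')" using b(2) b'(2) by simp
    also have "\<dots> = (pr x \<oplus>\<^bsub>N\<^esub> pr y) \<oplus>\<^bsub>N\<^esub> (b \<oplus>\<^bsub>N\<^esub> b')"
      using inA[OF b(3)] inA[OF b'(3)] inB[OF b(1)] inB[OF b'(1)] by (simp add: N.M.a_ac)
    finally have "P (x \<oplus>\<^bsub>N\<^esub> y) (pr x \<oplus>\<^bsub>N\<^esub> pr y)"
      using b b' rsubmodule_closed(3)[OF A] rsubmodule_closed(3)[OF B] unfolding P_def by blast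
    then show "pr (x \<oplus>\<^bsub>N\<^esub> y) = pr x \<oplus>\<^bsub>N\<lparr>carrier := A\<rparr>\<^esub> pr y"
      using x y by (simp add: pr_eq)
  next
    fix x a assume x: "x \<in> carrier N" and a: "a \<in> carrier R"
    obtain b where b: "b \<in> B" "x = pr x \<oplus>\<^bsub>N\<^esub> b" "pr x \<in> A" using prP[OF x] by (auto simp: P_def)
    have "x \<star>\<^bsub>N\<^esub> a = (pr x \<oplus>\<^bsub>N\<^esub> b) \<star>\<^bsub>N\<^esub> a" using b(2) by simp
    also have "\<dots> = pr x \<star>\<^bsub>N\<^esub> a \<oplus>\<^bsub>N\<^esub> b \<star>\<^bsub>N\<^esub> a"
      using inA[OF b(3)] inB[OF b(1)] a by (simp add: N.ract_l_distr)
    finally have "P (x \<star>\<^bsub>N\<^esub> a) (pr x \<star>\<^bsub>N\<^esub> a)"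
      using b a rsubmodule_closed(4)[OF A] rsubmodule_closed(4)[OF B] unfolding P_def by blast
    then show "pr (x \<star>\<^bsub>N\<^esub> a) = pr x \<star>\<^bsub>N\<lparr>carrier := A\<rparr>\<^esub> a"
      using x a by (simp add: pr_eq)
  qed
  have inv: "inv_into (carrier L) h \<in> rmod_hom R (N\<lparr>carrier := A\<rparr>) L"
    using rmod_hom_inv_into[OF L h(1)] h(2) by simp
  have hA: "h x \<in> A" if "x \<in> carrier L" for x using rmod_homD(1)[OF h(1) that] by simp
  have "h \<in> rmod_hom R L N"
    using h(1) hA by (auto simp: rmod_hom_def inA)
  moreover have "(\<lambda>x. inv_into (carrier L) h (pr x)) \<in> rmod_hom R N L"
    by (rule rmod_hom_comp[OF pr_hom inv])
  moreover have "inv_into (carrier L) h (pr (h x)) = x" if x: "x \<in> carrier L" for x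
  proof -
    have "P (h x) (h x)"
      using hA[OF x] inA rsubmodule_closed(2)[OF B] unfolding P_def by force
    then have "pr (h x) = h x" using hA[OF x] inA pr_eq by blast
    then show ?thesis using x h(2) by (simp add: bij_betw_def)
  qed
  ultimately show "\<exists>i\<in>rmod_hom R L N. \<exists>p\<in>rmod_hom R N L. \<forall>x\<in>carrier L. p (i x) = x"
    by (intro bexI[of _ h] bexI[of _ "\<lambda>x. inv_into (carrier L) h (pr x)"]) auto
next
  interpret N: right_module R N by fact
  interpret L: right_module R L by fact
  assume "\<exists>i\<in>rmod_hom R L N. \<exists>p\<in>rmod_hom R N L. \<forall>x\<in>carrier L. p (i x) = x"
  then obtain i p where i: "i \<in> rmod_hom R L N" and p: "p \<in> rmod_hom R N L"
    and pi: "\<And>x. x \<in> carrier L \<Longrightarrow> p (i x) = x" by blast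
  note ih = rmod_homD[OF i] and ph = rmod_homD[OF p]
  have i0: "i \<zero>\<^bsub>L\<^esub> = \<zero>\<^bsub>N\<^esub>" and p0: "p \<zero>\<^bsub>N\<^esub> = \<zero>\<^bsub>L\<^esub>"
    using rmod_hom_zero[OF i L N] rmod_hom_zero[OF p N L] by auto
  define A where "A = i ` carrier L"
  define B where "B = {x \<in> carrier N. p x = \<zero>\<^bsub>L\<^esub>}"
  have A: "rsubmodule R A N"
    by (rule rsubmoduleI[OF N]) (auto simp: A_def ih(1) ih(2,3)[symmetric] i0[symmetric])
  have B: "rsubmodule R B N"
    by (rule rsubmoduleI[OF N]) (auto simp: B_def ph p0)
  have "A \<inter> B = {\<zero>\<^bsub>N\<^esub>}"
    using rsubmodule_closed(2)[OF A] rsubmodule_closed(2)[OF B] by (auto simp: A_def B_def pi i0)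
  moreover have "A <+>\<^bsub>N\<^esub> B = carrier N"
  proof (intro equalityI subsetI)
    fix x assume "x \<in> A <+>\<^bsub>N\<^esub> B"
    then show "x \<in> carrier N" by (auto simp: A_def B_def set_add_def set_mult_def ih)
  next
    fix x assume x: "x \<in> carrier N"
    have "x = i (p x) \<oplus>\<^bsub>N\<^esub> (x \<ominus>\<^bsub>N\<^esub> i (p x))"
      using x ih(1) ph(1) by (simp add: a_minus_def)
    moreover have "x \<ominus>\<^bsub>N\<^esub> i (p x) \<in> B"
      using x ih(1) ph(1) pi by (simp add: B_def rmod_hom_diff[OF p N L] L.diff_eq_zero_iff)
    moreover have "i (p x) \<in> A" using x ph(1) by (simp add: A_def)
    ultimately show "x \<in> A <+>\<^bsub>N\<^esub> B" by (auto simp: set_add_def set_mult_def)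
  qed
  moreover have "i \<in> rmod_hom R L (N\<lparr>carrier := A\<rparr>)"
    using i by (auto simp: rmod_hom_def A_def)
  moreover have "bij_betw i (carrier L) A"
    unfolding bij_betw_def A_def by (metis inj_on_inverseI pi)
  ultimately show "is_direct_summand R L N"
    using A B unfolding is_direct_summand_def rmod_isomorphic_def
    by (intro exI[of _ A] exI[of _ B]) auto
qed

section \<open>Direct sums of copies of a module\<close>

lemma direct_sum_copies_simps [simp]:
  "\<zero>\<^bsub>direct_sum_copies X M\<^esub> = (\<lambda>x\<in>X. \<zero>\<^bsub>M\<^esub>)"
  "f \<oplus>\<^bsub>direct_sum_copies X M\<^esub> g = (\<lambda>x\<in>X. f x \<oplus>\<^bsub>M\<^esub> g x)"
  "f \<star>\<^bsub>direct_sum_copies X M\<^esub> a = (\<lambda>x\<in>X. f x \<star>\<^bsub>M\<^esub> a)"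
  by (simp_all add: direct_sum_copies_def)

lemma carrier_direct_sum_copies:
  "f \<in> carrier (direct_sum_copies X M) \<longleftrightarrow>
    f \<in> X \<rightarrow>\<^sub>E carrier M \<and> finite {x \<in> X. f x \<noteq> \<zero>\<^bsub>M\<^esub>}"
  by (simp add: direct_sum_copies_def)

lemma direct_sum_copies_coord:
  "\<lbrakk>f \<in> carrier (direct_sum_copies X M); x \<in> X\<rbrakk> \<Longrightarrow> f x \<in> carrier M"
  by (auto simp: carrier_direct_sum_copies)

lemma direct_sum_copies_outside:
  "\<lbrakk>f \<in> carrier (direct_sum_copies X M); x \<notin> X\<rbrakk> \<Longrightarrow> f x = undefined"
  unfolding carrier_direct_sum_copies using PiE_arb by fastforce

lemma direct_sum_copies_eqI:
  assumes "f \<in> carrier (direct_sum_copies X M)" "g \<in> carrier (direct_sum_copies X M)"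
    and "\<And>x. x \<in> X \<Longrightarrow> f x = g x"
  shows "f = g"
  using assms by (auto simp: carrier_direct_sum_copies intro: PiE_ext)

lemma direct_sum_copies_restrict:
  assumes "\<And>x. x \<in> X \<Longrightarrow> f x \<in> carrier M" "finite F" "\<And>x. x \<in> X - F \<Longrightarrow> f x = \<zero>\<^bsub>M\<^esub>"
  shows "(\<lambda>x\<in>X. f x) \<in> carrier (direct_sum_copies X M)"
proof -
  have "{x \<in> X. restrict f X x \<noteq> \<zero>\<^bsub>M\<^esub>} \<subseteq> F" using assms(3) by auto
  then have "finite {x \<in> X. restrict f X x \<noteq> \<zero>\<^bsub>M\<^esub>}" using assms(2) finite_subset by blast
  moreover have "(\<lambda>x\<in>X. f x) \<in> X \<rightarrow>\<^sub>E carrier M" using assms(1) by simp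
  ultimately show ?thesis unfolding carrier_direct_sum_copies by blast
qed

lemma right_module_direct_sum_copies:
  assumes "right_module R M"
  shows "right_module R (direct_sum_copies X M)"
proof -
  interpret right_module R M by fact
  let ?S = "direct_sum_copies X M"
  have fin: "finite ({x \<in> X. f x \<noteq> \<zero>\<^bsub>M\<^esub>})" if "f \<in> carrier ?S" for f
    using that by (simp add: carrier_direct_sum_copies)
  have cl: "f \<oplus>\<^bsub>?S\<^esub> g \<in> carrier ?S" if f: "f \<in> carrier ?S" and g: "g \<in> carrier ?S" for f g
    unfolding direct_sum_copies_simps
    by (rule direct_sum_copies_restrict[where F = "{x \<in> X. f x \<noteq> \<zero>\<^bsub>M\<^esub>} \<union> {x \<in> X. g x \<noteq> \<zero>\<^bsub>M\<^esub>}"])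
      (use f g fin in \<open>auto simp: direct_sum_copies_coord\<close>)
  have clr: "f \<star>\<^bsub>?S\<^esub> a \<in> carrier ?S" if f: "f \<in> carrier ?S" and a: "a \<in> carrier R" for f a
    unfolding direct_sum_copies_simps
    by (rule direct_sum_copies_restrict[where F = "{x \<in> X. f x \<noteq> \<zero>\<^bsub>M\<^esub>}"])
      (use f a fin in \<open>auto simp: direct_sum_copies_coord\<close>)
  have z: "\<zero>\<^bsub>?S\<^esub> \<in> carrier ?S"
    unfolding direct_sum_copies_simps by (rule direct_sum_copies_restrict[where F = "{}"]) auto
  note eqI = direct_sum_copies_eqI[where M = M and X = X]
  note co = direct_sum_copies_coord[where M = M and X = X]
  have "abelian_group ?S"
  proof (rule abelian_groupI)
    fix f g h assume f: "f \<in> carrier ?S" and g: "g \<in> carrier ?S" and h: "h \<in> carrier ?S"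
    show "f \<oplus>\<^bsub>?S\<^esub> g \<oplus>\<^bsub>?S\<^esub> h = f \<oplus>\<^bsub>?S\<^esub> (g \<oplus>\<^bsub>?S\<^esub> h)"
      by (rule eqI) (use f g h in \<open>simp_all add: cl del: direct_sum_copies_simps\<close>,
          use f g h in \<open>simp add: co M.a_assoc\<close>)
  next
    fix f g assume f: "f \<in> carrier ?S" and g: "g \<in> carrier ?S"
    show "f \<oplus>\<^bsub>?S\<^esub> g = g \<oplus>\<^bsub>?S\<^esub> f"
      by (rule eqI) (use f g in \<open>simp_all add: cl del: direct_sum_copies_simps\<close>,
          use f g in \<open>simp add: co M.a_comm\<close>)
  next
    fix f assume f: "f \<in> carrier ?S"
    show "\<zero>\<^bsub>?S\<^esub> \<oplus>\<^bsub>?S\<^esub> f = f"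
      by (rule eqI) (use f z in \<open>simp_all add: cl del: direct_sum_copies_simps\<close>,
          use f in \<open>simp add: co\<close>)
    have n: "(\<lambda>x\<in>X. \<ominus>\<^bsub>M\<^esub> f x) \<in> carrier ?S"
      by (rule direct_sum_copies_restrict[where F = "{x \<in> X. f x \<noteq> \<zero>\<^bsub>M\<^esub>}"])
        (use f fin in \<open>auto simp: co\<close>)
    have "(\<lambda>x\<in>X. \<ominus>\<^bsub>M\<^esub> f x) \<oplus>\<^bsub>?S\<^esub> f = \<zero>\<^bsub>?S\<^esub>"
      by (rule eqI) (use f n z in \<open>simp_all add: cl del: direct_sum_copies_simps\<close>,
          use f in \<open>simp add: co M.l_neg\<close>)
    then show "\<exists>g\<in>carrier ?S. g \<oplus>\<^bsub>?S\<^esub> f = \<zero>\<^bsub>?S\<^esub>" using n by blast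
  qed (fact cl z)+
  moreover have "right_module_axioms R ?S"
  proof (unfold_locales)
    fix f a assume f: "f \<in> carrier ?S" and a: "a \<in> carrier R"
    show "f \<star>\<^bsub>?S\<^esub> a \<in> carrier ?S" by (rule clr[OF f a])
  next
    fix f g a assume f: "f \<in> carrier ?S" and g: "g \<in> carrier ?S" and a: "a \<in> carrier R"
    show "(f \<oplus>\<^bsub>?S\<^esub> g) \<star>\<^bsub>?S\<^esub> a = f \<star>\<^bsub>?S\<^esub> a \<oplus>\<^bsub>?S\<^esub> g \<star>\<^bsub>?S\<^esub> a"
      by (rule eqI) (use f g a in \<open>simp_all add: cl clr del: direct_sum_copies_simps\<close>,
          use f g a in \<open>simp add: co ract_l_distr\<close>)
  next
    fix f a b assume f: "f \<in> carrier ?S" and a: "a \<in> carrier R" and b: "b \<in> carrier R"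
    show "f \<star>\<^bsub>?S\<^esub> (a \<oplus>\<^bsub>R\<^esub> b) = f \<star>\<^bsub>?S\<^esub> a \<oplus>\<^bsub>?S\<^esub> f \<star>\<^bsub>?S\<^esub> b"
      by (rule eqI) (use f a b in \<open>simp_all add: cl clr del: direct_sum_copies_simps\<close>,
          use f a b in \<open>simp add: co ract_r_distr\<close>)
    show "f \<star>\<^bsub>?S\<^esub> (a \<otimes>\<^bsub>R\<^esub> b) = f \<star>\<^bsub>?S\<^esub> a \<star>\<^bsub>?S\<^esub> b"
      by (rule eqI) (use f a b in \<open>simp_all add: cl clr del: direct_sum_copies_simps\<close>,
          use f a b in \<open>simp add: co ract_assoc\<close>)
  next
    fix f assume f: "f \<in> carrier ?S"
    show "f \<star>\<^bsub>?S\<^esub> \<one>\<^bsub>R\<^esub> = f"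
      by (rule eqI) (use f in \<open>simp_all add: cl clr del: direct_sum_copies_simps\<close>,
          use f in \<open>simp add: co\<close>)
  qed
  ultimately show ?thesis by (intro right_module.intro R.ring_axioms)
qed

lemma direct_sum_copies_proj:
  "x \<in> X \<Longrightarrow> (\<lambda>f. f x) \<in> rmod_hom R (direct_sum_copies X M) M"
  by (rule rmod_homI) (auto simp: direct_sum_copies_coord)

lemma direct_sum_copies_hom_into:
  assumes "\<And>x. x \<in> X \<Longrightarrow> c x \<in> rmod_hom R A M"
    and "\<And>v. v \<in> carrier A \<Longrightarrow> finite {x \<in> X. c x v \<noteq> \<zero>\<^bsub>M\<^esub>}"
  shows "(\<lambda>v. \<lambda>x\<in>X. c x v) \<in> rmod_hom R A (direct_sum_copies X M)"
proof (rule rmod_homI)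
  fix v assume v: "v \<in> carrier A"
  show "(\<lambda>x\<in>X. c x v) \<in> carrier (direct_sum_copies X M)"
    by (rule direct_sum_copies_restrict[OF _ assms(2)[OF v]])
      (use v rmod_homD(1)[OF assms(1)] in auto)
qed (auto simp: rmod_homD(2,3)[OF assms(1)] intro!: restrict_ext)

text \<open>For injective \<open>f\<close>, the maps \<open>push\<close> and \<open>pull\<close> make the direct sum over \<open>X\<close> a retract of
  the one over \<open>Y\<close>. Inclusions of blocks of coordinates, reindexings and restrictions to a finite
  support are all instances.\<close>

definition push :: "('x \<Rightarrow> 'y) \<Rightarrow> 'x set \<Rightarrow> 'y set \<Rightarrow> ('r, 'a, 'm) rmodule_scheme \<Rightarrow> ('x \<Rightarrow> 'a) \<Rightarrow> 'y \<Rightarrow> 'a"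
  where "push f X Y M g = (\<lambda>y\<in>Y. if y \<in> f ` X then g (inv_into X f y) else \<zero>\<^bsub>M\<^esub>)"

definition pull :: "('x \<Rightarrow> 'y) \<Rightarrow> 'x set \<Rightarrow> ('y \<Rightarrow> 'a) \<Rightarrow> 'x \<Rightarrow> 'a"
  where "pull f X g = (\<lambda>x\<in>X. g (f x))"

lemma push_image: "\<lbrakk>inj_on f X; f ` X \<subseteq> Y; x \<in> X\<rbrakk> \<Longrightarrow> push f X Y M g (f x) = g x"
  by (auto simp: push_def)

lemma push_outside: "\<lbrakk>y \<in> Y; y \<notin> f ` X\<rbrakk> \<Longrightarrow> push f X Y M g y = \<zero>\<^bsub>M\<^esub>"
  by (auto simp: push_def)

lemma pull_apply: "x \<in> X \<Longrightarrow> pull f X g x = g (f x)"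
  by (simp add: pull_def)

lemma push_hom:
  assumes M: "right_module R M" and f: "inj_on f X" "f ` X \<subseteq> Y"
  shows "push f X Y M \<in> rmod_hom R (direct_sum_copies X M) (direct_sum_copies Y M)"
proof -
  interpret right_module R M by fact
  note co = direct_sum_copies_coord[where M = M and X = X]
  show ?thesis
  proof (rule rmod_homI)
    fix g assume g: "g \<in> carrier (direct_sum_copies X M)"
    have "finite (f ` {x \<in> X. g x \<noteq> \<zero>\<^bsub>M\<^esub>})" using g by (simp add: carrier_direct_sum_copies)
    then show "push f X Y M g \<in> carrier (direct_sum_copies Y M)"
      unfolding push_def by (rule direct_sum_copies_restrict[rotated]) (use g f in \<open>auto simp: co\<close>)
  next
    fix g h assume g: "g \<in> carrier (direct_sum_copies X M)" "h \<in> carrier (direct_sum_copies X M)"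
    show "push f X Y M (g \<oplus>\<^bsub>direct_sum_copies X M\<^esub> h) =
      push f X Y M g \<oplus>\<^bsub>direct_sum_copies Y M\<^esub> push f X Y M h"
      using f(1) by (auto simp: push_def intro!: restrict_ext)
  next
    fix g a assume g: "g \<in> carrier (direct_sum_copies X M)" "a \<in> carrier R"
    show "push f X Y M (g \<star>\<^bsub>direct_sum_copies X M\<^esub> a) = push f X Y M g \<star>\<^bsub>direct_sum_copies Y M\<^esub> a"
      using f(1) g(2) by (auto simp: push_def intro!: restrict_ext)
  qed
qed

lemma pull_hom:
  assumes f: "inj_on f X" "f ` X \<subseteq> Y"
  shows "pull f X \<in> rmod_hom R (direct_sum_copies Y M) (direct_sum_copies X M)"
  unfolding pull_def
proof (rule direct_sum_copies_hom_into)
  fix x assume "x \<in> X"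
  then show "(\<lambda>g. g (f x)) \<in> rmod_hom R (direct_sum_copies Y M) M"
    using f(2) by (intro direct_sum_copies_proj) auto
next
  fix g assume g: "g \<in> carrier (direct_sum_copies Y M)"
  have "finite (f -` {y \<in> Y. g y \<noteq> \<zero>\<^bsub>M\<^esub>} \<inter> X)"
    using g f(1) by (intro finite_vimage_IntI) (simp_all add: carrier_direct_sum_copies)
  then show "finite {x \<in> X. g (f x) \<noteq> \<zero>\<^bsub>M\<^esub>}"
    by (rule rev_finite_subset) (use f(2) in auto)
qed

lemma pull_push:
  assumes f: "inj_on f X" "f ` X \<subseteq> Y" and g: "g \<in> carrier (direct_sum_copies X M)"
  shows "pull f X (push f X Y M g) = g"
proof
  fix x show "pull f X (push f X Y M g) x = g x"
    using f g by (cases "x \<in> X") (simp_all add: pull_def push_image direct_sum_copies_outside[OF g])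
qed

lemma push_pull:
  assumes f: "inj_on f X" "f ` X \<subseteq> Y" and g: "g \<in> carrier (direct_sum_copies Y M)"
    and 0: "\<And>y. y \<in> Y - f ` X \<Longrightarrow> g y = \<zero>\<^bsub>M\<^esub>"
  shows "push f X Y M (pull f X g) = g"
proof
  fix y show "push f X Y M (pull f X g) y = g y"
  proof (cases "y \<in> Y")
    case False then show ?thesis by (simp add: push_def direct_sum_copies_outside[OF g])
  next
    case True
    then show ?thesis using f 0 by (auto simp: push_def pull_def inv_into_into)
  qed
qed

definition single :: "'x \<Rightarrow> 'x set \<Rightarrow> ('r, 'a, 'm) rmodule_scheme \<Rightarrow> 'a \<Rightarrow> 'x \<Rightarrow> 'a"
  where "single x X M m = (\<lambda>y\<in>X. if y = x then m else \<zero>\<^bsub>M\<^esub>)"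

lemma single_hom:
  assumes "right_module R M"
  shows "single x X M \<in> rmod_hom R M (direct_sum_copies X M)"
proof -
  interpret right_module R M by fact
  show ?thesis unfolding single_def
  proof (rule direct_sum_copies_hom_into)
    fix y show "(\<lambda>m. if y = x then m else \<zero>\<^bsub>M\<^esub>) \<in> rmod_hom R M M"
      by (rule rmod_homI) auto
  next
    fix m show "finite {y \<in> X. (if y = x then m else \<zero>\<^bsub>M\<^esub>) \<noteq> \<zero>\<^bsub>M\<^esub>}"
      by (rule finite_subset[of _ "{x}"]) auto
  qed
qed

text \<open>The decomposition \<open>M\<^sup>n\<^sup>+\<^sup>1 = M\<^sup>n \<oplus> M\<close>, on which all inductions on the number of
  copies below rest.\<close>

lemma direct_sum_copies_Suc:
  assumes M: "right_module R M" and v: "v \<in> carrier (direct_sum_copies {..<Suc n} M)"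
  shows "v = push id {..<n} {..<Suc n} M (pull id {..<n} v)
           \<oplus>\<^bsub>direct_sum_copies {..<Suc n} M\<^esub> single n {..<Suc n} M (v n)"
proof -
  interpret right_module R M by fact
  interpret S: right_module R "direct_sum_copies {..<Suc n} M"
    by (rule right_module_direct_sum_copies[OF M])
  have id: "inj_on id {..<n}" "id ` {..<n} \<subseteq> {..<Suc n}" by auto
  note c = direct_sum_copies_coord[OF v]
  have p: "pull id {..<n} v \<in> carrier (direct_sum_copies {..<n} M)"
    using rmod_homD(1)[OF pull_hom[OF id] v] .
  show ?thesis
  proof (rule direct_sum_copies_eqI[OF v])
    show "push id {..<n} {..<Suc n} M (pull id {..<n} v)
           \<oplus>\<^bsub>direct_sum_copies {..<Suc n} M\<^esub> single n {..<Suc n} M (v n)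
          \<in> carrier (direct_sum_copies {..<Suc n} M)"
      by (intro S.M.a_closed rmod_homD(1)[OF push_hom[OF M id] p] rmod_homD(1)[OF single_hom[OF M]] c) simp
    fix j assume j: "j \<in> {..<Suc n}"
    show "v j = (push id {..<n} {..<Suc n} M (pull id {..<n} v)
           \<oplus>\<^bsub>direct_sum_copies {..<Suc n} M\<^esub> single n {..<Suc n} M (v n)) j"
    proof (cases "j = n")
      case True then show ?thesis using c[OF j] by (simp add: single_def push_outside)
    next
      case False
      then have "j < n" using j by simp
      then show ?thesis using c[OF j] push_image[OF id, of j M "pull id {..<n} v"] False
        by (simp add: single_def pull_apply)
    qed
  qed
qed

section \<open>The ring as a right module over itself\<close>

definition reg :: "('r, 'k) ring_scheme \<Rightarrow> ('r, 'r) rmodule"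
  where "reg R = \<lparr>carrier = carrier R, mult = undefined, one = undefined,
    zero = \<zero>\<^bsub>R\<^esub>, add = (\<oplus>\<^bsub>R\<^esub>), ract = (\<otimes>\<^bsub>R\<^esub>)\<rparr>"

lemma reg_simps [simp]:
  "carrier (reg R) = carrier R" "\<zero>\<^bsub>reg R\<^esub> = \<zero>\<^bsub>R\<^esub>"
  "x \<oplus>\<^bsub>reg R\<^esub> y = x \<oplus>\<^bsub>R\<^esub> y" "x \<star>\<^bsub>reg R\<^esub> a = x \<otimes>\<^bsub>R\<^esub> a"
  by (simp_all add: reg_def)

lemma right_module_reg:
  assumes "ring R" shows "right_module R (reg R)"
proof -
  interpret ring R by fact
  have "abelian_group (reg R)"
    by (rule abelian_groupI) (auto simp: a_ac intro!: bexI[of _ "\<ominus>\<^bsub>R\<^esub> _"] l_neg)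
  moreover have "right_module_axioms R (reg R)"
    by unfold_locales (auto simp: l_distr r_distr m_assoc)
  ultimately show ?thesis by (intro right_module.intro ring_axioms)
qed

section \<open>Recognizing direct limits by cocones\<close>

text \<open>The conditions that make a compatible family of maps \<open>\<phi> i\<close> a direct limit. Only elements
  mapping to zero are required to die at a later stage, since two elements with the same image can be
  subtracted.\<close>

definition dirlim_cocone ::
    "('r, 'k) ring_scheme \<Rightarrow> 'i set \<Rightarrow> 'i rel \<Rightarrow> ('i \<Rightarrow> ('r, 'a) rmodule) \<Rightarrow> ('i \<Rightarrow> 'i \<Rightarrow> 'a \<Rightarrow> 'a) \<Rightarrow>
      ('r, 'n) rmodule \<Rightarrow> ('i \<Rightarrow> 'a \<Rightarrow> 'n) \<Rightarrow> bool"
  where "dirlim_cocone R I r D f N \<phi> \<longleftrightarrow>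
    (\<forall>i\<in>I. \<phi> i \<in> rmod_hom R (D i) N) \<and>
    (\<forall>(i, j)\<in>r. \<forall>x\<in>carrier (D i). \<phi> j (f i j x) = \<phi> i x) \<and>
    (\<forall>y\<in>carrier N. \<exists>i\<in>I. \<exists>x\<in>carrier (D i). \<phi> i x = y) \<and>
    (\<forall>i\<in>I. \<forall>x\<in>carrier (D i). \<phi> i x = \<zero>\<^bsub>N\<^esub> \<longrightarrow> (\<exists>j. (i, j) \<in> r \<and> f i j x = \<zero>\<^bsub>D j\<^esub>))"

lemma dirlim_coconeD:
  assumes "dirlim_cocone R I r D f N \<phi>"
  shows "i \<in> I \<Longrightarrow> \<phi> i \<in> rmod_hom R (D i) N"
    and "\<lbrakk>(i, j) \<in> r; x \<in> carrier (D i)\<rbrakk> \<Longrightarrow> \<phi> j (f i j x) = \<phi> i x"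
    and "y \<in> carrier N \<Longrightarrow> \<exists>i\<in>I. \<exists>x\<in>carrier (D i). \<phi> i x = y"
    and "\<lbrakk>i \<in> I; x \<in> carrier (D i); \<phi> i x = \<zero>\<^bsub>N\<^esub>\<rbrakk> \<Longrightarrow> \<exists>j. (i, j) \<in> r \<and> f i j x = \<zero>\<^bsub>D j\<^esub>"
  using assms by (auto simp: dirlim_cocone_def)

locale directed_system =
  fixes R :: "('r, 'k) ring_scheme" and I :: "'i set" and r and D :: "'i \<Rightarrow> ('r, 'a) rmodule" and f
  assumes system: "direct_system R I r D f"
begin

lemma order:
  shows in_index: "(i, j) \<in> r \<Longrightarrow> i \<in> I \<and> j \<in> I"
    and idx_refl: "i \<in> I \<Longrightarrow> (i, i) \<in> r"
    and idx_trans: "\<lbrakk>(i, j) \<in> r; (j, k) \<in> r\<rbrakk> \<Longrightarrow> (i, k) \<in> r"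
    and upper_bound: "\<lbrakk>i \<in> I; j \<in> I\<rbrakk> \<Longrightarrow> \<exists>k. (i, k) \<in> r \<and> (j, k) \<in> r"
proof -
  have "directed_poset I r" using system by (simp add: direct_system_def)
  then have 1: "r \<subseteq> I \<times> I" "refl_on I r" "trans r"
    and 2: "\<forall>i\<in>I. \<forall>j\<in>I. \<exists>k. (i, k) \<in> r \<and> (j, k) \<in> r"
    by (auto simp: directed_poset_def partial_order_on_def preorder_on_def)
  show "(i, j) \<in> r \<Longrightarrow> i \<in> I \<and> j \<in> I" using 1(1) by blast
  show "i \<in> I \<Longrightarrow> (i, i) \<in> r" using 1(2) by (auto dest: refl_onD)
  show "\<lbrakk>(i, j) \<in> r; (j, k) \<in> r\<rbrakk> \<Longrightarrow> (i, k) \<in> r" using 1(3) by (auto dest: transD)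
  show "\<lbrakk>i \<in> I; j \<in> I\<rbrakk> \<Longrightarrow> \<exists>k. (i, k) \<in> r \<and> (j, k) \<in> r" using 2 by blast
qed

lemma modules: "i \<in> I \<Longrightarrow> right_module R (D i)"
  and maps: "(i, j) \<in> r \<Longrightarrow> f i j \<in> rmod_hom R (D i) (D j)"
  and map_id: "\<lbrakk>i \<in> I; x \<in> carrier (D i)\<rbrakk> \<Longrightarrow> f i i x = x"
  and map_comp: "\<lbrakk>(i, j) \<in> r; (j, k) \<in> r; x \<in> carrier (D i)\<rbrakk> \<Longrightarrow> f j k (f i j x) = f i k x"
  using system by (auto simp: direct_system_def)

lemma map_closed: "\<lbrakk>(i, j) \<in> r; x \<in> carrier (D i)\<rbrakk> \<Longrightarrow> f i j x \<in> carrier (D j)"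
  using rmod_homD(1)[OF maps] .

abbreviation E where "E \<equiv> dirlim_rel I r D f"
definition cls where "cls i x = E `` {(i, x)}"

lemma E_iff:
  "((i, x), (j, y)) \<in> E \<longleftrightarrow> i \<in> I \<and> x \<in> carrier (D i) \<and> j \<in> I \<and> y \<in> carrier (D j) \<and>
    (\<exists>k. (i, k) \<in> r \<and> (j, k) \<in> r \<and> f i k x = f j k y)"
  by (simp add: dirlim_rel_def)

lemma equiv_E: "equiv (SIGMA i:I. carrier (D i)) E"
proof (rule equivI)
  show "E \<subseteq> (SIGMA i:I. carrier (D i)) \<times> (SIGMA i:I. carrier (D i))"
    by (auto simp: dirlim_rel_def)
  show "refl_on (SIGMA i:I. carrier (D i)) E"
    by (rule refl_onI) (use idx_refl in \<open>auto simp: E_iff, blast+\<close>)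
  show "sym E" by (rule symI) (auto simp: E_iff, metis)
  show "trans E"
  proof (rule transI, clarify)
    fix i x j y k z assume 1: "((i, x), (j, y)) \<in> E" and 2: "((j, y), (k, z)) \<in> E"
    obtain l where l: "(i, l) \<in> r" "(j, l) \<in> r" "f i l x = f j l y" using 1 by (auto simp: E_iff)
    obtain m where m: "(j, m) \<in> r" "(k, m) \<in> r" "f j m y = f k m z" using 2 by (auto simp: E_iff)
    obtain n where n: "(l, n) \<in> r" "(m, n) \<in> r" using upper_bound in_index l(1) m(1) by meson
    have c: "x \<in> carrier (D i)" "y \<in> carrier (D j)" "z \<in> carrier (D k)" "i \<in> I" "k \<in> I"
      using 1 2 by (auto simp: E_iff)
    have "f i n x = f l n (f i l x)" using map_comp[OF l(1) n(1) c(1)] by simp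
    also have "\<dots> = f m n (f j m y)"
      unfolding l(3) using map_comp[OF l(2) n(1) c(2)] map_comp[OF m(1) n(2) c(2)] by simp
    also have "\<dots> = f k n z" unfolding m(3) using map_comp[OF m(2) n(2) c(3)] by simp
    finally show "((i, x), (k, z)) \<in> E"
      using c idx_trans[OF l(1) n(1)] idx_trans[OF m(2) n(2)] by (auto simp: E_iff)
  qed
qed

lemma cls_eq_iff:
  assumes "i \<in> I" "x \<in> carrier (D i)" "j \<in> I" "y \<in> carrier (D j)"
  shows "cls i x = cls j y \<longleftrightarrow> (\<exists>k. (i, k) \<in> r \<and> (j, k) \<in> r \<and> f i k x = f j k y)"
  unfolding cls_def using assms by (subst eq_equiv_class_iff[OF equiv_E]) (auto simp: E_iff)

lemma cls_map:
  assumes "(i, j) \<in> r" "x \<in> carrier (D i)" shows "cls j (f i j x) = cls i x"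
  using assms map_closed in_index[OF assms(1)] idx_refl map_id map_comp
  by (subst cls_eq_iff) (auto intro!: exI[of _ j])

lemma in_cls_iff:
  assumes "i \<in> I" "x \<in> carrier (D i)"
  shows "(j, y) \<in> cls i x \<longleftrightarrow> j \<in> I \<and> y \<in> carrier (D j) \<and> cls j y = cls i x"
proof -
  have "(j, y) \<in> cls i x \<longleftrightarrow> ((i, x), (j, y)) \<in> E" by (simp add: cls_def)
  also have "\<dots> \<longleftrightarrow> j \<in> I \<and> y \<in> carrier (D j) \<and> cls j y = cls i x"
    using assms cls_eq_iff[of j y i x] unfolding E_iff by metis
  finally show ?thesis .
qed

abbreviation L where "L \<equiv> direct_limit I r D f"

lemma carrier_L: "carrier L = (\<Union>i\<in>I. cls i ` carrier (D i))"
  by (auto simp: direct_limit_def quotient_def cls_def)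

lemma add_cls:
  assumes i: "i \<in> I" "x \<in> carrier (D i)" "y \<in> carrier (D i)"
  shows "cls i x \<oplus>\<^bsub>L\<^esub> cls i y = cls i (x \<oplus>\<^bsub>D i\<^esub> y)"
proof -
  have *: "cls k (f j k x' \<oplus>\<^bsub>D k\<^esub> f l k y') = cls i (x \<oplus>\<^bsub>D i\<^esub> y)"
    if jx: "(j, x') \<in> cls i x" and ly: "(l, y') \<in> cls i y" and k: "(j, k) \<in> r" "(l, k) \<in> r" for j x' l y' k
  proof -
    have jx': "j \<in> I" "x' \<in> carrier (D j)" "cls j x' = cls i x" using jx in_cls_iff[OF i(1,2)] by auto
    have ly': "l \<in> I" "y' \<in> carrier (D l)" "cls l y' = cls i y" using ly in_cls_iff[OF i(1,3)] by auto
    have kI: "k \<in> I" using in_index[OF k(1)] by simp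
    note c = map_closed[OF k(1) jx'(2)] map_closed[OF k(2) ly'(2)]
    have "cls k (f j k x') = cls i x" using cls_map[OF k(1) jx'(2)] jx'(3) by simp
    then obtain m where m: "(k, m) \<in> r" "(i, m) \<in> r" "f k m (f j k x') = f i m x"
      using cls_eq_iff[OF kI c(1) i(1,2)] by auto
    have "cls k (f l k y') = cls i y" using cls_map[OF k(2) ly'(2)] ly'(3) by simp
    then obtain m' where m': "(k, m') \<in> r" "(i, m') \<in> r" "f k m' (f l k y') = f i m' y"
      using cls_eq_iff[OF kI c(2) i(1,3)] by auto
    obtain n where n: "(m, n) \<in> r" "(m', n) \<in> r" using upper_bound in_index m(1) m'(1) by meson
    have kn: "(k, n) \<in> r" and in_: "(i, n) \<in> r" using idx_trans m n by blast+
    have 1: "f k n (f j k x') = f i n x"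
      using map_comp[OF m(1) n(1) c(1)] map_comp[OF m(2) n(1) i(2)] m(3) by simp
    have 2: "f k n (f l k y') = f i n y"
      using map_comp[OF m'(1) n(2) c(2)] map_comp[OF m'(2) n(2) i(3)] m'(3) by simp
    interpret Dk: right_module R "D k" by (rule modules[OF kI])
    interpret Di: right_module R "D i" by (rule modules[OF i(1)])
    have "f k n (f j k x' \<oplus>\<^bsub>D k\<^esub> f l k y') = f i n (x \<oplus>\<^bsub>D i\<^esub> y)"
      using rmod_homD(2)[OF maps[OF kn] c] rmod_homD(2)[OF maps[OF in_] i(2,3)] 1 2 by simp
    then show ?thesis using cls_eq_iff[OF kI _ i(1)] kn in_ c i by blast
  qed
  have ex: "\<exists>j x' l y' k. (j, x') \<in> cls i x \<and> (l, y') \<in> cls i y \<and> (j, k) \<in> r \<and> (l, k) \<in> r"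
    using in_cls_iff[OF i(1,2)] in_cls_iff[OF i(1,3)] i idx_refl by blast
  have "cls i x \<oplus>\<^bsub>L\<^esub> cls i y = (\<Union>(j, x')\<in>cls i x. \<Union>(l, y')\<in>cls i y. \<Union>k\<in>{k. (j, k) \<in> r \<and> (l, k) \<in> r}.
       cls k (f j k x' \<oplus>\<^bsub>D k\<^esub> f l k y'))"
    by (simp add: direct_limit_def cls_def)
  also have "\<dots> = (\<Union>(j, x')\<in>cls i x. \<Union>(l, y')\<in>cls i y. \<Union>k\<in>{k. (j, k) \<in> r \<and> (l, k) \<in> r}.
       cls i (x \<oplus>\<^bsub>D i\<^esub> y))"
    using * by (intro SUP_cong refl) (auto intro!: SUP_cong)
  also have "\<dots> = cls i (x \<oplus>\<^bsub>D i\<^esub> y)"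
  proof (rule equalityI)
    obtain j x' l y' k where w: "(j, x') \<in> cls i x" "(l, y') \<in> cls i y" "(j, k) \<in> r \<and> (l, k) \<in> r"
      using ex by blast
    show "cls i (x \<oplus>\<^bsub>D i\<^esub> y) \<subseteq> (\<Union>(j, x')\<in>cls i x. \<Union>(l, y')\<in>cls i y.
        \<Union>k\<in>{k. (j, k) \<in> r \<and> (l, k) \<in> r}. cls i (x \<oplus>\<^bsub>D i\<^esub> y))"
      by (rule subsetI, rule UN_I[OF w(1)], unfold case_prod_conv, rule UN_I[OF w(2)],
          unfold case_prod_conv, rule UN_I[of k]) (use w(3) in simp_all)
  qed (auto split: if_splits)
  finally show ?thesis .
qed

lemma ract_cls:
  assumes i: "i \<in> I" "x \<in> carrier (D i)" "a \<in> carrier R"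
  shows "cls i x \<star>\<^bsub>L\<^esub> a = cls i (x \<star>\<^bsub>D i\<^esub> a)"
proof -
  interpret Di: right_module R "D i" by (rule modules[OF i(1)])
  have *: "cls j (y \<star>\<^bsub>D j\<^esub> a) = cls i (x \<star>\<^bsub>D i\<^esub> a)" if "(j, y) \<in> cls i x" for j y
  proof -
    have jy: "j \<in> I" "y \<in> carrier (D j)" "cls j y = cls i x" using that in_cls_iff[OF i(1,2)] by auto
    interpret Dj: right_module R "D j" by (rule modules[OF jy(1)])
    obtain k where k: "(j, k) \<in> r" "(i, k) \<in> r" "f j k y = f i k x"
      using jy(3) cls_eq_iff[OF jy(1,2) i(1,2)] by auto
    have "f j k (y \<star>\<^bsub>D j\<^esub> a) = f i k (x \<star>\<^bsub>D i\<^esub> a)"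
      using rmod_homD(3)[OF maps[OF k(1)] jy(2) i(3)] rmod_homD(3)[OF maps[OF k(2)] i(2,3)] k(3) by simp
    then show ?thesis using cls_eq_iff[OF jy(1) _ i(1)] k jy i by blast
  qed
  have "(i, x) \<in> cls i x" using in_cls_iff[OF i(1,2)] i by blast
  moreover have "cls i x \<star>\<^bsub>L\<^esub> a = (\<Union>(j, y)\<in>cls i x. cls j (y \<star>\<^bsub>D j\<^esub> a))"
    by (simp add: direct_limit_def cls_def)
  moreover have "\<dots> = (\<Union>(j, y)\<in>cls i x. cls i (x \<star>\<^bsub>D i\<^esub> a))"
    using * by (intro SUP_cong refl) auto
  ultimately show ?thesis by auto
qed

lemma isomorphic_imp_cocone:
  fixes N :: "('r, 'n) rmodule"
  assumes N: "right_module R N" and iso: "rmod_isomorphic R N L"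
  shows "\<exists>\<phi>. dirlim_cocone R I r D f N \<phi>"
proof -
  obtain g where g: "g \<in> rmod_hom R N L" and bij: "bij_betw g (carrier N) (carrier L)"
    using iso by (auto simp: rmod_isomorphic_def)
  interpret N: right_module R N by fact
  define \<phi> where "\<phi> i x = inv_into (carrier N) g (cls i x)" for i x
  have cl: "cls i x \<in> g ` carrier N" if "i \<in> I" "x \<in> carrier (D i)" for i x
    using bij that by (auto simp: bij_betw_def carrier_L)
  have \<phi>c: "\<phi> i x \<in> carrier N" and g\<phi>: "g (\<phi> i x) = cls i x" if "i \<in> I" "x \<in> carrier (D i)" for i x
    using cl[OF that] by (auto simp: \<phi>_def inv_into_into f_inv_into_f)
  have eqI: "\<phi> i x = n" if "i \<in> I" "x \<in> carrier (D i)" "n \<in> carrier N" "g n = cls i x" for i x n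
    using that bij by (auto simp: \<phi>_def bij_betw_def inv_into_f_eq)
  have hom: "\<phi> i \<in> rmod_hom R (D i) N" if i: "i \<in> I" for i
  proof -
    interpret Di: right_module R "D i" by (rule modules[OF i])
    show ?thesis
      by (rule rmod_homI; (rule eqI)?)
        (simp_all add: i \<phi>c rmod_homD[OF g] g\<phi> add_cls ract_cls)
  qed
  have "dirlim_cocone R I r D f N \<phi>"
    unfolding dirlim_cocone_def
  proof (intro conjI ballI impI)
    fix i assume "i \<in> I" then show "\<phi> i \<in> rmod_hom R (D i) N" by (rule hom)
  next
    fix p assume "p \<in> r"
    then show "case p of (i, j) \<Rightarrow> \<forall>x\<in>carrier (D i). \<phi> j (f i j x) = \<phi> i x"
      by (auto simp: \<phi>_def cls_map)
  next
    fix y assume y: "y \<in> carrier N"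
    then have "g y \<in> carrier L" using rmod_homD(1)[OF g] by blast
    then obtain i x where "i \<in> I" "x \<in> carrier (D i)" "g y = cls i x" by (auto simp: carrier_L)
    then show "\<exists>i\<in>I. \<exists>x\<in>carrier (D i). \<phi> i x = y" using eqI y by blast
  next
    fix i x assume i: "i \<in> I" and x: "x \<in> carrier (D i)" and 0: "\<phi> i x = \<zero>\<^bsub>N\<^esub>"
    interpret Di: right_module R "D i" by (rule modules[OF i])
    have "\<phi> i \<zero>\<^bsub>D i\<^esub> = \<zero>\<^bsub>N\<^esub>" by (rule rmod_hom_zero[OF hom[OF i] modules[OF i] N])
    then have "cls i x = cls i \<zero>\<^bsub>D i\<^esub>" using g\<phi>[OF i x] g\<phi>[OF i Di.M.zero_closed] 0 by simp
    then obtain k where k: "(i, k) \<in> r" "f i k x = f i k \<zero>\<^bsub>D i\<^esub>"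
      using cls_eq_iff[OF i x i Di.M.zero_closed] by auto
    moreover have "f i k \<zero>\<^bsub>D i\<^esub> = \<zero>\<^bsub>D k\<^esub>"
      using rmod_hom_zero[OF maps[OF k(1)]] modules in_index[OF k(1)] by blast
    ultimately show "\<exists>j. (i, j) \<in> r \<and> f i j x = \<zero>\<^bsub>D j\<^esub>" by auto
  qed
  then show ?thesis by blast
qed

lemma cocone_imp_isomorphic:
  fixes N :: "('r, 'n) rmodule"
  assumes N: "right_module R N" and c: "dirlim_cocone R I r D f N \<phi>"
  shows "rmod_isomorphic R N L"
proof -
  note \<phi>hom = dirlim_coconeD(1)[OF c] and \<phi>map = dirlim_coconeD(2)[OF c]
  interpret N: right_module R N by fact
  have \<phi>c: "\<phi> i x \<in> carrier N" if "i \<in> I" "x \<in> carrier (D i)" for i x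
    using rmod_homD(1)[OF \<phi>hom] that by blast
  have key: "\<phi> i x = \<phi> j y \<longleftrightarrow> cls i x = cls j y"
    if ix: "i \<in> I" "x \<in> carrier (D i)" and jy: "j \<in> I" "y \<in> carrier (D j)" for i x j y
  proof
    assume eq: "\<phi> i x = \<phi> j y"
    obtain k where k: "(i, k) \<in> r" "(j, k) \<in> r" using upper_bound[OF ix(1) jy(1)] by auto
    have kI: "k \<in> I" using in_index[OF k(1)] by simp
    interpret Dk: right_module R "D k" by (rule modules[OF kI])
    note m = map_closed[OF k(1) ix(2)] map_closed[OF k(2) jy(2)]
    have "\<phi> k (f i k x \<ominus>\<^bsub>D k\<^esub> f j k y) = \<zero>\<^bsub>N\<^esub>"
      using rmod_hom_diff[OF \<phi>hom[OF kI] modules[OF kI] N m] \<phi>map[OF k(1) ix(2)] \<phi>map[OF k(2) jy(2)]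
        eq \<phi>c[OF jy] by (simp add: N.diff_eq_zero_iff)
    then obtain l where l: "(k, l) \<in> r" "f k l (f i k x \<ominus>\<^bsub>D k\<^esub> f j k y) = \<zero>\<^bsub>D l\<^esub>"
      using dirlim_coconeD(4)[OF c kI] m by (meson Dk.M.minus_closed)
    have lI: "l \<in> I" using in_index[OF l(1)] by simp
    interpret Dl: right_module R "D l" by (rule modules[OF lI])
    have "f k l (f i k x) = f k l (f j k y)"
      using l(2) m map_closed[OF l(1)] rmod_hom_diff[OF maps[OF l(1)] modules[OF kI] modules[OF lI] m]
      by (simp add: Dl.diff_eq_zero_iff)
    then have "f i l x = f j l y" using map_comp k l(1) ix jy by simp
    then show "cls i x = cls j y" using cls_eq_iff[OF ix jy] idx_trans k l(1) by blast
  next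
    assume "cls i x = cls j y"
    then obtain k where "(i, k) \<in> r" "(j, k) \<in> r" "f i k x = f j k y" using cls_eq_iff[OF ix jy] by auto
    then show "\<phi> i x = \<phi> j y" using \<phi>map ix jy by metis
  qed
  define P where "P y p \<longleftrightarrow> fst p \<in> I \<and> snd p \<in> carrier (D (fst p)) \<and> \<phi> (fst p) (snd p) = y" for y p
  define g where "g y = (let p = SOME p. P y p in cls (fst p) (snd p))" for y
  have g\<phi>: "g (\<phi> i x) = cls i x" if ix: "i \<in> I" "x \<in> carrier (D i)" for i x
  proof -
    define p where "p = (SOME p. P (\<phi> i x) p)"
    have "P (\<phi> i x) p" unfolding p_def by (rule someI[of _ "(i, x)"]) (simp add: P_def ix)
    then have "cls (fst p) (snd p) = cls i x" using key[of "fst p" "snd p" i x] ix by (simp add: P_def)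
    then show ?thesis by (simp only: g_def Let_def p_def[symmetric])
  qed
  have rep2: "\<exists>i\<in>I. \<exists>x\<in>carrier (D i). \<exists>x'\<in>carrier (D i). \<phi> i x = y \<and> \<phi> i x' = y'"
    if y: "y \<in> carrier N" "y' \<in> carrier N" for y y'
  proof -
    obtain i x where ix: "i \<in> I" "x \<in> carrier (D i)" "\<phi> i x = y"
      using dirlim_coconeD(3)[OF c y(1)] by blast
    obtain j x' where jx: "j \<in> I" "x' \<in> carrier (D j)" "\<phi> j x' = y'"
      using dirlim_coconeD(3)[OF c y(2)] by blast
    obtain k where k: "(i, k) \<in> r" "(j, k) \<in> r" using upper_bound[OF ix(1) jx(1)] by auto
    show ?thesis
      using \<phi>map[OF k(1) ix(2)] \<phi>map[OF k(2) jx(2)] map_closed[OF k(1) ix(2)] map_closed[OF k(2) jx(2)]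
        in_index[OF k(1)] ix(3) jx(3) by blast
  qed
  have "g \<in> rmod_hom R N L"
  proof (rule rmod_homI)
    fix y assume "y \<in> carrier N"
    then obtain i x where "i \<in> I" "x \<in> carrier (D i)" "\<phi> i x = y"
      using dirlim_coconeD(3)[OF c] by blast
    then show "g y \<in> carrier L" using g\<phi> by (auto simp: carrier_L intro!: imageI bexI[of _ i])
  next
    fix y y' assume y: "y \<in> carrier N" "y' \<in> carrier N"
    obtain i x x' where i: "i \<in> I" "x \<in> carrier (D i)" "x' \<in> carrier (D i)" "\<phi> i x = y" "\<phi> i x' = y'"
      using rep2[OF y] by blast
    interpret Di: right_module R "D i" by (rule modules[OF i(1)])
    have "y \<oplus>\<^bsub>N\<^esub> y' = \<phi> i (x \<oplus>\<^bsub>D i\<^esub> x')" using rmod_homD(2)[OF \<phi>hom] i by simp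
    then show "g (y \<oplus>\<^bsub>N\<^esub> y') = g y \<oplus>\<^bsub>L\<^esub> g y'" using g\<phi> i add_cls by auto
  next
    fix y a assume y: "y \<in> carrier N" and a: "a \<in> carrier R"
    obtain i x where i: "i \<in> I" "x \<in> carrier (D i)" "\<phi> i x = y"
      using dirlim_coconeD(3)[OF c y] by blast
    interpret Di: right_module R "D i" by (rule modules[OF i(1)])
    have "y \<star>\<^bsub>N\<^esub> a = \<phi> i (x \<star>\<^bsub>D i\<^esub> a)" using rmod_homD(3)[OF \<phi>hom] i a by simp
    then show "g (y \<star>\<^bsub>N\<^esub> a) = g y \<star>\<^bsub>L\<^esub> a" using g\<phi> i a ract_cls by auto
  qed
  moreover have "bij_betw g (carrier N) (carrier L)"
    unfolding bij_betw_def
  proof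
    show "inj_on g (carrier N)"
    proof (rule inj_onI)
      fix y y' assume y: "y \<in> carrier N" "y' \<in> carrier N" and eq: "g y = g y'"
      obtain i x x' where i: "i \<in> I" "x \<in> carrier (D i)" "x' \<in> carrier (D i)" "\<phi> i x = y" "\<phi> i x' = y'"
        using rep2[OF y] by blast
      have "cls i x = cls i x'" using eq g\<phi> i by auto
      then show "y = y'" using key[of i x i x'] i by simp
    qed
    show "g ` carrier N = carrier L"
    proof
      show "g ` carrier N \<subseteq> carrier L" using rmod_homD(1)[OF \<open>g \<in> rmod_hom R N L\<close>] by blast
      show "carrier L \<subseteq> g ` carrier N"
      proof
        fix z assume "z \<in> carrier L"
        then obtain i x where "i \<in> I" "x \<in> carrier (D i)" "z = cls i x" by (auto simp: carrier_L)
        then show "z \<in> g ` carrier N" using g\<phi>[of i x] \<phi>c[of i x] by (metis imageI)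
      qed
    qed
  qed
  ultimately show ?thesis by (auto simp: rmod_isomorphic_def)
qed

end

lemma direct_limits_iff_cocone:
  fixes N :: "('r, 'n) rmodule" and C :: "('r, 'u) rmodule set"
  shows "N \<in> direct_limits R C \<longleftrightarrow> right_module R N \<and>
    (\<exists>(I::'u set) r D f \<phi>. direct_system R I r D f \<and> (\<forall>i\<in>I. D i \<in> C) \<and> dirlim_cocone R I r D f N \<phi>)"
proof -
  have "rmod_isomorphic R N (direct_limit I r D f) \<longleftrightarrow> (\<exists>\<phi>. dirlim_cocone R I r D f N \<phi>)"
    if "direct_system R I r D f" "right_module R N"
    for I :: "'u set" and r and D :: "'u \<Rightarrow> ('r, 'u) rmodule" and f
    using directed_system.isomorphic_imp_cocone[OF directed_system.intro[OF that(1)] that(2)]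
      directed_system.cocone_imp_isomorphic[OF directed_system.intro[OF that(1)] that(2)] by blast
  then show ?thesis unfolding direct_limits_def by blast
qed

section \<open>From filtered diagrams to directed systems\<close>

text \<open>The module \<open>N\<close> is the colimit of a diagram \<open>G\<close> indexed by a filtered category, which
  unlike a poset may have several arrows between two objects. Arrows are extensional functions, so
  that arrows agreeing on all elements are equal.\<close>

locale filtered_presentation =
  fixes R :: "('r, 'k) ring_scheme" and N :: "('r, 'n) rmodule"
    and Ob :: "'o set" and G :: "'o \<Rightarrow> ('r, 'a) rmodule"
    and Mor :: "'o \<Rightarrow> 'o \<Rightarrow> ('a \<Rightarrow> 'a) set" and \<phi> :: "'o \<Rightarrow> 'a \<Rightarrow> 'n"
  assumes N: "right_module R N"
    and G: "a \<in> Ob \<Longrightarrow> right_module R (G a)"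
    and Mor_hom: "\<lbrakk>a \<in> Ob; b \<in> Ob; u \<in> Mor a b\<rbrakk> \<Longrightarrow> u \<in> rmod_hom R (G a) (G b)"
    and Mor_ext: "\<lbrakk>a \<in> Ob; b \<in> Ob; u \<in> Mor a b\<rbrakk> \<Longrightarrow> u \<in> extensional (carrier (G a))"
    and Mor_id: "a \<in> Ob \<Longrightarrow> (\<lambda>x\<in>carrier (G a). x) \<in> Mor a a"
    and Mor_comp: "\<lbrakk>a \<in> Ob; b \<in> Ob; c \<in> Ob; u \<in> Mor a b; v \<in> Mor b c\<rbrakk> \<Longrightarrow>
      compose (carrier (G a)) v u \<in> Mor a c"
    and \<phi>_hom: "a \<in> Ob \<Longrightarrow> \<phi> a \<in> rmod_hom R (G a) N"
    and \<phi>_Mor: "\<lbrakk>a \<in> Ob; b \<in> Ob; u \<in> Mor a b; x \<in> carrier (G a)\<rbrakk> \<Longrightarrow> \<phi> b (u x) = \<phi> a x"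
    and bound: "\<lbrakk>a \<in> Ob; b \<in> Ob\<rbrakk> \<Longrightarrow> \<exists>c\<in>Ob. Mor a c \<noteq> {} \<and> Mor b c \<noteq> {}"
    and coequal: "\<lbrakk>a \<in> Ob; b \<in> Ob; u \<in> Mor a b; v \<in> Mor a b\<rbrakk> \<Longrightarrow>
      \<exists>c\<in>Ob. \<exists>w\<in>Mor b c. \<forall>x\<in>carrier (G a). w (u x) = w (v x)"
    and generate: "y \<in> carrier N \<Longrightarrow> \<exists>a\<in>Ob. \<exists>x\<in>carrier (G a). \<phi> a x = y"
    and kill: "\<lbrakk>a \<in> Ob; x \<in> carrier (G a); \<phi> a x = \<zero>\<^bsub>N\<^esub>\<rbrakk> \<Longrightarrow>
      \<exists>b\<in>Ob. \<exists>u\<in>Mor a b. u x = \<zero>\<^bsub>G b\<^esub>"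
begin

abbreviation comp where "comp a v u \<equiv> compose (carrier (G a)) v u"
abbreviation ident where "ident a \<equiv> (\<lambda>x\<in>carrier (G a). x)"

lemma coequal_finite:
  assumes "finite Q" "b \<in> Ob" "\<And>a u v. (a, u, v) \<in> Q \<Longrightarrow> a \<in> Ob \<and> u \<in> Mor a b \<and> v \<in> Mor a b"
  shows "\<exists>c\<in>Ob. \<exists>w\<in>Mor b c. \<forall>(a, u, v)\<in>Q. comp a w u = comp a w v"
  using assms(1,3)
proof (induction Q rule: finite_induct)
  case empty
  then show ?case using Mor_id[OF assms(2)] assms(2) by blast
next
  case (insert q Q)
  obtain a u v where q: "q = (a, u, v)" by (metis prod_cases3)
  have a: "a \<in> Ob" "u \<in> Mor a b" "v \<in> Mor a b" using insert.prems[of a u v] q by auto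
  obtain c w where c: "c \<in> Ob" "w \<in> Mor b c"
    and eq: "\<And>a u v. (a, u, v) \<in> Q \<Longrightarrow> comp a w u = comp a w v"
    using insert.IH insert.prems by fastforce
  obtain d z where d: "d \<in> Ob" "z \<in> Mor c d"
    and z: "\<And>x. x \<in> carrier (G a) \<Longrightarrow> z (comp a w u x) = z (comp a w v x)"
    using coequal[OF a(1) c(1) Mor_comp[OF a(1) assms(2) c(1) a(2) c(2)]
        Mor_comp[OF a(1) assms(2) c(1) a(3) c(2)]] by blast
  have split: "comp a' (comp b z w) u' = comp a' z (comp a' w u')" if "a' \<in> Ob" "u' \<in> Mor a' b" for a' u'
    using rmod_homD(1)[OF Mor_hom[OF that(1) assms(2) that(2)]] by (intro compose_assoc[symmetric]) auto
  have "comp a' (comp b z w) u' = comp a' (comp b z w) v'" if "(a', u', v') \<in> insert q Q" for a' u' v'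
  proof -
    have a': "a' \<in> Ob" "u' \<in> Mor a' b" "v' \<in> Mor a' b" using insert.prems[OF that] by auto
    have "comp a' z (comp a' w u') = comp a' z (comp a' w v')"
    proof (cases "(a', u', v') \<in> Q")
      case True then show ?thesis using eq by simp
    next
      case False
      then have "a' = a" "u' = u" "v' = v" using that q by auto
      then show ?thesis using z by (simp add: compose_def cong: restrict_cong)
    qed
    then show ?thesis using split a' by simp
  qed
  then show ?case using d Mor_comp[OF assms(2) c(1) d(1) c(2) d(2)] by blast
qed

text \<open>A stage is a finite set of objects together with arrows from all of them into one
  distinguished member, which carries the identity arrow. One stage is below another if its diagram is
  obtained by composing with an arrow between the distinguished objects. The diagram then determines
  this arrow, namely as the one recorded for the distinguished object of the smaller stage, so the
  stages form a poset although the category has parallel arrows. Each object comes with a number as a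
  label: this provides infinitely many copies of it, so the distinguished object of the larger stage
  can be required to be new, and this gives antisymmetry.\<close>

definition stages :: "((('o \<times> nat) \<times> ('a \<Rightarrow> 'a)) set \<times> 'o \<times> nat) set"
  where "stages = {(F, q). finite F \<and> single_valued F \<and> (q, ident (fst q)) \<in> F \<and> fst q \<in> Ob \<and>
    (\<forall>(y, u)\<in>F. fst y \<in> Ob \<and> u \<in> Mor (fst y) (fst q))}"

definition extends_by where
  "extends_by p p' v \<longleftrightarrow> (snd p, v) \<in> fst p' \<and> (\<forall>(y, u)\<in>fst p. (y, comp (fst y) v u) \<in> fst p')"

definition stage_le where
  "stage_le = {(p, p'). p \<in> stages \<and> p' \<in> stages \<and>
    (p = p' \<or> snd p' \<notin> Domain (fst p) \<and> (\<exists>v. extends_by p p' v))}"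

definition stage_map where "stage_map p p' = (THE v. (snd p, v) \<in> fst p')"

abbreviation top_ob :: "(('o \<times> nat) \<times> ('a \<Rightarrow> 'a)) set \<times> 'o \<times> nat \<Rightarrow> 'o"
  where "top_ob p \<equiv> fst (snd p)"

lemma stagesD:
  assumes "p \<in> stages"
  shows "finite (fst p)" "single_valued (fst p)" "(snd p, ident (top_ob p)) \<in> fst p" "top_ob p \<in> Ob"
    "(y, u) \<in> fst p \<Longrightarrow> fst y \<in> Ob \<and> u \<in> Mor (fst y) (top_ob p)"
proof -
  show "finite (fst p)" "single_valued (fst p)" "(snd p, ident (top_ob p)) \<in> fst p" "top_ob p \<in> Ob"
    using assms by (auto simp: stages_def)
  show "(y, u) \<in> fst p \<Longrightarrow> fst y \<in> Ob \<and> u \<in> Mor (fst y) (top_ob p)"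
    using assms unfolding stages_def by (cases p) fastforce
qed

lemma stagesI:
  assumes "finite F" "single_valued F" "(q, ident (fst q)) \<in> F" "fst q \<in> Ob"
    and "\<And>y u. (y, u) \<in> F \<Longrightarrow> fst y \<in> Ob \<and> u \<in> Mor (fst y) (fst q)"
  shows "(F, q) \<in> stages"
  using assms unfolding stages_def by blast

lemma stage_map_eq: "\<lbrakk>p' \<in> stages; (snd p, v) \<in> fst p'\<rbrakk> \<Longrightarrow> stage_map p p' = v"
  unfolding stage_map_def using stagesD(2) by (metis single_valuedD the_equality)

lemma stage_map_extends: "\<lbrakk>p' \<in> stages; extends_by p p' v\<rbrakk> \<Longrightarrow> stage_map p p' = v"
  unfolding extends_by_def by (blast intro: stage_map_eq)

lemma extends_refl: assumes p: "p \<in> stages" shows "extends_by p p (ident (top_ob p))"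
proof -
  have "comp (fst y) (ident (top_ob p)) u = u" if "(y, u) \<in> fst p" for y u
  proof -
    have y: "fst y \<in> Ob" "u \<in> Mor (fst y) (top_ob p)" using stagesD(5)[OF p that] by auto
    show ?thesis
      using rmod_homD(1)[OF Mor_hom[OF y(1) stagesD(4)[OF p] y(2)]] Mor_ext[OF y(1) stagesD(4)[OF p] y(2)]
      by (intro extensionalityI[of _ "carrier (G (fst y))"]) (auto simp: compose_def)
  qed
  then show ?thesis unfolding extends_by_def using stagesD(3)[OF p] by auto
qed

lemma extends_trans:
  assumes p: "p \<in> stages" "p' \<in> stages"
    and e: "extends_by p p' v" "extends_by p' p'' w"
  shows "extends_by p p'' (comp (top_ob p) w v)"
proof -
  have "(snd p, comp (top_ob p) w v) \<in> fst p''" using e by (auto simp: extends_by_def)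
  moreover have "(y, comp (fst y) (comp (top_ob p) w v) u) \<in> fst p''" if yu: "(y, u) \<in> fst p" for y u
  proof -
    have y: "fst y \<in> Ob" "u \<in> Mor (fst y) (top_ob p)" using stagesD(5)[OF p(1) yu] by auto
    have "(y, comp (fst y) v u) \<in> fst p'" using e(1) yu by (auto simp: extends_by_def)
    then have "(y, comp (fst y) w (comp (fst y) v u)) \<in> fst p''" using e(2) by (auto simp: extends_by_def)
    moreover have "comp (fst y) w (comp (fst y) v u) = comp (fst y) (comp (top_ob p) w v) u"
      using rmod_homD(1)[OF Mor_hom[OF y(1) stagesD(4)[OF p(1)] y(2)]] by (intro compose_assoc) auto
    ultimately show ?thesis by simp
  qed
  ultimately show ?thesis by (auto simp: extends_by_def)
qed

lemma stage_leD:
  assumes "(p, p') \<in> stage_le"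
  shows "p \<in> stages" "p' \<in> stages" "extends_by p p' (stage_map p p')"
    "stage_map p p' \<in> Mor (top_ob p) (top_ob p')"
proof -
  show p: "p \<in> stages" "p' \<in> stages" using assms by (auto simp: stage_le_def)
  have "\<exists>v. extends_by p p' v" using assms extends_refl[OF p(1)] by (auto simp only: stage_le_def)
  then obtain v where v: "extends_by p p' v" by blast
  then have "stage_map p p' = v" by (rule stage_map_extends[OF p(2)])
  then show e: "extends_by p p' (stage_map p p')" using v by simp
  show "stage_map p p' \<in> Mor (top_ob p) (top_ob p')"
    using e stagesD(5)[OF p(2), of "snd p"] by (auto simp: extends_by_def)
qed

lemma stage_leI:
  "\<lbrakk>p \<in> stages; p' \<in> stages; snd p' \<notin> Domain (fst p); extends_by p p' v\<rbrakk> \<Longrightarrow> (p, p') \<in> stage_le"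
  by (auto simp: stage_le_def)

lemma extends_Domain: "extends_by p p' v \<Longrightarrow> Domain (fst p) \<subseteq> Domain (fst p')"
  by (force simp: extends_by_def)

lemma stage_le_partial_order: "partial_order_on stages stage_le"
  unfolding partial_order_on_def preorder_on_def
proof (intro conjI)
  show "stage_le \<subseteq> stages \<times> stages" by (auto simp: stage_le_def)
  show "refl_on stages stage_le" by (rule refl_onI) (auto simp: stage_le_def)
  show "antisym stage_le"
  proof (rule antisymI, rule ccontr)
    fix p p' assume 1: "(p, p') \<in> stage_le" and 2: "(p', p) \<in> stage_le" and ne: "p \<noteq> p'"
    have "snd p' \<notin> Domain (fst p)" using 1 ne by (simp add: stage_le_def)
    moreover have "Domain (fst p') \<subseteq> Domain (fst p)" by (rule extends_Domain[OF stage_leD(3)[OF 2]])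
    moreover have "snd p' \<in> Domain (fst p')" using stagesD(3)[OF stage_leD(2)[OF 1]] by (rule DomainI)
    ultimately show False by blast
  qed
  show "trans stage_le"
  proof (rule transI)
    fix p p' p'' assume 1: "(p, p') \<in> stage_le" and 2: "(p', p'') \<in> stage_le"
    show "(p, p'') \<in> stage_le"
    proof (cases "p = p' \<or> p' = p''")
      case True then show ?thesis using 1 2 by auto
    next
      case False
      then have "snd p'' \<notin> Domain (fst p')" using 2 by (simp add: stage_le_def)
      then have "snd p'' \<notin> Domain (fst p)" using extends_Domain[OF stage_leD(3)[OF 1]] by blast
      then show ?thesis
        by (rule stage_leI[OF stage_leD(1)[OF 1] stage_leD(2)[OF 2] _
            extends_trans[OF stage_leD(1,2)[OF 1] stage_leD(3)[OF 1] stage_leD(3)[OF 2]]])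
    qed
  qed
qed

lemma fresh_label:
  assumes "finite F" shows "\<exists>k::nat. (a, k) \<notin> Domain F"
proof -
  have "finite (snd ` Domain F)" using assms by (simp add: finite_Domain)
  then obtain k where "k \<notin> snd ` Domain F" using ex_new_if_finite[OF infinite_UNIV_nat] by blast
  then show ?thesis by force
qed

text \<open>Every arrow out of the distinguished object of a stage is realized by a transition map, which
  is why elements that can be killed in the category are killed in the directed system.\<close>

lemma stage_over:
  assumes p: "p \<in> stages" and b: "b \<in> Ob" and v: "v \<in> Mor (top_ob p) b"
  shows "\<exists>p'. (p, p') \<in> stage_le \<and> top_ob p' = b \<and> stage_map p p' = v"
proof -
  let ?F = "fst p"
  obtain k where k: "(b, k) \<notin> Domain ?F" using fresh_label[OF stagesD(1)[OF p]] by blast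
  define G' where "G' = (\<lambda>(y, u). (y, comp (fst y) v u)) ` ?F"
  define p' where "p' = (insert ((b, k), ident b) G', (b, k))"
  have dom: "Domain G' = Domain ?F" by (auto simp: G'_def Domain_fst image_image case_prod_beta)
  have "single_valued G'"
    using stagesD(2)[OF p] by (fastforce simp: G'_def single_valued_def)
  then have "single_valued (fst p')" using k dom by (auto simp: p'_def single_valued_def)
  moreover have "fst y \<in> Ob \<and> u \<in> Mor (fst y) b" if "(y, u) \<in> fst p'" for y u
  proof (cases "(y, u) \<in> G'")
    case True
    then obtain u' where u': "(y, u') \<in> ?F" "u = comp (fst y) v u'" by (auto simp: G'_def)
    have "fst y \<in> Ob" "u' \<in> Mor (fst y) (top_ob p)" using stagesD(5)[OF p u'(1)] by auto
    then show ?thesis using Mor_comp[OF _ stagesD(4)[OF p] b _ v] u'(2) by simp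
  next
    case False
    then show ?thesis using that b Mor_id[OF b] by (auto simp: p'_def)
  qed
  moreover have "finite (fst p')" using stagesD(1)[OF p] by (simp add: p'_def G'_def)
  ultimately have p': "p' \<in> stages"
    using stagesI[of "fst p'" "(b, k)"] b by (simp add: p'_def)
  have "comp (top_ob p) v (ident (top_ob p)) = v"
    using Mor_ext[OF stagesD(4)[OF p] b v]
    by (intro extensionalityI[of _ "carrier (G (top_ob p))"]) (auto simp: compose_def)
  then have "(snd p, v) \<in> G'"
    using imageI[OF stagesD(3)[OF p], of "\<lambda>(y, u). (y, comp (fst y) v u)"] unfolding G'_def by simp
  moreover have "(y, comp (fst y) v u) \<in> G'" if "(y, u) \<in> ?F" for y u
    using imageI[OF that, of "\<lambda>(y, u). (y, comp (fst y) v u)"] unfolding G'_def by simp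
  ultimately have e: "extends_by p p' v" by (auto simp: extends_by_def p'_def)
  have "(p, p') \<in> stage_le" using stage_leI[OF p p' _ e] k by (simp add: p'_def)
  moreover have "stage_map p p' = v" by (rule stage_map_extends[OF p' e])
  ultimately show ?thesis by (auto simp: p'_def)
qed

text \<open>An upper bound of two stages is obtained from an upper bound of their distinguished objects by
  equalizing the two composite arrows out of every object that occurs in both.\<close>

lemma stages_directed:
  assumes p: "p \<in> stages" and p': "p' \<in> stages"
  shows "\<exists>p''. (p, p'') \<in> stage_le \<and> (p', p'') \<in> stage_le"
proof -
  note a = stagesD(4)[OF p] stagesD(4)[OF p']
  obtain b v v' where b: "b \<in> Ob" and v: "v \<in> Mor (top_ob p) b" and v': "v' \<in> Mor (top_ob p') b"
    using bound[OF a] by blast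
  \<comment> \<open>An object lying in both stages has two composite arrows into \<open>b\<close>. There are finitely many
    such pairs, so they can be equalized simultaneously.\<close>
  define Q where "Q = (\<lambda>((y, u), (y', u')). (fst y, comp (fst y) v u, comp (fst y') v' u'))
    ` {z \<in> fst p \<times> fst p'. fst (fst z) = fst (snd z)}"
  have finQ: "finite Q" using stagesD(1)[OF p] stagesD(1)[OF p'] by (simp add: Q_def)
  have QM: "a \<in> Ob \<and> u \<in> Mor a b \<and> w \<in> Mor a b" if q: "(a, u, w) \<in> Q" for a u w
  proof -
    obtain y u1 u2 where y: "(y, u1) \<in> fst p" "(y, u2) \<in> fst p'" "a = fst y"
      "u = comp (fst y) v u1" "w = comp (fst y) v' u2" using q by (auto simp: Q_def)
    show ?thesis
      using stagesD(5)[OF p y(1)] stagesD(5)[OF p' y(2)] Mor_comp[OF _ a(1) b _ v] Mor_comp[OF _ a(2) b _ v']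
        y(3-5) by simp
  qed
  from coequal_finite[OF finQ b QM] obtain c w where c: "c \<in> Ob" and w: "w \<in> Mor b c"
    and eqQ: "\<forall>(a, u, u')\<in>Q. comp a w u = comp a w u'"
    by blast
  define z where "z = comp (top_ob p) w v"
  define z' where "z' = comp (top_ob p') w v'"
  have zM: "z \<in> Mor (top_ob p) c" and zM': "z' \<in> Mor (top_ob p') c"
    unfolding z_def z'_def using Mor_comp[OF a(1) b c v w] Mor_comp[OF a(2) b c v' w] .
  have zz: "comp (fst y) z u = comp (fst y) w (comp (fst y) v u)" if "(y, u) \<in> fst p" for y u
    using rmod_homD(1)[OF Mor_hom[OF _ a(1)]] stagesD(5)[OF p that]
    unfolding z_def by (intro compose_assoc[symmetric]) auto
  have zz': "comp (fst y) z' u = comp (fst y) w (comp (fst y) v' u)" if "(y, u) \<in> fst p'" for y u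
    using rmod_homD(1)[OF Mor_hom[OF _ a(2)]] stagesD(5)[OF p' that]
    unfolding z'_def by (intro compose_assoc[symmetric]) auto
  have agree: "comp (fst y) z u = comp (fst y) z' u'" if y: "(y, u) \<in> fst p" "(y, u') \<in> fst p'" for y u u'
  proof -
    have "(fst y, comp (fst y) v u, comp (fst y) v' u') \<in> Q" using y by (force simp: Q_def)
    then show ?thesis using eqQ zz[OF y(1)] zz'[OF y(2)] by auto
  qed
  define H where "H = (\<lambda>(y, u). (y, comp (fst y) z u)) ` fst p \<union> (\<lambda>(y, u). (y, comp (fst y) z' u)) ` fst p'"
  have fin: "finite H" using stagesD(1)[OF p] stagesD(1)[OF p'] by (simp add: H_def)
  have dom: "Domain H = Domain (fst p) \<union> Domain (fst p')"
    by (simp add: H_def Domain_fst image_Un image_image case_prod_beta)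
  obtain k where k: "(c, k) \<notin> Domain H" using fresh_label[OF fin] by blast
  define q where "q = (insert ((c, k), ident c) H, (c, k))"
  have svH: "single_valued H"
  proof (rule single_valuedI)
    fix y t t' assume t: "(y, t) \<in> H" "(y, t') \<in> H"
    have form: "(\<exists>u. (y, u) \<in> fst p \<and> s = comp (fst y) z u) \<or> (\<exists>u. (y, u) \<in> fst p' \<and> s = comp (fst y) z' u)"
      if "(y, s) \<in> H" for s using that by (auto simp: H_def)
    show "t = t'"
      using form[OF t(1)] form[OF t(2)] agree single_valuedD[OF stagesD(2)[OF p]]
        single_valuedD[OF stagesD(2)[OF p']] by metis
  qed
  have sv: "single_valued (fst q)"
    using k svH by (auto simp: q_def single_valued_def)
  have mem: "fst y \<in> Ob \<and> u \<in> Mor (fst y) c" if yu: "(y, u) \<in> fst q" for y u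
  proof -
    consider "y = (c, k)" "u = ident c" | u' where "(y, u') \<in> fst p" "u = comp (fst y) z u'"
      | u' where "(y, u') \<in> fst p'" "u = comp (fst y) z' u'"
      using yu by (auto simp: q_def H_def)
    then show ?thesis
    proof cases
      case 1 then show ?thesis using c Mor_id[OF c] by simp
    next
      case 2 then show ?thesis using stagesD(5)[OF p 2(1)] Mor_comp[OF _ a(1) c _ zM] by simp
    next
      case 3 then show ?thesis using stagesD(5)[OF p' 3(1)] Mor_comp[OF _ a(2) c _ zM'] by simp
    qed
  qed
  have q: "q \<in> stages" using stagesI[of "fst q" "(c, k)"] fin sv mem c by (simp add: q_def)
  have id: "comp (top_ob r) s (ident (top_ob r)) = s" if "r \<in> stages" "s \<in> Mor (top_ob r) c" for r s
    using Mor_ext[OF stagesD(4)[OF that(1)] c that(2)]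
    by (intro extensionalityI[of _ "carrier (G (top_ob r))"]) (auto simp: compose_def)
  have e1: "(y, comp (fst y) z u) \<in> fst q" if "(y, u) \<in> fst p" for y u
    using imageI[OF that, of "\<lambda>(y, u). (y, comp (fst y) z u)"] by (simp add: q_def H_def)
  have e2: "(y, comp (fst y) z' u) \<in> fst q" if "(y, u) \<in> fst p'" for y u
    using imageI[OF that, of "\<lambda>(y, u). (y, comp (fst y) z' u)"] by (simp add: q_def H_def)
  have "extends_by p q z"
    using e1 e1[OF stagesD(3)[OF p]] id[OF p zM] by (auto simp: extends_by_def)
  moreover have "extends_by p' q z'"
    using e2 e2[OF stagesD(3)[OF p']] id[OF p' zM'] by (auto simp: extends_by_def)
  ultimately have "(p, q) \<in> stage_le" "(p', q) \<in> stage_le"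
    using stage_leI[OF p q] stage_leI[OF p' q] k dom by (auto simp: q_def)
  then show ?thesis by blast
qed

lemma stage_of_object:
  assumes a: "a \<in> Ob" shows "({((a, 0), ident a)}, (a, 0)) \<in> stages"
  using a Mor_id[OF a] by (auto simp: stages_def single_valued_def)

lemma stages_system:
  "direct_system R stages stage_le (\<lambda>p. G (top_ob p)) stage_map"
  unfolding direct_system_def
proof (intro conjI ballI allI impI)
  interpret N: right_module R N by (rule N)
  obtain a where "a \<in> Ob" using generate[OF N.M.zero_closed] by blast
  then have "stages \<noteq> {}" using stage_of_object by blast
  then show "directed_poset stages stage_le"
    using stage_le_partial_order stages_directed by (auto simp: directed_poset_def)
next
  fix p assume "p \<in> stages" then show "right_module R (G (top_ob p))" by (intro G stagesD(4))
next
  fix z assume "z \<in> stage_le"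
  then show "case z of (i, j) \<Rightarrow> stage_map i j \<in> rmod_hom R (G (top_ob i)) (G (top_ob j))"
    using Mor_hom[OF stagesD(4) stagesD(4)] stage_leD(1,2,4) unfolding case_prod_beta
    by (metis prod.collapse)
next
  fix p x assume "p \<in> stages" "x \<in> carrier (G (top_ob p))"
  then show "stage_map p p x = x" using stage_map_eq[OF _ stagesD(3)] by simp
next
  fix p p' p'' x assume 1: "(p, p') \<in> stage_le" and 2: "(p', p'') \<in> stage_le" and x: "x \<in> carrier (G (top_ob p))"
  have "extends_by p p'' (comp (top_ob p) (stage_map p' p'') (stage_map p p'))"
    by (rule extends_trans[OF stage_leD(1,2)[OF 1] stage_leD(3)[OF 1] stage_leD(3)[OF 2]])
  then have "stage_map p p'' = comp (top_ob p) (stage_map p' p'') (stage_map p p')"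
    by (rule stage_map_extends[OF stage_leD(2)[OF 2]])
  then show "stage_map p' p'' (stage_map p p' x) = stage_map p p'' x" using x by (simp add: compose_eq)
qed

lemma stages_cocone:
  "dirlim_cocone R stages stage_le (\<lambda>p. G (top_ob p)) stage_map N (\<lambda>p. \<phi> (top_ob p))"
  unfolding dirlim_cocone_def
proof (intro conjI ballI impI)
  fix p assume "p \<in> stages" then show "\<phi> (top_ob p) \<in> rmod_hom R (G (top_ob p)) N"
    by (intro \<phi>_hom stagesD(4))
next
  fix z assume "z \<in> stage_le"
  then show "case z of (p, p') \<Rightarrow> \<forall>x\<in>carrier (G (top_ob p)). \<phi> (top_ob p') (stage_map p p' x) = \<phi> (top_ob p) x"
    using \<phi>_Mor[OF stagesD(4) stagesD(4)] stage_leD(1,2,4) unfolding case_prod_beta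
    by (metis prod.collapse)
next
  fix y assume "y \<in> carrier N"
  then obtain a x where a: "a \<in> Ob" "x \<in> carrier (G a)" "\<phi> a x = y" using generate by blast
  then show "\<exists>p\<in>stages. \<exists>x\<in>carrier (G (top_ob p)). \<phi> (top_ob p) x = y"
    using stage_of_object[OF a(1)] by (intro bexI[of _ "({((a, 0), ident a)}, (a, 0))"]) auto
next
  fix p x assume p: "p \<in> stages" and x: "x \<in> carrier (G (top_ob p))" "\<phi> (top_ob p) x = \<zero>\<^bsub>N\<^esub>"
  obtain b u where b: "b \<in> Ob" "u \<in> Mor (top_ob p) b" "u x = \<zero>\<^bsub>G b\<^esub>"
    using kill[OF stagesD(4)[OF p] x] by blast
  obtain p' where "(p, p') \<in> stage_le" "top_ob p' = b" "stage_map p p' = u"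
    using stage_over[OF p b(1,2)] by blast
  then show "\<exists>p'. (p, p') \<in> stage_le \<and> stage_map p p' x = \<zero>\<^bsub>G (top_ob p')\<^esub>" using b(3) by metis
qed

end

section \<open>Linear functionals on free modules over a left noetherian ring\<close>

abbreviation free :: "('r, 'k) ring_scheme \<Rightarrow> nat \<Rightarrow> ('r, nat \<Rightarrow> 'r) rmodule"
  where "free R n \<equiv> direct_sum_copies {..<n} (reg R)"

abbreviation functionals :: "('r, 'k) ring_scheme \<Rightarrow> nat \<Rightarrow> ((nat \<Rightarrow> 'r) \<Rightarrow> 'r) set"
  where "functionals R n \<equiv> rmod_hom R (free R n) (reg R)"

abbreviation basis :: "('r, 'k) ring_scheme \<Rightarrow> nat \<Rightarrow> nat \<Rightarrow> nat \<Rightarrow> 'r"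
  where "basis R n i \<equiv> single i {..<n} (reg R) \<one>\<^bsub>R\<^esub>"

abbreviation incl :: "('r, 'k) ring_scheme \<Rightarrow> nat \<Rightarrow> (nat \<Rightarrow> 'r) \<Rightarrow> nat \<Rightarrow> 'r"
  where "incl R n \<equiv> push id {..<n} {..<Suc n} (reg R)"

text \<open>The left module \<open>Hom(R\<^sup>n, R)\<close> plays the role of the row vectors. Its elements are functions
  on a whole type whose values outside the free module are arbitrary, whence the last condition.\<close>

definition functional_submodule :: "('r, 'k) ring_scheme \<Rightarrow> nat \<Rightarrow> ((nat \<Rightarrow> 'r) \<Rightarrow> 'r) set \<Rightarrow> bool"
  where "functional_submodule R n K \<longleftrightarrow> K \<subseteq> functionals R n \<and> (\<lambda>v. \<zero>\<^bsub>R\<^esub>) \<in> K \<and>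
    (\<forall>k\<in>K. \<forall>l\<in>K. (\<lambda>v. k v \<oplus>\<^bsub>R\<^esub> l v) \<in> K) \<and>
    (\<forall>a\<in>carrier R. \<forall>k\<in>K. (\<lambda>v. a \<otimes>\<^bsub>R\<^esub> k v) \<in> K) \<and>
    (\<forall>k\<in>K. \<forall>l\<in>functionals R n. (\<forall>v\<in>carrier (free R n). l v = k v) \<longrightarrow> l \<in> K)"

lemma functional_submoduleD:
  assumes "functional_submodule R n K"
  shows "k \<in> K \<Longrightarrow> k \<in> functionals R n" and "(\<lambda>v. \<zero>\<^bsub>R\<^esub>) \<in> K"
    and "\<lbrakk>k \<in> K; l \<in> K\<rbrakk> \<Longrightarrow> (\<lambda>v. k v \<oplus>\<^bsub>R\<^esub> l v) \<in> K"
    and "\<lbrakk>a \<in> carrier R; k \<in> K\<rbrakk> \<Longrightarrow> (\<lambda>v. a \<otimes>\<^bsub>R\<^esub> k v) \<in> K"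
    and "\<lbrakk>k \<in> K; l \<in> functionals R n; \<And>v. v \<in> carrier (free R n) \<Longrightarrow> l v = k v\<rbrakk> \<Longrightarrow> l \<in> K"
  using assms by (auto simp: functional_submodule_def)

lemma functional_submoduleI:
  assumes "\<And>k. k \<in> K \<Longrightarrow> k \<in> functionals R n" "(\<lambda>v. \<zero>\<^bsub>R\<^esub>) \<in> K"
    and "\<And>k l. \<lbrakk>k \<in> K; l \<in> K\<rbrakk> \<Longrightarrow> (\<lambda>v. k v \<oplus>\<^bsub>R\<^esub> l v) \<in> K"
    and "\<And>a k. \<lbrakk>a \<in> carrier R; k \<in> K\<rbrakk> \<Longrightarrow> (\<lambda>v. a \<otimes>\<^bsub>R\<^esub> k v) \<in> K"
    and "\<And>k l. \<lbrakk>k \<in> K; l \<in> functionals R n; \<And>v. v \<in> carrier (free R n) \<Longrightarrow> l v = k v\<rbrakk> \<Longrightarrow> l \<in> K"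
  shows "functional_submodule R n K"
  unfolding functional_submodule_def
proof (intro conjI ballI subsetI impI)
  fix k l assume "k \<in> K" "l \<in> functionals R n" "\<forall>v\<in>carrier (free R n). l v = k v"
  then show "l \<in> K" using assms(5)[of k l] by blast
qed (fact assms(1-4))+

lemma functional_submodule_Int:
  assumes J: "functional_submodule R n J" and K: "functional_submodule R n K"
  shows "functional_submodule R n (J \<inter> K)"
proof (rule functional_submoduleI)
  fix k l assume kl: "k \<in> J \<inter> K" "l \<in> functionals R n" "\<And>v. v \<in> carrier (free R n) \<Longrightarrow> l v = k v"
  then show "l \<in> J \<inter> K"
    using functional_submoduleD(5)[OF J _ kl(2)] functional_submoduleD(5)[OF K _ kl(2)] by blast
qed (simp_all add: functional_submoduleD[OF J] functional_submoduleD[OF K])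

lemma left_idealI:
  assumes "ring R" "I \<subseteq> carrier R" "\<zero>\<^bsub>R\<^esub> \<in> I"
    and add: "\<And>x y. \<lbrakk>x \<in> I; y \<in> I\<rbrakk> \<Longrightarrow> x \<oplus>\<^bsub>R\<^esub> y \<in> I"
    and mult: "\<And>x a. \<lbrakk>x \<in> I; a \<in> carrier R\<rbrakk> \<Longrightarrow> a \<otimes>\<^bsub>R\<^esub> x \<in> I"
  shows "left_ideal I R"
proof -
  interpret ring R by fact
  have "\<ominus>\<^bsub>R\<^esub> x \<in> I" if "x \<in> I" for x
    using mult[OF that, of "\<ominus>\<^bsub>R\<^esub> \<one>\<^bsub>R\<^esub>"] that assms(2) by (auto simp: l_minus)
  then have "subgroup I (add_monoid R)"
    using assms(2-4) by (intro add.subgroupI) (auto simp: a_inv_def)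
  then show ?thesis using mult by (simp add: left_ideal_def)
qed

locale free_modules = ring R for R :: "('r, 'k) ring_scheme" (structure)
begin

lemma reg_module: "right_module R (reg R)" by (rule right_module_reg) (rule ring_axioms)
lemma free_module: "right_module R (free R n)" by (rule right_module_direct_sum_copies[OF reg_module])

sublocale free: right_module R "free R n" for n by (rule free_module)

lemma functionalD:
  assumes "k \<in> functionals R n"
  shows "v \<in> carrier (free R n) \<Longrightarrow> k v \<in> carrier R"
    and "\<lbrakk>v \<in> carrier (free R n); w \<in> carrier (free R n)\<rbrakk> \<Longrightarrow> k (v \<oplus>\<^bsub>free R n\<^esub> w) = k v \<oplus> k w"
    and "\<lbrakk>v \<in> carrier (free R n); a \<in> carrier R\<rbrakk> \<Longrightarrow> k (v \<star>\<^bsub>free R n\<^esub> a) = k v \<otimes> a"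
    and "k \<zero>\<^bsub>free R n\<^esub> = \<zero>"
  using rmod_homD[OF assms] rmod_hom_zero[OF assms free_module reg_module] by (simp_all del: direct_sum_copies_simps)

lemma functional_scale: "\<lbrakk>k \<in> functionals R n; a \<in> carrier R\<rbrakk> \<Longrightarrow> (\<lambda>v. a \<otimes> k v) \<in> functionals R n"
  by (rule rmod_homI) (simp_all del: direct_sum_copies_simps add: functionalD r_distr m_assoc)

lemma functional_add:
  "\<lbrakk>k \<in> functionals R n; l \<in> functionals R n\<rbrakk> \<Longrightarrow> (\<lambda>v. k v \<oplus> l v) \<in> functionals R n"
  using rmod_hom_add[OF reg_module] by fastforce

lemma functional_zero: "(\<lambda>v. \<zero>) \<in> functionals R n"
  using rmod_hom_zero_map[OF free_module reg_module] by fastforce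

lemma incl_hom: "incl R n \<in> rmod_hom R (free R n) (free R (Suc n))"
  by (rule push_hom[OF reg_module]) auto

lemma proj_hom: "pull id {..<n} \<in> rmod_hom R (free R (Suc n)) (free R n)"
  by (rule pull_hom) auto

lemma last_hom: "(\<lambda>v. v n) \<in> functionals R (Suc n)"
  by (rule direct_sum_copies_proj) simp

lemma basis_closed: "basis R n i \<in> carrier (free R n)"
  by (rule rmod_homD(1)[OF single_hom[OF reg_module]]) simp

lemma single_basis: "a \<in> carrier R \<Longrightarrow> single i {..<n} (reg R) a = basis R n i \<star>\<^bsub>free R n\<^esub> a"
  using rmod_homD(3)[OF single_hom[OF reg_module], of "\<one>" a i "{..<n}"] by simp

lemma free_Suc:
  assumes "v \<in> carrier (free R (Suc n))"
  shows "v = incl R n (pull id {..<n} v) \<oplus>\<^bsub>free R (Suc n)\<^esub> basis R (Suc n) n \<star>\<^bsub>free R (Suc n)\<^esub> v n"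
  using direct_sum_copies_Suc[OF reg_module assms] single_basis[of "v n" n "Suc n"]
    functionalD(1)[OF last_hom assms] by (simp del: direct_sum_copies_simps)

lemma hom_free_Suc:
  assumes B: "right_module R B" and f: "f \<in> rmod_hom R (free R (Suc n)) B"
    and v: "v \<in> carrier (free R (Suc n))"
  shows "f v = f (incl R n (pull id {..<n} v)) \<oplus>\<^bsub>B\<^esub> f (basis R (Suc n) n) \<star>\<^bsub>B\<^esub> v n"
proof -
  note c = rmod_homD(1)[OF incl_hom rmod_homD(1)[OF proj_hom v]] functionalD(1)[OF last_hom v]
  have "f v = f (incl R n (pull id {..<n} v) \<oplus>\<^bsub>free R (Suc n)\<^esub> basis R (Suc n) n \<star>\<^bsub>free R (Suc n)\<^esub> v n)"
    using free_Suc[OF v] by simp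
  also have "\<dots> = f (incl R n (pull id {..<n} v)) \<oplus>\<^bsub>B\<^esub> f (basis R (Suc n) n) \<star>\<^bsub>B\<^esub> v n"
    using c basis_closed by (simp del: direct_sum_copies_simps add: rmod_homD(2,3)[OF f])
  finally show ?thesis .
qed

lemma proj_incl: "v \<in> carrier (free R n) \<Longrightarrow> pull id {..<n} (incl R n v) = v"
  by (rule pull_push) auto

lemma incl_last: "incl R n v n = \<zero>" by (simp add: push_outside)

lemma incl_basis: "i < n \<Longrightarrow> incl R n (basis R n i) = basis R (Suc n) i"
  by (rule ext) (auto simp: push_def single_def inv_into_f_eq restrict_def)

lemma proj_basis: "pull id {..<n} (basis R (Suc n) n) = \<zero>\<^bsub>free R n\<^esub>"
  by (rule ext) (auto simp: pull_def single_def)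

lemma basis_last: "basis R (Suc n) n n = \<one>" by (simp add: single_def)

lemma free_0: "v \<in> carrier (free R 0) \<Longrightarrow> v = \<zero>\<^bsub>free R 0\<^esub>"
  by (rule direct_sum_copies_eqI[OF _ free.M.zero_closed]) auto

text \<open>A property of vectors that is preserved by linear combinations only has to be checked on the
  basis; this replaces expansions of vectors into sums.\<close>

lemma free_span:
  assumes v: "v \<in> carrier (free R n)" and 0: "V \<zero>\<^bsub>free R n\<^esub>"
    and add: "\<And>v w. \<lbrakk>v \<in> carrier (free R n); w \<in> carrier (free R n); V v; V w\<rbrakk> \<Longrightarrow> V (v \<oplus>\<^bsub>free R n\<^esub> w)"
    and ract: "\<And>v a. \<lbrakk>v \<in> carrier (free R n); a \<in> carrier R; V v\<rbrakk> \<Longrightarrow> V (v \<star>\<^bsub>free R n\<^esub> a)"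
    and basis: "\<And>i. i < n \<Longrightarrow> V (basis R n i)"
  shows "V v"
  using assms
proof (induction n arbitrary: v V)
  case 0
  then show ?case using free_0 by metis
next
  case (Suc n)
  note i = rmod_homD[OF incl_hom[of n]]
  have i0: "incl R n \<zero>\<^bsub>free R n\<^esub> = \<zero>\<^bsub>free R (Suc n)\<^esub>"
    by (rule rmod_hom_zero[OF incl_hom free_module free_module])
  have "V (incl R n (pull id {..<n} v))"
  proof (rule Suc.IH[of "pull id {..<n} v" "\<lambda>w. V (incl R n w)"])
    show "pull id {..<n} v \<in> carrier (free R n)" by (rule rmod_homD(1)[OF proj_hom Suc.prems(1)])
    show "V (incl R n \<zero>\<^bsub>free R n\<^esub>)" using Suc.prems(2) by (simp only: i0)
    show "V (incl R n (basis R n j))" if "j < n" for j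
      using Suc.prems(5)[of j] that incl_basis[OF that] by simp
  qed (simp_all only: i Suc.prems(3,4))
  moreover have "V (basis R (Suc n) n \<star>\<^bsub>free R (Suc n)\<^esub> v n)"
    by (rule Suc.prems(4)[OF basis_closed functionalD(1)[OF last_hom Suc.prems(1)] Suc.prems(5)]) simp
  ultimately have "V (incl R n (pull id {..<n} v) \<oplus>\<^bsub>free R (Suc n)\<^esub> basis R (Suc n) n \<star>\<^bsub>free R (Suc n)\<^esub> v n)"
    by (intro Suc.prems(3) i(1) free.ract_closed basis_closed rmod_homD(1)[OF proj_hom Suc.prems(1)]
        functionalD(1)[OF last_hom Suc.prems(1)])
  then show ?case by (simp only: free_Suc[OF Suc.prems(1), symmetric])
qed

text \<open>Free modules of finite rank are projective: the lift is built one basis vector at a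
  time.\<close>

lemma free_lift:
  assumes A: "right_module R A" and B: "right_module R B" and q: "q \<in> rmod_hom R A B"
    and f: "f \<in> rmod_hom R (free R n) B" and im: "\<And>v. v \<in> carrier (free R n) \<Longrightarrow> f v \<in> q ` carrier A"
  shows "\<exists>g\<in>rmod_hom R (free R n) A. \<forall>v\<in>carrier (free R n). q (g v) = f v"
  using f im
proof (induction n arbitrary: f)
  case 0
  have "f v = q \<zero>\<^bsub>A\<^esub>" if "v \<in> carrier (free R 0)" for v
    using free_0[OF that] rmod_hom_zero[OF q A B] rmod_hom_zero[OF 0(1) free_module B] by metis
  then have "\<forall>v\<in>carrier (free R 0). q \<zero>\<^bsub>A\<^esub> = f v" by metis
  then show ?case by (rule bexI[OF _ rmod_hom_zero_map[OF free_module A]])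
next
  case (Suc n)
  interpret A: right_module R A by fact
  note ih = rmod_homD(1)[OF incl_hom[of n]]
  have "\<exists>g\<in>rmod_hom R (free R n) A. \<forall>v\<in>carrier (free R n). q (g v) = f (incl R n v)"
    using Suc.IH[OF rmod_hom_comp[OF incl_hom Suc.prems(1)]] Suc.prems(2) ih by blast
  then obtain g where g: "g \<in> rmod_hom R (free R n) A"
    and qg: "\<And>v. v \<in> carrier (free R n) \<Longrightarrow> q (g v) = f (incl R n v)" by blast
  obtain a where a: "a \<in> carrier A" "q a = f (basis R (Suc n) n)"
    using Suc.prems(2)[OF basis_closed] by (metis imageE)
  have "(\<lambda>c. a \<star>\<^bsub>A\<^esub> c) \<in> rmod_hom R (reg R) A"
    using a(1) by (intro rmod_homI) (auto simp: A.ract_r_distr A.ract_assoc)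
  then have h: "(\<lambda>v. g (pull id {..<n} v) \<oplus>\<^bsub>A\<^esub> a \<star>\<^bsub>A\<^esub> v n) \<in> rmod_hom R (free R (Suc n)) A"
    by (intro rmod_hom_add[OF A] rmod_hom_comp[OF proj_hom g] rmod_hom_comp[OF last_hom])
  have "q (g (pull id {..<n} v) \<oplus>\<^bsub>A\<^esub> a \<star>\<^bsub>A\<^esub> v n) = f v" if v: "v \<in> carrier (free R (Suc n))" for v
  proof -
    note c = rmod_homD(1)[OF proj_hom v] functionalD(1)[OF last_hom v]
    have "q (g (pull id {..<n} v) \<oplus>\<^bsub>A\<^esub> a \<star>\<^bsub>A\<^esub> v n) = q (g (pull id {..<n} v)) \<oplus>\<^bsub>B\<^esub> q a \<star>\<^bsub>B\<^esub> v n"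
      using c a(1) rmod_homD(1)[OF g] by (simp add: rmod_homD(2,3)[OF q])
    then show ?thesis using hom_free_Suc[OF B Suc.prems(1) v] qg[OF c(1)] a(2) by simp
  qed
  then show ?case by (intro bexI[OF _ h] ballI)
qed

lemma hom_from_free_finite_support:
  assumes r: "r \<in> rmod_hom R (free R n) (direct_sum_copies X (reg R))"
  shows "finite {x \<in> X. \<exists>v\<in>carrier (free R n). r v x \<noteq> \<zero>}"
proof -
  interpret S: right_module R "direct_sum_copies X (reg R)"
    by (rule right_module_direct_sum_copies[OF reg_module])
  define Y where "Y = (\<Union>i<n. {x \<in> X. r (basis R n i) x \<noteq> \<zero>})"
  have "finite Y"
    using rmod_homD(1)[OF r basis_closed] unfolding Y_def by (auto simp: carrier_direct_sum_copies)
  moreover have "r v x = \<zero>" if v: "v \<in> carrier (free R n)" and x: "x \<in> X" "x \<notin> Y" for v x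
  proof (rule free_span[of v n "\<lambda>v. r v x = \<zero>", OF v])
    show "r \<zero>\<^bsub>free R n\<^esub> x = \<zero>"
      using rmod_hom_zero[OF r free_module S.right_module_axioms] x(1) by simp
    show "r (basis R n i) x = \<zero>" if "i < n" for i using x that by (auto simp: Y_def)
  qed (use x(1) in \<open>simp_all only: rmod_homD(2,3)[OF r]\<close>, use x(1) in simp_all)
  then have "{x \<in> X. \<exists>v\<in>carrier (free R n). r v x \<noteq> \<zero>} \<subseteq> Y" by blast
  ultimately show ?thesis by (rule rev_finite_subset)
qed

text \<open>The left module \<open>R\<^sup>n\<close> is noetherian. By induction on \<open>n\<close>, a submodule \<open>K\<close> is generated by
  functionals whose values on the last basis vector generate the left ideal of all such values,
  together with extensions of generators of the module of those members of \<open>K\<close> that vanish on the last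
  basis vector. Being generated by \<open>A\<close> is expressed as lying in every submodule containing
  \<open>A\<close>, as in the definition of left noetherian rings.\<close>

lemma functional_submodule_fg:
  assumes noeth: "left_noetherian R" and K: "functional_submodule R n K"
  shows "\<exists>A\<subseteq>K. finite A \<and> (\<forall>J. functional_submodule R n J \<longrightarrow> A \<subseteq> J \<longrightarrow> K \<subseteq> J)"
  using K
proof (induction n arbitrary: K)
  case 0
  have "k \<in> J" if k: "k \<in> K" and J: "functional_submodule R 0 J" for k J
  proof -
    have k': "k \<in> functionals R 0" by (rule functional_submoduleD(1)[OF 0 k])
    show ?thesis
    proof (rule functional_submoduleD(5)[OF J functional_submoduleD(2)[OF J] k'])
      fix v assume "v \<in> carrier (free R 0)"
      then show "k v = \<zero>" using free_0 functionalD(4)[OF k'] by metis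
    qed
  qed
  then show ?case by (intro exI[of _ "{}"]) auto
next
  case (Suc n)
  note KD = functional_submoduleD[OF Suc.prems]
  let ?e = "basis R (Suc n) n"
  have ev: "left_ideal ((\<lambda>k. k ?e) ` J) R" if J: "functional_submodule R (Suc n) J" for J
  proof (rule left_idealI[OF ring_axioms])
    note JD = functional_submoduleD[OF J]
    show "(\<lambda>k. k ?e) ` J \<subseteq> carrier R" using functionalD(1)[OF JD(1) basis_closed] by auto
    show "\<zero> \<in> (\<lambda>k. k ?e) ` J" using imageI[OF JD(2), of "\<lambda>k. k ?e"] by simp
    fix x assume "x \<in> (\<lambda>k. k ?e) ` J"
    then obtain k where k: "k \<in> J" "x = k ?e" by auto
    show "a \<otimes> x \<in> (\<lambda>k. k ?e) ` J" if a: "a \<in> carrier R" for a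
      using imageI[OF JD(4)[OF a k(1)], of "\<lambda>k. k ?e"] k(2) by simp
    fix y assume "y \<in> (\<lambda>k. k ?e) ` J"
    then obtain l where l: "l \<in> J" "y = l ?e" by auto
    show "x \<oplus> y \<in> (\<lambda>k. k ?e) ` J"
      using imageI[OF JD(3)[OF k(1) l(1)], of "\<lambda>k. k ?e"] k(2) l(2) by simp
  qed
  obtain A0 where A0: "A0 \<subseteq> carrier R" "finite A0"
    and A0gen: "(\<lambda>k. k ?e) ` K = \<Inter>{J. left_ideal J R \<and> A0 \<subseteq> J}"
    using noeth ev[OF Suc.prems] unfolding left_noetherian_def by meson
  have "A0 \<subseteq> (\<lambda>k. k ?e) ` K" unfolding A0gen by blast
  then obtain A0' where A0': "A0' \<subseteq> K" "finite A0'" "A0 = (\<lambda>k. k ?e) ` A0'"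
    using A0(2) by (meson finite_subset_image)
  define K0 where "K0 = {l \<in> functionals R n. \<exists>k\<in>K. k ?e = \<zero> \<and> (\<forall>v\<in>carrier (free R n). l v = k (incl R n v))}"
  have K0: "functional_submodule R n K0"
  proof (rule functional_submoduleI)
    show "(\<lambda>v. \<zero>) \<in> K0" using KD(2) functional_zero[of n] unfolding K0_def
      by (auto intro!: bexI[of _ "\<lambda>v. \<zero>"])
  next
    fix k l assume "k \<in> K0" "l \<in> K0"
    then obtain k' l' where kl: "k \<in> functionals R n" "l \<in> functionals R n" "k' \<in> K" "l' \<in> K"
      "k' ?e = \<zero>" "l' ?e = \<zero>" "\<forall>v\<in>carrier (free R n). k v = k' (incl R n v)"
      "\<forall>v\<in>carrier (free R n). l v = l' (incl R n v)" unfolding K0_def by blast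
    show "(\<lambda>v. k v \<oplus> l v) \<in> K0"
      using kl KD(3)[OF kl(3,4)] functional_add[OF kl(1,2)] unfolding K0_def
      by (auto intro!: bexI[of _ "\<lambda>v. k' v \<oplus> l' v"])
  next
    fix a k assume a: "a \<in> carrier R" and "k \<in> K0"
    then obtain k' where kl: "k \<in> functionals R n" "k' \<in> K"
      "k' ?e = \<zero>" "\<forall>v\<in>carrier (free R n). k v = k' (incl R n v)" unfolding K0_def by blast
    show "(\<lambda>v. a \<otimes> k v) \<in> K0"
      using a kl KD(4)[OF a kl(2)] functional_scale[OF kl(1) a] unfolding K0_def
      by (auto intro!: bexI[of _ "\<lambda>v. a \<otimes> k' v"])
  next
    fix k l assume "k \<in> K0" "l \<in> functionals R n" "\<And>v. v \<in> carrier (free R n) \<Longrightarrow> l v = k v"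
    then show "l \<in> K0" unfolding K0_def by auto
  qed (auto simp: K0_def)
  obtain A1 where A1: "A1 \<subseteq> K0" "finite A1"
    and "\<forall>J. functional_submodule R n J \<longrightarrow> A1 \<subseteq> J \<longrightarrow> K0 \<subseteq> J"
    using Suc.IH[OF K0] by (elim exE conjE) (rule that)
  then have A1gen: "K0 \<subseteq> J" if "functional_submodule R n J" "A1 \<subseteq> J" for J using that by simp
  have "\<forall>l\<in>A1. \<exists>k. k \<in> K \<and> k ?e = \<zero> \<and> (\<forall>v\<in>carrier (free R n). l v = k (incl R n v))"
    using A1(1) unfolding K0_def by blast
  then obtain \<kappa> where \<kappa>: "\<And>l. l \<in> A1 \<Longrightarrow> \<kappa> l \<in> K" "\<And>l. l \<in> A1 \<Longrightarrow> \<kappa> l ?e = \<zero>"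
    "\<And>l v. \<lbrakk>l \<in> A1; v \<in> carrier (free R n)\<rbrakk> \<Longrightarrow> l v = \<kappa> l (incl R n v)" by metis
  have vanish: "k v = k (incl R n (pull id {..<n} v))"
    if k: "k \<in> functionals R (Suc n)" "k ?e = \<zero>" and v: "v \<in> carrier (free R (Suc n))" for k v
    using hom_free_Suc[OF reg_module k(1) v] k(2) functionalD(1)[OF last_hom v]
      functionalD(1)[OF k(1) rmod_homD(1)[OF incl_hom rmod_homD(1)[OF proj_hom v]]] by simp
  have "k \<in> J" if J: "functional_submodule R (Suc n) J" and sub: "A0' \<union> \<kappa> ` A1 \<subseteq> J" and k: "k \<in> K" for J k
  proof -
    note JD = functional_submoduleD[OF J]
    have JK: "functional_submodule R (Suc n) (J \<inter> K)" by (rule functional_submodule_Int[OF J Suc.prems])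
    have "A0 \<subseteq> (\<lambda>k. k ?e) ` (J \<inter> K)" using A0' sub by auto
    then have "(\<lambda>k. k ?e) ` K \<subseteq> (\<lambda>k. k ?e) ` (J \<inter> K)"
      unfolding A0gen using ev[OF JK] by blast
    then obtain j where j: "j \<in> J" "j \<in> K" "k ?e = j ?e" using k by blast
    \<comment> \<open>The difference \<open>k - j\<close> vanishes on the last basis vector, so it comes from the first \<open>n\<close>
      coordinates, where the induction hypothesis applies.\<close>
    define d where "d v = k v \<oplus> \<ominus> \<one> \<otimes> j v" for v
    note kF = KD(1)[OF k] and jF = KD(1)[OF j(2)]
    have dK: "d \<in> K" unfolding d_def by (rule KD(3)[OF k KD(4)[OF _ j(2)]]) simp
    have d0: "d ?e = \<zero>" using j(3) functionalD(1)[OF jF basis_closed] by (simp add: d_def l_minus r_neg)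
    define J0 where "J0 = {l \<in> functionals R n. (\<lambda>v. l (pull id {..<n} v)) \<in> J}"
    have J0: "functional_submodule R n J0"
    proof (rule functional_submoduleI)
      fix k l assume kl: "k \<in> J0" "l \<in> functionals R n" "\<And>v. v \<in> carrier (free R n) \<Longrightarrow> l v = k v"
      then have "(\<lambda>v. l (pull id {..<n} v)) \<in> J"
        using JD(5)[OF _ rmod_hom_comp[OF proj_hom kl(2)], of "\<lambda>v. k (pull id {..<n} v)"]
          rmod_homD(1)[OF proj_hom] by (auto simp: J0_def)
      then show "l \<in> J0" using kl(2) by (simp add: J0_def)
    qed (use JD(2,3,4) functional_zero functional_add functional_scale in \<open>auto simp: J0_def\<close>)
    have "l \<in> J0" if l: "l \<in> A1" for l
    proof -
      have lF: "l \<in> functionals R n" using l A1(1) by (auto simp: K0_def)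
      have "\<kappa> l \<in> J" using sub l by blast
      then have "(\<lambda>v. l (pull id {..<n} v)) \<in> J"
        by (rule JD(5)[OF _ rmod_hom_comp[OF proj_hom lF]])
          (use vanish[OF KD(1)[OF \<kappa>(1)[OF l]] \<kappa>(2)[OF l]] \<kappa>(3)[OF l rmod_homD(1)[OF proj_hom]] in auto)
      then show ?thesis using lF by (simp add: J0_def)
    qed
    then have "K0 \<subseteq> J0" by (intro A1gen[OF J0]) auto
    moreover have "(\<lambda>v. d (incl R n v)) \<in> K0"
      using dK d0 rmod_hom_comp[OF incl_hom KD(1)[OF dK]] by (auto simp: K0_def)
    ultimately have "(\<lambda>v. d (incl R n (pull id {..<n} v))) \<in> J" by (auto simp: J0_def)
    then have "d \<in> J"
      by (rule JD(5)[OF _ KD(1)[OF dK]]) (rule vanish[OF KD(1)[OF dK] d0])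
    then have "(\<lambda>v. d v \<oplus> j v) \<in> J" by (rule JD(3)[OF _ j(1)])
    then show "k \<in> J"
    proof (rule JD(5)[OF _ kF])
      fix v assume v: "v \<in> carrier (free R (Suc n))"
      show "k v = d v \<oplus> j v"
        using functionalD(1)[OF kF v] functionalD(1)[OF jF v] by (simp add: d_def l_minus a_assoc l_neg)
    qed
  qed
  moreover have "A0' \<union> \<kappa> ` A1 \<subseteq> K" using A0'(1) \<kappa>(1) by auto
  moreover have "finite (A0' \<union> \<kappa> ` A1)" using A0'(2) A1(2) by simp
  ultimately show ?case by (intro exI[of _ "A0' \<union> \<kappa> ` A1"]) blast
qed

text \<open>Finitely many functionals are the coordinates of a single map \<open>\<gamma>\<close> of free modules, and a
  linear combination of them is \<open>c \<circ> \<gamma>\<close> for the functional \<open>c\<close> made of the coefficients.\<close>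

lemma finite_functionals_cover:
  assumes K: "functional_submodule R n K" and A: "finite A" "A \<subseteq> K"
  shows "\<exists>p. \<exists>\<gamma>\<in>rmod_hom R (free R n) (free R p).
    (\<forall>c\<in>functionals R p. (\<lambda>v. c (\<gamma> v)) \<in> K) \<and>
    (\<forall>k\<in>A. \<exists>c\<in>functionals R p. \<forall>v\<in>carrier (free R n). k v = c (\<gamma> v))"
  using A
proof (induction A rule: finite_induct)
  case empty
  have z: "(\<lambda>v. c \<zero>\<^bsub>free R 0\<^esub>) \<in> K" if "c \<in> functionals R 0" for c
    unfolding functionalD(4)[OF that] by (rule functional_submoduleD(2)[OF K])
  show ?case
    by (intro exI[of _ 0] bexI[OF _ rmod_hom_zero_map[OF free_module free_module]] conjI ballI z) simp_all
next
  case (insert k A)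
  note KD = functional_submoduleD[OF K]
  obtain p \<gamma> where \<gamma>: "\<gamma> \<in> rmod_hom R (free R n) (free R p)"
    and into: "\<And>c. c \<in> functionals R p \<Longrightarrow> (\<lambda>v. c (\<gamma> v)) \<in> K"
    and onto: "\<And>l. l \<in> A \<Longrightarrow> \<exists>c\<in>functionals R p. \<forall>v\<in>carrier (free R n). l v = c (\<gamma> v)"
    using insert by auto
  have kK: "k \<in> K" using insert.prems by simp
  note kF = KD(1)[OF kK]
  let ?e = "basis R (Suc p) p"
  define \<delta> where "\<delta> v = incl R p (\<gamma> v) \<oplus>\<^bsub>free R (Suc p)\<^esub> ?e \<star>\<^bsub>free R (Suc p)\<^esub> k v" for v
  have "(\<lambda>c. ?e \<star>\<^bsub>free R (Suc p)\<^esub> c) \<in> rmod_hom R (reg R) (free R (Suc p))"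
    using basis_closed by (intro rmod_homI) (simp_all del: direct_sum_copies_simps add: free.ract_r_distr free.ract_assoc)
  then have \<delta>: "\<delta> \<in> rmod_hom R (free R n) (free R (Suc p))"
    unfolding \<delta>_def by (intro rmod_hom_add[OF free_module] rmod_hom_comp[OF \<gamma> incl_hom] rmod_hom_comp[OF kF])
  have \<delta>p: "pull id {..<p} (\<delta> v) = \<gamma> v" if v: "v \<in> carrier (free R n)" for v
  proof -
    note c = rmod_homD(1)[OF incl_hom rmod_homD(1)[OF \<gamma> v]] functionalD(1)[OF kF v]
    have "pull id {..<p} (\<delta> v) = \<gamma> v \<oplus>\<^bsub>free R p\<^esub> \<zero>\<^bsub>free R p\<^esub> \<star>\<^bsub>free R p\<^esub> k v"
      unfolding \<delta>_def using c basis_closed rmod_homD(1)[OF \<gamma> v]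
      by (simp only: rmod_homD(2,3)[OF proj_hom] free.ract_closed proj_incl proj_basis)
    then show ?thesis using c rmod_homD(1)[OF \<gamma> v] by (simp del: direct_sum_copies_simps)
  qed
  have \<delta>l: "\<delta> v p = k v" if v: "v \<in> carrier (free R n)" for v
    using functionalD(1)[OF kF v] by (simp add: \<delta>_def incl_last basis_last)
  have "(\<lambda>v. c (\<delta> v)) \<in> K" if c: "c \<in> functionals R (Suc p)" for c
  proof -
    have "(\<lambda>v. c (incl R p (\<gamma> v)) \<oplus> c ?e \<otimes> k v) \<in> K"
      by (rule KD(3)[OF into[OF rmod_hom_comp[OF incl_hom c]] KD(4)[OF functionalD(1)[OF c basis_closed] kK]])
    then show ?thesis
    proof (rule KD(5)[OF _ rmod_hom_comp[OF \<delta> c]])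
      fix v assume v: "v \<in> carrier (free R n)"
      note d = rmod_homD(1)[OF incl_hom rmod_homD(1)[OF \<gamma> v]] functionalD(1)[OF kF v]
      show "c (\<delta> v) = c (incl R p (\<gamma> v)) \<oplus> c ?e \<otimes> k v"
        unfolding \<delta>_def using d basis_closed by (simp only: functionalD(2,3)[OF c] free.ract_closed)
    qed
  qed
  moreover have "\<exists>c\<in>functionals R (Suc p). \<forall>v\<in>carrier (free R n). l v = c (\<delta> v)" if l: "l \<in> insert k A" for l
  proof (cases "l \<in> A")
    case True
    then obtain c where c: "c \<in> functionals R p" "\<forall>v\<in>carrier (free R n). l v = c (\<gamma> v)" using onto by blast
    show ?thesis
      using rmod_hom_comp[OF proj_hom c(1)] c(2) \<delta>p by (intro bexI[of _ "\<lambda>w. c (pull id {..<p} w)"]) auto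
  next
    case False
    then show ?thesis using l \<delta>l last_hom by (intro bexI[of _ "\<lambda>w. w p"]) auto
  qed
  ultimately show ?case using \<delta> by blast
qed

lemma functional_submodule_cover:
  assumes noeth: "left_noetherian R" and K: "functional_submodule R n K"
  shows "\<exists>p. \<exists>\<gamma>\<in>rmod_hom R (free R n) (free R p).
    (\<forall>c\<in>functionals R p. (\<lambda>v. c (\<gamma> v)) \<in> K) \<and>
    (\<forall>k\<in>K. \<exists>c\<in>functionals R p. \<forall>v\<in>carrier (free R n). k v = c (\<gamma> v))"
proof -
  obtain A where A: "A \<subseteq> K" "finite A" and gen: "\<And>J. functional_submodule R n J \<Longrightarrow> A \<subseteq> J \<Longrightarrow> K \<subseteq> J"
    using functional_submodule_fg[OF noeth K] by blast
  obtain p \<gamma> where \<gamma>: "\<gamma> \<in> rmod_hom R (free R n) (free R p)"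
    and into: "\<And>c. c \<in> functionals R p \<Longrightarrow> (\<lambda>v. c (\<gamma> v)) \<in> K"
    and onto: "\<And>k. k \<in> A \<Longrightarrow> \<exists>c\<in>functionals R p. \<forall>v\<in>carrier (free R n). k v = c (\<gamma> v)"
    using finite_functionals_cover[OF K A(2,1)] by blast
  define J where "J = {k \<in> functionals R n. \<exists>c\<in>functionals R p. \<forall>v\<in>carrier (free R n). k v = c (\<gamma> v)}"
  have "functional_submodule R n J"
  proof (rule functional_submoduleI)
    show "(\<lambda>v. \<zero>) \<in> J" using functional_zero[of n] functional_zero[of p] unfolding J_def
      by (auto intro!: bexI[of _ "\<lambda>v. \<zero>"])
  next
    fix k l assume "k \<in> J" "l \<in> J"
    then obtain c d where cd: "k \<in> functionals R n" "l \<in> functionals R n" "c \<in> functionals R p" "d \<in> functionals R p"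
      "\<forall>v\<in>carrier (free R n). k v = c (\<gamma> v)" "\<forall>v\<in>carrier (free R n). l v = d (\<gamma> v)" unfolding J_def by blast
    show "(\<lambda>v. k v \<oplus> l v) \<in> J"
      using cd functional_add[OF cd(1,2)] functional_add[OF cd(3,4)] unfolding J_def
      by (auto intro!: bexI[of _ "\<lambda>v. c v \<oplus> d v"])
  next
    fix a k assume a: "a \<in> carrier R" and "k \<in> J"
    then obtain c where c: "k \<in> functionals R n" "c \<in> functionals R p"
      "\<forall>v\<in>carrier (free R n). k v = c (\<gamma> v)" unfolding J_def by blast
    show "(\<lambda>v. a \<otimes> k v) \<in> J"
      using c functional_scale[OF c(1) a] functional_scale[OF c(2) a] unfolding J_def
      by (auto intro!: bexI[of _ "\<lambda>v. a \<otimes> c v"])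
  next
    fix k l assume "k \<in> J" "l \<in> functionals R n" "\<And>v. v \<in> carrier (free R n) \<Longrightarrow> l v = k v"
    then show "l \<in> J" unfolding J_def by auto
  qed (auto simp: J_def)
  moreover have "A \<subseteq> J" using onto A(1) functional_submoduleD(1)[OF K] unfolding J_def by blast
  ultimately have "K \<subseteq> J" by (rule gen)
  then show ?thesis using \<gamma> into unfolding J_def by blast
qed

end

section \<open>Modules of fractions modulo integral fractions\<close>

locale central_subset = ring R for R :: "('r, 'k) ring_scheme" (structure) +
  fixes T assumes central: "central_mult_subset T R"
begin

lemma T_closed [simp]: "t \<in> T \<Longrightarrow> t \<in> carrier R"
  and one_T [simp]: "\<one> \<in> T"
  and T_mult [simp]: "\<lbrakk>s \<in> T; t \<in> T\<rbrakk> \<Longrightarrow> s \<otimes> t \<in> T"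
  and T_comm: "\<lbrakk>t \<in> T; a \<in> carrier R\<rbrakk> \<Longrightarrow> t \<otimes> a = a \<otimes> t"
  using central submonoid.subset[of T R] submonoid.one_closed[of T R] submonoid.m_closed[of T R s t]
  by (auto simp: central_mult_subset_def)

text \<open>Finitely many denominators have a common multiple.\<close>

lemma common_multiple:
  assumes "finite Y" and ex: "\<And>y. y \<in> Y \<Longrightarrow> \<exists>t\<in>T. P y t"
    and mono: "\<And>y s t. \<lbrakk>y \<in> Y; s \<in> T; t \<in> T; P y s\<rbrakk> \<Longrightarrow> P y (s \<otimes> t)"
  shows "\<exists>t\<in>T. \<forall>y\<in>Y. P y t"
  using assms
proof (induction Y rule: finite_induct)
  case empty then show ?case using one_T by blast
next
  case (insert y Y)
  obtain s where s: "s \<in> T" "\<forall>y\<in>Y. P y s" using insert by auto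
  obtain t where t: "t \<in> T" "P y t" using insert.prems(1) by auto
  have "P y (s \<otimes> t)" using insert.prems(2)[OF _ t(1) s(1) t(2)] T_comm[of t s] s t by simp
  moreover have "\<forall>y\<in>Y. P y (s \<otimes> t)" using insert.prems(2) s t by simp
  ultimately show ?case using s(1) t(1) by (intro bexI[of _ "s \<otimes> t"]) auto
qed

end

text \<open>The cokernel of the localization map is generated by the classes \<open>e s\<close> of the unit
  fractions \<open>1/s\<close>. The assumptions describe it completely, and the rest of the argument uses nothing
  else about it. In \<open>e_zero\<close>, the factor \<open>u\<close> accounts for the torsion of \<open>R\<close>.\<close>

locale unit_fractions = right_module R M + central_subset R T
  for R :: "('r, 'k) ring_scheme" (structure) and M :: "('r, 'm) rmodule" and T +
  fixes e :: "'r \<Rightarrow> 'm"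
  assumes e_closed: "s \<in> T \<Longrightarrow> e s \<in> carrier M"
    and e_mult: "\<lbrakk>s \<in> T; u \<in> T\<rbrakk> \<Longrightarrow> e (s \<otimes> u) \<star>\<^bsub>M\<^esub> u = e s"
    and e_gen: "m \<in> carrier M \<Longrightarrow> \<exists>s\<in>T. \<exists>a\<in>carrier R. m = e s \<star>\<^bsub>M\<^esub> a"
    and e_zero: "\<lbrakk>s \<in> T; a \<in> carrier R\<rbrakk> \<Longrightarrow>
      e s \<star>\<^bsub>M\<^esub> a = \<zero>\<^bsub>M\<^esub> \<longleftrightarrow> (\<exists>u\<in>T. \<exists>c\<in>carrier R. a \<otimes> u = c \<otimes> s \<otimes> u)"
begin

sublocale free_modules R by unfold_locales

abbreviation Ms :: "'x set \<Rightarrow> ('r, 'x \<Rightarrow> 'm) rmodule" where "Ms X \<equiv> direct_sum_copies X M"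
abbreviation Rs :: "'x set \<Rightarrow> ('r, 'x \<Rightarrow> 'r) rmodule" where "Rs X \<equiv> direct_sum_copies X (reg R)"

lemma M_module: "right_module R M" by (rule right_module_axioms)

sublocale Ms: right_module R "Ms X" for X by (rule right_module_direct_sum_copies[OF M_module])
sublocale Rs: right_module R "Rs X" for X by (rule right_module_direct_sum_copies[OF reg_module])

lemma central_act_hom:
  assumes "right_module R A" "t \<in> T"
  shows "(\<lambda>x. x \<star>\<^bsub>A\<^esub> t) \<in> rmod_hom R A A"
proof -
  interpret A: right_module R A by fact
  show ?thesis
    using assms(2) T_comm[OF assms(2)] A.ract_assoc
    by (intro rmod_homI) (simp_all add: A.ract_l_distr flip: A.ract_assoc)
qed

lemma e_ract_mult:
  "\<lbrakk>s \<in> T; u \<in> T; a \<in> carrier R\<rbrakk> \<Longrightarrow> e (s \<otimes> u) \<star>\<^bsub>M\<^esub> (a \<otimes> u) = e s \<star>\<^bsub>M\<^esub> a"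
  using e_mult[of s u] T_comm[of u a] ract_assoc[of "e (s \<otimes> u)" u a] e_closed[of "s \<otimes> u"] by simp

lemma e_ract_self: "\<lbrakk>s \<in> T; a \<in> carrier R\<rbrakk> \<Longrightarrow> e s \<star>\<^bsub>M\<^esub> (a \<otimes> s) = \<zero>\<^bsub>M\<^esub>"
  by (rule iffD2[OF e_zero], simp_all, rule bexI[of _ \<one>], rule bexI[of _ a]) simp_all

lemma Rs_coord: "\<lbrakk>w \<in> carrier (Rs X); x \<in> X\<rbrakk> \<Longrightarrow> w x \<in> carrier R"
  using direct_sum_copies_coord[of w X "reg R" x] by simp

text \<open>The vector of fractions \<open>w/s\<close>.\<close>

definition q :: "'x set \<Rightarrow> 'r \<Rightarrow> ('x \<Rightarrow> 'r) \<Rightarrow> 'x \<Rightarrow> 'm"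
  where "q X s w = (\<lambda>x\<in>X. e s \<star>\<^bsub>M\<^esub> w x)"

lemma q_hom:
  assumes s: "s \<in> T" shows "q X s \<in> rmod_hom R (Rs X) (Ms X)"
  unfolding q_def
proof (rule direct_sum_copies_hom_into)
  fix x assume "x \<in> X"
  then show "(\<lambda>w. e s \<star>\<^bsub>M\<^esub> w x) \<in> rmod_hom R (Rs X) M"
    using e_closed[OF s]
    by (intro rmod_homI) (simp_all add: ract_r_distr ract_assoc Rs_coord)
next
  fix w assume w: "w \<in> carrier (Rs X)"
  have "{x \<in> X. e s \<star>\<^bsub>M\<^esub> w x \<noteq> \<zero>\<^bsub>M\<^esub>} \<subseteq> {x \<in> X. w x \<noteq> \<zero>}" using e_closed[OF s] by auto
  moreover have "finite {x \<in> X. w x \<noteq> \<zero>}" using w by (simp add: carrier_direct_sum_copies)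
  ultimately show "finite {x \<in> X. e s \<star>\<^bsub>M\<^esub> w x \<noteq> \<zero>\<^bsub>M\<^esub>}" by (rule finite_subset)
qed

lemma q_closed: "\<lbrakk>s \<in> T; w \<in> carrier (Rs X)\<rbrakk> \<Longrightarrow> q X s w \<in> carrier (Ms X)"
  by (rule rmod_homD(1)[OF q_hom])

lemma q_scale: "\<lbrakk>s \<in> T; u \<in> T; w \<in> carrier (Rs X)\<rbrakk> \<Longrightarrow> q X (s \<otimes> u) (w \<star>\<^bsub>Rs X\<^esub> u) = q X s w"
  by (auto simp: q_def e_ract_mult Rs_coord intro!: restrict_ext)

lemma q_ract_self: "\<lbrakk>s \<in> T; w \<in> carrier (Rs X)\<rbrakk> \<Longrightarrow> q X s (w \<star>\<^bsub>Rs X\<^esub> s) = \<zero>\<^bsub>Ms X\<^esub>"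
  by (auto simp: q_def e_ract_self Rs_coord intro!: restrict_ext)

text \<open>A vector of finite support has a common denominator.\<close>

lemma q_surj:
  assumes y: "y \<in> carrier (Ms X)"
  shows "\<exists>s\<in>T. \<exists>w\<in>carrier (Rs X). y = q X s w"
proof -
  define Y where "Y = {x \<in> X. y x \<noteq> \<zero>\<^bsub>M\<^esub>}"
  have fin: "finite Y" using y by (simp add: Y_def carrier_direct_sum_copies)
  have "\<exists>s\<in>T. \<forall>x\<in>Y. \<exists>a\<in>carrier R. y x = e s \<star>\<^bsub>M\<^esub> a"
  proof (rule common_multiple[OF fin])
    fix x assume "x \<in> Y"
    then show "\<exists>s\<in>T. \<exists>a\<in>carrier R. y x = e s \<star>\<^bsub>M\<^esub> a"
      using direct_sum_copies_coord[OF y] by (intro e_gen) (auto simp: Y_def)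
  next
    fix x s t assume st: "s \<in> T" "t \<in> T" and "\<exists>a\<in>carrier R. y x = e s \<star>\<^bsub>M\<^esub> a"
    then obtain a where "a \<in> carrier R" "y x = e s \<star>\<^bsub>M\<^esub> a" by blast
    then show "\<exists>a\<in>carrier R. y x = e (s \<otimes> t) \<star>\<^bsub>M\<^esub> a"
      using st e_ract_mult by (intro bexI[of _ "a \<otimes> t"]) auto
  qed
  then obtain s a where s: "s \<in> T" and a: "\<And>x. x \<in> Y \<Longrightarrow> a x \<in> carrier R" "\<And>x. x \<in> Y \<Longrightarrow> y x = e s \<star>\<^bsub>M\<^esub> a x"
    by metis
  define w where "w = (\<lambda>x\<in>X. if x \<in> Y then a x else \<zero>)"
  have w: "w \<in> carrier (Rs X)"
    unfolding w_def by (rule direct_sum_copies_restrict[OF _ fin]) (use a(1) in auto)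
  moreover have "y = q X s w"
  proof (rule direct_sum_copies_eqI[OF y q_closed[OF s w]])
    fix x assume x: "x \<in> X"
    show "y x = q X s w x"
    proof (cases "x \<in> Y")
      case True then show ?thesis using x a(2)[OF True] by (simp add: q_def w_def)
    next
      case False
      then have "y x = \<zero>\<^bsub>M\<^esub>" using x by (simp add: Y_def)
      then show ?thesis using x False e_closed[OF s] by (simp add: q_def w_def)
    qed
  qed
  ultimately show ?thesis using s by blast
qed

lemma q_zero:
  assumes s: "s \<in> T" and w: "w \<in> carrier (Rs X)" and 0: "q X s w = \<zero>\<^bsub>Ms X\<^esub>"
  shows "\<exists>u\<in>T. \<exists>c\<in>carrier (Rs X). w \<star>\<^bsub>Rs X\<^esub> u = c \<star>\<^bsub>Rs X\<^esub> s \<star>\<^bsub>Rs X\<^esub> u"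
proof -
  define Y where "Y = {x \<in> X. w x \<noteq> \<zero>}"
  have fin: "finite Y" using w by (simp add: Y_def carrier_direct_sum_copies)
  have "\<exists>u\<in>T. \<forall>x\<in>Y. \<exists>c\<in>carrier R. w x \<otimes> u = c \<otimes> s \<otimes> u"
  proof (rule common_multiple[OF fin])
    fix x assume "x \<in> Y"
    then have x: "x \<in> X" by (simp add: Y_def)
    have "e s \<star>\<^bsub>M\<^esub> w x = \<zero>\<^bsub>M\<^esub>" using fun_cong[OF 0, of x] x by (simp add: q_def)
    then show "\<exists>u\<in>T. \<exists>c\<in>carrier R. w x \<otimes> u = c \<otimes> s \<otimes> u" using e_zero[OF s Rs_coord[OF w x]] by simp
  next
    fix x u t assume x: "x \<in> Y" and ut: "u \<in> T" "t \<in> T" and "\<exists>c\<in>carrier R. w x \<otimes> u = c \<otimes> s \<otimes> u"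
    then obtain c where c: "c \<in> carrier R" "w x \<otimes> u = c \<otimes> s \<otimes> u" by blast
    have "w x \<otimes> (u \<otimes> t) = c \<otimes> s \<otimes> (u \<otimes> t)"
      using c s ut x Rs_coord[OF w] m_assoc[of "w x" u t] m_assoc[of "c \<otimes> s" u t] by (simp add: Y_def)
    then show "\<exists>c\<in>carrier R. w x \<otimes> (u \<otimes> t) = c \<otimes> s \<otimes> (u \<otimes> t)" using c(1) by blast
  qed
  then obtain u c where u: "u \<in> T" and c: "\<And>x. x \<in> Y \<Longrightarrow> c x \<in> carrier R"
    "\<And>x. x \<in> Y \<Longrightarrow> w x \<otimes> u = c x \<otimes> s \<otimes> u" by metis
  define d where "d = (\<lambda>x\<in>X. if x \<in> Y then c x else \<zero>)"
  have "d \<in> carrier (Rs X)"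
    unfolding d_def by (rule direct_sum_copies_restrict[OF _ fin]) (use c(1) in auto)
  moreover have "w \<star>\<^bsub>Rs X\<^esub> u = d \<star>\<^bsub>Rs X\<^esub> s \<star>\<^bsub>Rs X\<^esub> u"
    using c(2) s u by (auto simp: d_def Y_def intro!: restrict_ext)
  ultimately show ?thesis using u by blast
qed

text \<open>The \<open>s\<close>-torsion consists of the fractions with denominator \<open>s\<close>: if \<open>s w/t\<close> is integral,
  then up to torsion \<open>s w\<close> is a multiple \<open>t c\<close>, so \<open>w/t = c/s\<close>.\<close>

lemma q_level:
  assumes s: "s \<in> T" and y: "y \<in> carrier (Ms X)" and 0: "y \<star>\<^bsub>Ms X\<^esub> s = \<zero>\<^bsub>Ms X\<^esub>"
  shows "y \<in> q X s ` carrier (Rs X)"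
proof -
  obtain t w where t: "t \<in> T" and w: "w \<in> carrier (Rs X)" and yq: "y = q X t w" using q_surj[OF y] by blast
  have "q X t (w \<star>\<^bsub>Rs X\<^esub> s) = \<zero>\<^bsub>Ms X\<^esub>"
    using 0 rmod_homD(3)[OF q_hom[OF t] w] s yq by simp
  then obtain u c where u: "u \<in> T" and c: "c \<in> carrier (Rs X)"
    and eq: "w \<star>\<^bsub>Rs X\<^esub> s \<star>\<^bsub>Rs X\<^esub> u = c \<star>\<^bsub>Rs X\<^esub> t \<star>\<^bsub>Rs X\<^esub> u"
    using q_zero[OF t Rs.ract_closed[OF w]] s by (metis T_closed)
  have "y = q X (t \<otimes> (s \<otimes> u)) (w \<star>\<^bsub>Rs X\<^esub> (s \<otimes> u))"
    using q_scale[OF t _ w, of "s \<otimes> u"] s u yq by simp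
  also have "w \<star>\<^bsub>Rs X\<^esub> (s \<otimes> u) = c \<star>\<^bsub>Rs X\<^esub> (t \<otimes> u)"
    using Rs.ract_assoc[OF w, of s u] Rs.ract_assoc[OF c, of t u] s t u eq by (simp del: direct_sum_copies_simps)
  also have "t \<otimes> (s \<otimes> u) = s \<otimes> (t \<otimes> u)"
    using T_comm[of t s] s t u m_assoc[of t s u] m_assoc[of s t u] by simp
  also have "q X (s \<otimes> (t \<otimes> u)) (c \<star>\<^bsub>Rs X\<^esub> (t \<otimes> u)) = q X s c" using q_scale[OF s _ c] t u by simp
  finally show ?thesis using c by blast
qed

lemma Ms_divisible:
  assumes s: "s \<in> T" and y: "y \<in> carrier (Ms X)"
  shows "\<exists>z\<in>carrier (Ms X). z \<star>\<^bsub>Ms X\<^esub> s = y"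
proof -
  obtain t w where t: "t \<in> T" and w: "w \<in> carrier (Rs X)" and yq: "y = q X t w" using q_surj[OF y] by blast
  have "q X (t \<otimes> s) w \<star>\<^bsub>Ms X\<^esub> s = y"
    using q_scale[OF t s w] rmod_homD(3)[OF q_hom w, of "t \<otimes> s" s] s t yq by simp
  then show ?thesis by (rule bexI[OF _ q_closed[OF T_mult[OF t s] w]])
qed

lemma Ms_hom_eqI:
  assumes "\<And>s w. \<lbrakk>s \<in> T; w \<in> carrier (Rs X)\<rbrakk> \<Longrightarrow> f (q X s w) = g (q X s w)" "y \<in> carrier (Ms X)"
  shows "f y = g y"
  using q_surj[OF assms(2)] assms(1) by blast

text \<open>A homomorphism killing the \<open>s\<close>-torsion is divisible by \<open>s\<close>: precompose it with
  any set-theoretic section of multiplication by \<open>s\<close>.\<close>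

lemma divide_hom:
  assumes D: "right_module R D" and s: "s \<in> T" and h: "h \<in> rmod_hom R (Ms X) D"
    and 0: "\<And>w. w \<in> carrier (Rs X) \<Longrightarrow> h (q X s w) = \<zero>\<^bsub>D\<^esub>"
  shows "\<exists>g\<in>rmod_hom R (Ms X) D. \<forall>x\<in>carrier (Ms X). h x = g (x \<star>\<^bsub>Ms X\<^esub> s)"
proof -
  interpret D: right_module R D by fact
  note hD = rmod_homD[OF h] and act = rmod_homD[OF central_act_hom[OF Ms.right_module_axioms s], of _ X]
  have sR: "s \<in> carrier R" using s by simp
  have wd: "h x = h y" if x: "x \<in> carrier (Ms X)" and y: "y \<in> carrier (Ms X)"
    and eq: "x \<star>\<^bsub>Ms X\<^esub> s = y \<star>\<^bsub>Ms X\<^esub> s" for x y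
  proof -
    have "(x \<ominus>\<^bsub>Ms X\<^esub> y) \<star>\<^bsub>Ms X\<^esub> s = \<zero>\<^bsub>Ms X\<^esub>"
      unfolding Ms.diff_ract[OF x y sR] using Ms.diff_eq_zero_iff[of "x \<star>\<^bsub>Ms X\<^esub> s" X "y \<star>\<^bsub>Ms X\<^esub> s"] x y sR eq
      by (simp del: direct_sum_copies_simps)
    then have "h (x \<ominus>\<^bsub>Ms X\<^esub> y) = \<zero>\<^bsub>D\<^esub>" using imageE[OF q_level[OF s Ms.M.minus_closed[OF x y]]] 0 by metis
    then show ?thesis
      unfolding rmod_hom_diff[OF h Ms.right_module_axioms D x y] using D.diff_eq_zero_iff hD(1) x y by blast
  qed
  define g where "g x = h (SOME z. z \<in> carrier (Ms X) \<and> z \<star>\<^bsub>Ms X\<^esub> s = x)" for x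
  have g: "g (z \<star>\<^bsub>Ms X\<^esub> s) = h z" if z: "z \<in> carrier (Ms X)" for z
  proof -
    have "(SOME z'. z' \<in> carrier (Ms X) \<and> z' \<star>\<^bsub>Ms X\<^esub> s = z \<star>\<^bsub>Ms X\<^esub> s) \<in> carrier (Ms X) \<and>
      (SOME z'. z' \<in> carrier (Ms X) \<and> z' \<star>\<^bsub>Ms X\<^esub> s = z \<star>\<^bsub>Ms X\<^esub> s) \<star>\<^bsub>Ms X\<^esub> s = z \<star>\<^bsub>Ms X\<^esub> s"
      by (rule someI[of _ z]) (simp add: z del: direct_sum_copies_simps)
    then show ?thesis unfolding g_def using wd z by blast
  qed
  have "g \<in> rmod_hom R (Ms X) D"
  proof (rule rmod_homI)
    fix x assume x: "x \<in> carrier (Ms X)"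
    obtain x' where x': "x' \<in> carrier (Ms X)" "x' \<star>\<^bsub>Ms X\<^esub> s = x" using Ms_divisible[OF s x] by blast
    show "g x \<in> carrier D" using g[OF x'(1)] hD(1)[OF x'(1)] x'(2) by simp
    show "g (x \<star>\<^bsub>Ms X\<^esub> a) = g x \<star>\<^bsub>D\<^esub> a" if a: "a \<in> carrier R" for a
      using g[OF Ms.ract_closed[OF x'(1) a]] act(3)[OF x'(1) a] g[OF x'(1)] hD(3)[OF x'(1) a] x'(2)
      by (simp del: direct_sum_copies_simps)
    fix y assume y: "y \<in> carrier (Ms X)"
    obtain y' where y': "y' \<in> carrier (Ms X)" "y' \<star>\<^bsub>Ms X\<^esub> s = y" using Ms_divisible[OF s y] by blast
    show "g (x \<oplus>\<^bsub>Ms X\<^esub> y) = g x \<oplus>\<^bsub>D\<^esub> g y"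
      using g[OF Ms.M.a_closed[OF x'(1) y'(1)]] act(2)[OF x'(1) y'(1)] g[OF x'(1)] g[OF y'(1)]
        hD(2)[OF x'(1) y'(1)] x'(2) y'(2)
      by (simp del: direct_sum_copies_simps)
  qed
  then show ?thesis using g by metis
qed

text \<open>A linear map between free modules acts on numerators. The result is well defined because two
  representations of a vector can be brought to a common denominator, and linear maps send multiples of
  the denominator to multiples of the denominator.\<close>

lemma extend_hom:
  assumes c: "c \<in> rmod_hom R (Rs Y) (Rs X)"
  shows "\<exists>C\<in>rmod_hom R (Ms Y) (Ms X). \<forall>s\<in>T. \<forall>w\<in>carrier (Rs Y). C (q Y s w) = q X s (c w)"
proof -
  note cD = rmod_homD[OF c]
  have wd: "q X s (c w) = q X s' (c w')" if s: "s \<in> T" "s' \<in> T" and w: "w \<in> carrier (Rs Y)" "w' \<in> carrier (Rs Y)"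
    and eq: "q Y s w = q Y s' w'" for s s' w w'
  proof -
    let ?d = "w \<star>\<^bsub>Rs Y\<^esub> s' \<ominus>\<^bsub>Rs Y\<^esub> w' \<star>\<^bsub>Rs Y\<^esub> s"
    let ?t = "s \<otimes> s'"
    have tT: "?t \<in> T" and sR: "s \<in> carrier R" "s' \<in> carrier R" using s by auto
    have comm: "s' \<otimes> s = ?t" using T_comm[OF s(2) sR(1)] by simp
    have cl: "w \<star>\<^bsub>Rs Y\<^esub> s' \<in> carrier (Rs Y)" "w' \<star>\<^bsub>Rs Y\<^esub> s \<in> carrier (Rs Y)" using Rs.ract_closed w sR by auto
    have d: "?d \<in> carrier (Rs Y)" using Rs.M.minus_closed cl by blast
    have q1: "q Y ?t (w \<star>\<^bsub>Rs Y\<^esub> s') = q Y s w" using q_scale[OF s w(1)] .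
    have q2: "q Y ?t (w' \<star>\<^bsub>Rs Y\<^esub> s) = q Y s' w'" using q_scale[OF s(2,1) w(2)] comm by simp
    have "q Y ?t ?d = \<zero>\<^bsub>Ms Y\<^esub>"
      using rmod_hom_diff[OF q_hom[OF tT] Rs.right_module_axioms Ms.right_module_axioms cl] q1 q2 eq
        Ms.diff_eq_zero_iff[OF q_closed[OF s(2) w(2)] q_closed[OF s(2) w(2)]]
      by (simp del: direct_sum_copies_simps)
    then obtain u x where u: "u \<in> T" and x: "x \<in> carrier (Rs Y)"
      and du: "?d \<star>\<^bsub>Rs Y\<^esub> u = x \<star>\<^bsub>Rs Y\<^esub> ?t \<star>\<^bsub>Rs Y\<^esub> u" using q_zero[OF tT d] by blast
    have uR: "u \<in> carrier R" and tR: "?t \<in> carrier R" and tu: "?t \<otimes> u \<in> T" using u sR tT by auto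
    have "q X ?t (c ?d) = q X (?t \<otimes> u) (c ?d \<star>\<^bsub>Rs X\<^esub> u)" using q_scale[OF tT u cD(1)[OF d]] by simp
    also have "c ?d \<star>\<^bsub>Rs X\<^esub> u = c x \<star>\<^bsub>Rs X\<^esub> (?t \<otimes> u)"
      using cD(3)[OF d uR] du cD(3)[OF Rs.ract_closed[OF x tR] uR] cD(3)[OF x tR]
        Rs.ract_assoc[OF cD(1)[OF x] tR uR] by (simp del: direct_sum_copies_simps)
    also have "q X (?t \<otimes> u) (c x \<star>\<^bsub>Rs X\<^esub> (?t \<otimes> u)) = \<zero>\<^bsub>Ms X\<^esub>" using q_ract_self[OF tu cD(1)[OF x]] .
    finally have 0: "q X ?t (c ?d) = \<zero>\<^bsub>Ms X\<^esub>" .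
    have p1: "q X ?t (c (w \<star>\<^bsub>Rs Y\<^esub> s')) = q X s (c w)" unfolding cD(3)[OF w(1) sR(2)] using q_scale[OF s cD(1)[OF w(1)]] .
    have p2: "q X ?t (c (w' \<star>\<^bsub>Rs Y\<^esub> s)) = q X s' (c w')"
      unfolding cD(3)[OF w(2) sR(1)] using q_scale[OF s(2,1) cD(1)[OF w(2)]] comm by simp
    have "q X s (c w) \<ominus>\<^bsub>Ms X\<^esub> q X s' (c w') = \<zero>\<^bsub>Ms X\<^esub>"
      using rmod_hom_diff[OF q_hom[OF tT] Rs.right_module_axioms Ms.right_module_axioms cD(1)[OF cl(1)] cD(1)[OF cl(2)]]
        rmod_hom_diff[OF c Rs.right_module_axioms Rs.right_module_axioms cl] 0 p1 p2
      by (simp del: direct_sum_copies_simps)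
    then show ?thesis using Ms.diff_eq_zero_iff q_closed[OF s(1) cD(1)[OF w(1)]] q_closed[OF s(2) cD(1)[OF w(2)]] by blast
  qed
  define P where "P y z \<longleftrightarrow> (\<exists>s\<in>T. \<exists>w\<in>carrier (Rs Y). y = q Y s w \<and> z = q X s (c w))" for y z
  define C where "C y = (SOME z. P y z)" for y
  have C: "C (q Y s w) = q X s (c w)" if s: "s \<in> T" and w: "w \<in> carrier (Rs Y)" for s w
  proof -
    have "P (q Y s w) (q X s (c w))" using s w by (auto simp: P_def)
    then have "P (q Y s w) (C (q Y s w))" unfolding C_def by (rule someI[of "P (q Y s w)"])
    then obtain s' w' where "s' \<in> T" "w' \<in> carrier (Rs Y)" "q Y s w = q Y s' w'" "C (q Y s w) = q X s' (c w')"
      unfolding P_def by blast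
    then show ?thesis using wd[OF s _ w] by simp
  qed
  have "C \<in> rmod_hom R (Ms Y) (Ms X)"
  proof (rule rmod_homI)
    fix x assume x: "x \<in> carrier (Ms Y)"
    obtain s w where s: "s \<in> T" and w: "w \<in> carrier (Rs Y)" and xq: "x = q Y s w" using q_surj[OF x] by blast
    show "C x \<in> carrier (Ms X)" unfolding xq C[OF s w] by (rule q_closed[OF s cD(1)[OF w]])
    show "C (x \<star>\<^bsub>Ms Y\<^esub> a) = C x \<star>\<^bsub>Ms X\<^esub> a" if a: "a \<in> carrier R" for a
      using C[OF s Rs.ract_closed[OF w a]] C[OF s w] rmod_homD(3)[OF q_hom[OF s] w a]
        rmod_homD(3)[OF q_hom[OF s] cD(1)[OF w] a] cD(3)[OF w a] xq by (simp del: direct_sum_copies_simps)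
    fix y assume y: "y \<in> carrier (Ms Y)"
    obtain s' w' where s': "s' \<in> T" and w': "w' \<in> carrier (Rs Y)" and yq: "y = q Y s' w'" using q_surj[OF y] by blast
    define t where "t = s \<otimes> s'"
    have t: "t \<in> T" and sR: "s \<in> carrier R" "s' \<in> carrier R" using s s' by (auto simp: t_def)
    have comm: "s' \<otimes> s = t" using T_comm[OF s' sR(1)] by (simp add: t_def)
    define v where "v = w \<star>\<^bsub>Rs Y\<^esub> s'"
    define v' where "v' = w' \<star>\<^bsub>Rs Y\<^esub> s"
    have v: "v \<in> carrier (Rs Y)" "v' \<in> carrier (Rs Y)" unfolding v_def v'_def using Rs.ract_closed w w' sR by auto
    have "x = q Y t v" "y = q Y t v'"
      using q_scale[OF s s' w] q_scale[OF s' s w'] comm xq yq by (simp_all only: v_def v'_def t_def)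
    then show "C (x \<oplus>\<^bsub>Ms Y\<^esub> y) = C x \<oplus>\<^bsub>Ms X\<^esub> C y"
      using C[OF t Rs.M.a_closed[OF v]] C[OF t v(1)] C[OF t v(2)] rmod_homD(2)[OF q_hom[OF t] v]
        rmod_homD(2)[OF q_hom[OF t] cD(1)[OF v(1)] cD(1)[OF v(2)]] cD(2)[OF v] by (simp del: direct_sum_copies_simps)
  qed
  then show ?thesis using C by blast
qed

section \<open>Factorization of homomorphisms up to a denominator\<close>

abbreviation Mn :: "nat \<Rightarrow> ('r, nat \<Rightarrow> 'm) rmodule" where "Mn n \<equiv> Ms {..<n}"
abbreviation qn :: "nat \<Rightarrow> 'r \<Rightarrow> (nat \<Rightarrow> 'r) \<Rightarrow> nat \<Rightarrow> 'm" where "qn n \<equiv> q {..<n}"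

text \<open>If \<open>f\<close> vanishes after division by \<open>s\<close>, then up to torsion it is divisible by \<open>s\<close> as a
  functional. The factor \<open>u\<close> can be chosen uniformly because it suffices to treat the finitely many
  basis vectors.\<close>

lemma functional_lift:
  assumes f: "f \<in> functionals R n" and s: "s \<in> T"
    and 0: "\<And>v. v \<in> carrier (free R n) \<Longrightarrow> e s \<star>\<^bsub>M\<^esub> f v = \<zero>\<^bsub>M\<^esub>"
  shows "\<exists>u\<in>T. \<exists>x\<in>functionals R n. \<forall>v\<in>carrier (free R n). f v \<otimes> u = x v \<otimes> s \<otimes> u"
proof -
  note fD = functionalD[OF f]
  have sR: "s \<in> carrier R" using s by simp
  have "\<exists>u\<in>T. \<forall>i\<in>{..<n}. \<exists>c\<in>carrier R. f (basis R n i) \<otimes> u = c \<otimes> s \<otimes> u"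
  proof (rule common_multiple)
    fix i show "\<exists>u\<in>T. \<exists>c\<in>carrier R. f (basis R n i) \<otimes> u = c \<otimes> s \<otimes> u"
      using 0[OF basis_closed] e_zero[OF s fD(1)[OF basis_closed]] by blast
  next
    fix i u t assume ut: "u \<in> T" "t \<in> T" and "\<exists>c\<in>carrier R. f (basis R n i) \<otimes> u = c \<otimes> s \<otimes> u"
    then obtain c where c: "c \<in> carrier R" "f (basis R n i) \<otimes> u = c \<otimes> s \<otimes> u" by blast
    have "f (basis R n i) \<otimes> (u \<otimes> t) = c \<otimes> s \<otimes> (u \<otimes> t)"
      using c ut sR fD(1)[OF basis_closed] by (simp flip: m_assoc)
    then show "\<exists>c\<in>carrier R. f (basis R n i) \<otimes> (u \<otimes> t) = c \<otimes> s \<otimes> (u \<otimes> t)" using c(1) by blast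
  qed simp
  then obtain u where u: "u \<in> T"
    and b: "\<And>i. i < n \<Longrightarrow> \<exists>c\<in>carrier R. f (basis R n i) \<otimes> u = c \<otimes> s \<otimes> u" by auto
  have uR: "u \<in> carrier R" using u by simp
  have swap: "a \<otimes> b \<otimes> t = a \<otimes> t \<otimes> b" if "a \<in> carrier R" "b \<in> carrier R" "t \<in> T" for a b t
    using that T_comm[of t b] m_assoc[of a b t] m_assoc[of a t b] by simp
  have "\<exists>c\<in>carrier R. f v \<otimes> u = c \<otimes> s \<otimes> u" if v: "v \<in> carrier (free R n)" for v
  proof (rule free_span[of v n "\<lambda>v. \<exists>c\<in>carrier R. f v \<otimes> u = c \<otimes> s \<otimes> u", OF v _ _ _ b])
    show "\<exists>c\<in>carrier R. f \<zero>\<^bsub>free R n\<^esub> \<otimes> u = c \<otimes> s \<otimes> u"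
      unfolding fD(4) using sR uR by (intro bexI[of _ \<zero>]) simp_all
  next
    fix v w assume vw: "v \<in> carrier (free R n)" "w \<in> carrier (free R n)"
      and "\<exists>c\<in>carrier R. f v \<otimes> u = c \<otimes> s \<otimes> u" "\<exists>c\<in>carrier R. f w \<otimes> u = c \<otimes> s \<otimes> u"
    then obtain c d where cd: "c \<in> carrier R" "d \<in> carrier R" "f v \<otimes> u = c \<otimes> s \<otimes> u" "f w \<otimes> u = d \<otimes> s \<otimes> u" by blast
    then show "\<exists>c\<in>carrier R. f (v \<oplus>\<^bsub>free R n\<^esub> w) \<otimes> u = c \<otimes> s \<otimes> u"
      unfolding fD(2)[OF vw] using fD(1)[OF vw(1)] fD(1)[OF vw(2)] sR uR
      by (intro bexI[of _ "c \<oplus> d"]) (simp_all add: l_distr)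
  next
    fix v a assume v: "v \<in> carrier (free R n)" and a: "a \<in> carrier R"
      and "\<exists>c\<in>carrier R. f v \<otimes> u = c \<otimes> s \<otimes> u"
    then obtain c where c: "c \<in> carrier R" "f v \<otimes> u = c \<otimes> s \<otimes> u" by blast
    have "f v \<otimes> a \<otimes> u = c \<otimes> s \<otimes> u \<otimes> a" using swap[of "f v" a u] fD(1)[OF v] a u c(2) by simp
    also have "\<dots> = c \<otimes> a \<otimes> s \<otimes> u"
      using swap[of "c \<otimes> s" a u] swap[of c a s] a c(1) sR u s by simp
    finally show "\<exists>c\<in>carrier R. f (v \<star>\<^bsub>free R n\<^esub> a) \<otimes> u = c \<otimes> s \<otimes> u"
      unfolding fD(3)[OF v a] using c(1) a by (intro bexI[of _ "c \<otimes> a"]) simp_all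
  qed simp
  moreover have "(\<lambda>v. f v \<otimes> u) \<in> functionals R n"
    using rmod_hom_comp[OF f central_act_hom[OF reg_module u]] by simp
  moreover have "(\<lambda>c. c \<otimes> s \<otimes> u) \<in> rmod_hom R (reg R) (reg R)"
    using rmod_hom_comp[OF central_act_hom[OF reg_module s] central_act_hom[OF reg_module u]] by simp
  ultimately obtain g where "g \<in> functionals R n" "\<forall>v\<in>carrier (free R n). g v \<otimes> s \<otimes> u = f v \<otimes> u"
    using free_lift[OF reg_module reg_module, of "\<lambda>c. c \<otimes> s \<otimes> u" "\<lambda>v. f v \<otimes> u" n] by (auto simp: image_iff)
  then show ?thesis using u by (intro bexI[of _ u] bexI[of _ g]) auto
qed

text \<open>The torsion of the cokernel of precomposition with \<open>\<rho>\<close> is killed by a single element of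
  \<open>T\<close>: the functionals that lie in the image after multiplication by some element of \<open>T\<close> form a finitely
  generated left module, and a common multiple of the factors needed for the generators serves all
  of them. This replaces the Artin-Rees lemma.\<close>

lemma uniform_denominator:
  assumes noeth: "left_noetherian R" and \<rho>: "\<rho> \<in> rmod_hom R (free R n) (free R n')"
  shows "\<exists>\<sigma>\<in>T. \<forall>x\<in>functionals R n.
    (\<exists>t\<in>T. \<exists>y\<in>functionals R n'. \<forall>v\<in>carrier (free R n). t \<otimes> x v = y (\<rho> v)) \<longrightarrow>
    (\<exists>y\<in>functionals R n'. \<forall>v\<in>carrier (free R n). \<sigma> \<otimes> x v = y (\<rho> v))"
proof -
  define L where "L t = {x \<in> functionals R n. \<exists>y\<in>functionals R n'. \<forall>v\<in>carrier (free R n). t \<otimes> x v = y (\<rho> v)}" for t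
  have L: "functional_submodule R n (L t)" if t: "t \<in> T" for t
  proof (rule functional_submoduleI)
    have tR: "t \<in> carrier R" using t by simp
    show "(\<lambda>v. \<zero>) \<in> L t"
      using functional_zero[of n] functional_zero[of n'] tR unfolding L_def
      by (auto intro!: bexI[of _ "\<lambda>v. \<zero>"])
    fix x assume "x \<in> L t"
    then obtain y where x: "x \<in> functionals R n" and y: "y \<in> functionals R n'"
      and xy: "\<And>v. v \<in> carrier (free R n) \<Longrightarrow> t \<otimes> x v = y (\<rho> v)" unfolding L_def by blast
    note xD = functionalD(1)[OF x]
    show "x \<in> functionals R n" by (rule x)
    show "(\<lambda>v. a \<otimes> x v) \<in> L t" if a: "a \<in> carrier R" for a
    proof -
      have "t \<otimes> (a \<otimes> x v) = a \<otimes> y (\<rho> v)" if v: "v \<in> carrier (free R n)" for v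
        using xy[OF v, symmetric] m_assoc[OF tR a xD[OF v]] m_assoc[OF a tR xD[OF v]] T_comm[OF t a] by simp
      then show ?thesis
        unfolding L_def using functional_scale[OF x a] functional_scale[OF y a]
        by (auto intro!: bexI[of _ "\<lambda>v. a \<otimes> y v"])
    qed
    show "l \<in> L t" if "l \<in> functionals R n" "\<And>v. v \<in> carrier (free R n) \<Longrightarrow> l v = x v" for l
      unfolding L_def using that xy y by auto
    fix x' assume "x' \<in> L t"
    then obtain y' where x': "x' \<in> functionals R n" and y': "y' \<in> functionals R n'"
      and xy': "\<And>v. v \<in> carrier (free R n) \<Longrightarrow> t \<otimes> x' v = y' (\<rho> v)" unfolding L_def by blast
    have "t \<otimes> (x v \<oplus> x' v) = y (\<rho> v) \<oplus> y' (\<rho> v)" if v: "v \<in> carrier (free R n)" for v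
      using xy[OF v] xy'[OF v] r_distr[OF xD[OF v] functionalD(1)[OF x' v] tR] by simp
    then show "(\<lambda>v. x v \<oplus> x' v) \<in> L t"
      unfolding L_def using functional_add[OF x x'] functional_add[OF y y']
      by (auto intro!: bexI[of _ "\<lambda>v. y v \<oplus> y' v"])
  qed
  have mono: "x \<in> L (s \<otimes> t)" if st: "s \<in> T" "t \<in> T" and x: "x \<in> L s" for x s t
  proof -
    obtain y where xF: "x \<in> functionals R n" and y: "y \<in> functionals R n'"
      and xy: "\<And>v. v \<in> carrier (free R n) \<Longrightarrow> s \<otimes> x v = y (\<rho> v)" using x unfolding L_def by blast
    have "s \<otimes> t \<otimes> x v = t \<otimes> y (\<rho> v)" if v: "v \<in> carrier (free R n)" for v
      using xy[OF v, symmetric] T_comm[of t s] st m_assoc[of t s "x v"] functionalD(1)[OF xF v] by simp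
    then show ?thesis
      unfolding L_def using xF functional_scale[OF y] st by (auto intro!: bexI[of _ "\<lambda>v. t \<otimes> y v"])
  qed
  define L' where "L' = (\<Union>t\<in>T. L t)"
  have "functional_submodule R n L'"
  proof (rule functional_submoduleI)
    show "(\<lambda>v. \<zero>) \<in> L'" using functional_submoduleD(2)[OF L[OF one_T]] unfolding L'_def by (rule UN_I[OF one_T])
    fix x assume "x \<in> L'"
    then obtain t where t: "t \<in> T" "x \<in> L t" by (auto simp: L'_def)
    show "x \<in> functionals R n" by (rule functional_submoduleD(1)[OF L[OF t(1)] t(2)])
    show "(\<lambda>v. a \<otimes> x v) \<in> L'" if "a \<in> carrier R" for a
      unfolding L'_def by (rule UN_I[OF t(1)], rule functional_submoduleD(4)[OF L[OF t(1)] that t(2)])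
    show "l \<in> L'" if "l \<in> functionals R n" "\<And>v. v \<in> carrier (free R n) \<Longrightarrow> l v = x v" for l
      unfolding L'_def by (rule UN_I[OF t(1)], rule functional_submoduleD(5)[OF L[OF t(1)] t(2) that])
    fix x' assume "x' \<in> L'"
    then obtain t' where t': "t' \<in> T" "x' \<in> L t'" by (auto simp: L'_def)
    have "x' \<in> L (t \<otimes> t')" using mono[OF t'(1) t(1) t'(2)] T_comm[OF t(1), of t'] t'(1) by simp
    then show "(\<lambda>v. x v \<oplus> x' v) \<in> L'"
      unfolding L'_def using functional_submoduleD(3)[OF L mono[OF t(1) t'(1) t(2)]] t(1) t'(1) T_mult by blast
  qed
  then obtain A where A: "A \<subseteq> L'" "finite A"
    and gen: "\<And>J. functional_submodule R n J \<Longrightarrow> A \<subseteq> J \<Longrightarrow> L' \<subseteq> J"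
    using functional_submodule_fg[OF noeth] by metis
  have "\<exists>\<sigma>\<in>T. \<forall>x\<in>A. x \<in> L \<sigma>"
    by (rule common_multiple[OF A(2)]) (use A(1) mono in \<open>auto simp: L'_def\<close>)
  then obtain \<sigma> where \<sigma>: "\<sigma> \<in> T" "A \<subseteq> L \<sigma>" by blast
  have "L' \<subseteq> L \<sigma>" by (rule gen[OF L[OF \<sigma>(1)] \<sigma>(2)])
  then show ?thesis using \<sigma>(1) unfolding L'_def L_def by (intro bexI[of _ \<sigma>]) auto
qed

lemma relation_submodule:
  assumes \<rho>: "\<rho> \<in> rmod_hom R (free R n) (free R n')"
  shows "functional_submodule R n' {k \<in> functionals R n'. \<exists>t\<in>T. \<forall>v\<in>carrier (free R n). k (\<rho> v) \<otimes> t = \<zero>}"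
    (is "functional_submodule R n' ?K")
proof (rule functional_submoduleI)
  note \<rho>c = rmod_homD(1)[OF \<rho>]
  show "(\<lambda>v. \<zero>) \<in> ?K" by (intro CollectI conjI functional_zero bexI[of _ \<one>]) auto
  fix k assume "k \<in> ?K"
  then obtain t where k: "k \<in> functionals R n'" and t: "t \<in> T"
    and kt: "\<And>v. v \<in> carrier (free R n) \<Longrightarrow> k (\<rho> v) \<otimes> t = \<zero>" by blast
  note kD = functionalD(1)[OF k \<rho>c]
  show "k \<in> functionals R n'" by (rule k)
  show "(\<lambda>v. a \<otimes> k v) \<in> ?K" if a: "a \<in> carrier R" for a
    using functional_scale[OF k a] kt t a kD by (auto intro!: bexI[of _ t] simp: m_assoc)
  show "l \<in> ?K" if "l \<in> functionals R n'" "\<And>v. v \<in> carrier (free R n') \<Longrightarrow> l v = k v" for l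
    using that kt t \<rho>c by (auto intro!: bexI[of _ t])
  fix l assume "l \<in> ?K"
  then obtain u where l: "l \<in> functionals R n'" and u: "u \<in> T"
    and lu: "\<And>v. v \<in> carrier (free R n) \<Longrightarrow> l (\<rho> v) \<otimes> u = \<zero>" by blast
  note lD = functionalD(1)[OF l \<rho>c]
  have "(k (\<rho> v) \<oplus> l (\<rho> v)) \<otimes> (t \<otimes> u) = \<zero>" if v: "v \<in> carrier (free R n)" for v
  proof -
    have "k (\<rho> v) \<otimes> (t \<otimes> u) = \<zero>"
      using m_assoc[of "k (\<rho> v)" t u] kD[OF v] kt[OF v] t u by simp
    moreover have "l (\<rho> v) \<otimes> (t \<otimes> u) = \<zero>"
      using m_assoc[of "l (\<rho> v)" u t] lD[OF v] lu[OF v] t u T_comm[of t u] by simp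
    ultimately show ?thesis using kD[OF v] lD[OF v] t u by (simp add: l_distr)
  qed
  then show "(\<lambda>v. k v \<oplus> l v) \<in> ?K"
    using functional_add[OF k l] T_mult[OF t u] by blast
qed

text \<open>The homomorphisms \<open>M\<^sup>n \<rightarrow> M\<^sup>n\<^sup>'\<close> given by left multiplication with matrices over \<open>R\<close>. The matrix
  is represented by the linear map \<open>b\<close> between free modules, which acts on numerators.\<close>

definition linear_lift where
  "linear_lift n n' \<beta> b \<longleftrightarrow> b \<in> rmod_hom R (free R n) (free R n') \<and>
    (\<forall>s\<in>T. \<forall>v\<in>carrier (free R n). \<beta> (qn n s v) = qn n' s (b v))"

definition linear_maps :: "nat \<Rightarrow> nat \<Rightarrow> ((nat \<Rightarrow> 'm) \<Rightarrow> nat \<Rightarrow> 'm) set" where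
  "linear_maps n n' = {\<beta> \<in> rmod_hom R (Mn n) (Mn n') \<inter> extensional (carrier (Mn n)). \<exists>b. linear_lift n n' \<beta> b}"

lemma linear_mapsD:
  assumes "\<beta> \<in> linear_maps n n'"
  shows "\<beta> \<in> rmod_hom R (Mn n) (Mn n')" "\<beta> \<in> extensional (carrier (Mn n))"
  using assms by (auto simp: linear_maps_def)

text \<open>One step of the factorization of \<open>h\<close>. The map \<open>\<Gamma>\<close> has as coordinates finitely many
  generators of the module \<open>K\<close> of functionals on \<open>R\<^sup>n\<^sup>'\<close> that respect the relation
  \<open>\<beta>\<^sub>1 = \<beta>\<^sub>2\<close> up to torsion; it does not depend on \<open>h\<close> or \<open>s\<close>. On the fractions with
  denominator \<open>t\<close>, \<open>h\<close> is given by functionals, one for each \<open>x \<in> X\<close>, which respect the relation modulo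
  \<open>t\<close>. For \<open>t = s \<otimes> \<sigma>\<close>, with \<open>\<sigma>\<close> from \<open>uniform_denominator\<close>, this implies that modulo \<open>s\<close>
  they lie in \<open>K\<close>. So \<open>h\<close> factors through \<open>\<Gamma>\<close> on the fractions with denominator \<open>s\<close>, the
  remaining part is divisible by \<open>s\<close>, and the quotient inherits the relation because
  multiplication by \<open>s\<close> is surjective on \<open>M\<^sup>n\<close>.\<close>

lemma approximate_factorization:
  assumes noeth: "left_noetherian R"
    and \<beta>: "\<beta>\<^sub>1 \<in> rmod_hom R (Mn n) (Mn n')" "\<beta>\<^sub>2 \<in> rmod_hom R (Mn n) (Mn n')"
    and lift: "linear_lift n n' \<beta>\<^sub>1 b\<^sub>1" "linear_lift n n' \<beta>\<^sub>2 b\<^sub>2"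
  shows "\<exists>p. \<exists>\<Gamma>\<in>rmod_hom R (Mn n') (Mn p). (\<exists>g. linear_lift n' p \<Gamma> g) \<and>
    (\<forall>x\<in>carrier (Mn n). \<Gamma> (\<beta>\<^sub>1 x) = \<Gamma> (\<beta>\<^sub>2 x)) \<and>
    (\<forall>h\<in>rmod_hom R (Mn n') (Ms (X :: 'x set)). (\<forall>x\<in>carrier (Mn n). h (\<beta>\<^sub>1 x) = h (\<beta>\<^sub>2 x)) \<longrightarrow>
      (\<forall>s\<in>T. \<exists>C\<in>rmod_hom R (Mn p) (Ms X). \<exists>h'\<in>rmod_hom R (Mn n') (Ms X).
        (\<forall>x\<in>carrier (Mn n'). h x = C (\<Gamma> x) \<oplus>\<^bsub>Ms X\<^esub> h' (x \<star>\<^bsub>Mn n'\<^esub> s)) \<and>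
        (\<forall>x\<in>carrier (Mn n). h' (\<beta>\<^sub>1 x) = h' (\<beta>\<^sub>2 x))))"
proof -
  have b: "b\<^sub>1 \<in> rmod_hom R (free R n) (free R n')" "b\<^sub>2 \<in> rmod_hom R (free R n) (free R n')"
    and \<beta>q: "\<And>s v. \<lbrakk>s \<in> T; v \<in> carrier (free R n)\<rbrakk> \<Longrightarrow> \<beta>\<^sub>1 (qn n s v) = qn n' s (b\<^sub>1 v)"
      "\<And>s v. \<lbrakk>s \<in> T; v \<in> carrier (free R n)\<rbrakk> \<Longrightarrow> \<beta>\<^sub>2 (qn n s v) = qn n' s (b\<^sub>2 v)"
    using lift by (auto simp: linear_lift_def)
  note bc = rmod_homD(1)[OF b(1)] rmod_homD(1)[OF b(2)]
  define \<rho> where "\<rho> v = b\<^sub>1 v \<ominus>\<^bsub>free R n'\<^esub> b\<^sub>2 v" for v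
  have \<rho>: "\<rho> \<in> rmod_hom R (free R n) (free R n')"
    unfolding \<rho>_def by (rule rmod_hom_sub[OF free_module b])
  note \<rho>c = rmod_homD(1)[OF \<rho>]
  have hom_\<rho>: "f (\<rho> v) = f (b\<^sub>1 v) \<ominus>\<^bsub>A\<^esub> f (b\<^sub>2 v)"
    if "right_module R A" "f \<in> rmod_hom R (free R n') A" "v \<in> carrier (free R n)"
    for A :: "('r, 'z) rmodule" and f v
    unfolding \<rho>_def by (rule rmod_hom_diff[OF that(2) free_module that(1) bc(1)[OF that(3)] bc(2)[OF that(3)]])
  define K where "K = {k \<in> functionals R n'. \<exists>t\<in>T. \<forall>v\<in>carrier (free R n). k (\<rho> v) \<otimes> t = \<zero>}"
  have K: "functional_submodule R n' K" unfolding K_def by (rule relation_submodule[OF \<rho>])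
  obtain p \<gamma> where \<gamma>: "\<gamma> \<in> rmod_hom R (free R n') (free R p)"
    and into: "\<And>c. c \<in> functionals R p \<Longrightarrow> (\<lambda>v. c (\<gamma> v)) \<in> K"
    and onto: "\<And>k. k \<in> K \<Longrightarrow> \<exists>c\<in>functionals R p. \<forall>v\<in>carrier (free R n'). k v = c (\<gamma> v)"
    using functional_submodule_cover[OF noeth K] by metis
  obtain \<Gamma> where \<Gamma>: "\<Gamma> \<in> rmod_hom R (Mn n') (Mn p)"
    and \<Gamma>q: "\<And>s v. \<lbrakk>s \<in> T; v \<in> carrier (free R n')\<rbrakk> \<Longrightarrow> \<Gamma> (qn n' s v) = qn p s (\<gamma> v)"
    using extend_hom[OF \<gamma>] by blast
  obtain \<sigma> where \<sigma>: "\<sigma> \<in> T" and sat: "\<And>x. \<lbrakk>x \<in> functionals R n;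
    \<exists>t\<in>T. \<exists>y\<in>functionals R n'. \<forall>v\<in>carrier (free R n). t \<otimes> x v = y (\<rho> v)\<rbrakk> \<Longrightarrow>
    \<exists>y\<in>functionals R n'. \<forall>v\<in>carrier (free R n). \<sigma> \<otimes> x v = y (\<rho> v)"
    using uniform_denominator[OF noeth \<rho>] by metis
  have \<Gamma>\<beta>: "\<Gamma> (\<beta>\<^sub>1 x) = \<Gamma> (\<beta>\<^sub>2 x)" if x: "x \<in> carrier (Mn n)" for x
  proof (rule Ms_hom_eqI[OF _ x])
    fix s v assume s: "s \<in> T" and v: "v \<in> carrier (free R n)"
    have "qn p s (\<gamma> (\<rho> v)) = \<zero>\<^bsub>Mn p\<^esub>"
    proof (rule direct_sum_copies_eqI[OF q_closed[OF s rmod_homD(1)[OF \<gamma> \<rho>c[OF v]]] Ms.M.zero_closed])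
      fix j assume j: "j \<in> {..<p}"
      have "(\<lambda>v. \<gamma> v j) \<in> K" by (rule into) (rule direct_sum_copies_proj[OF j])
      then obtain t where "t \<in> T" "\<gamma> (\<rho> v) j \<otimes> t = \<zero>" using v by (auto simp: K_def)
      then have "e s \<star>\<^bsub>M\<^esub> \<gamma> (\<rho> v) j = \<zero>\<^bsub>M\<^esub>"
        unfolding e_zero[OF s Rs_coord[OF rmod_homD(1)[OF \<gamma> \<rho>c[OF v]] j]] using s
        by (intro bexI[of _ t] bexI[of _ \<zero>]) simp_all
      then show "qn p s (\<gamma> (\<rho> v)) j = \<zero>\<^bsub>Mn p\<^esub> j" using j by (simp add: q_def)
    qed
    then have "qn p s (\<gamma> (b\<^sub>1 v)) \<ominus>\<^bsub>Mn p\<^esub> qn p s (\<gamma> (b\<^sub>2 v)) = \<zero>\<^bsub>Mn p\<^esub>"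
      using hom_\<rho>[OF Ms.right_module_axioms rmod_hom_comp[OF \<gamma> q_hom[OF s]] v] by simp
    then have "qn p s (\<gamma> (b\<^sub>1 v)) = qn p s (\<gamma> (b\<^sub>2 v))"
      using Ms.diff_eq_zero_iff q_closed[OF s] rmod_homD(1)[OF \<gamma>] bc v by metis
    then show "\<Gamma> (\<beta>\<^sub>1 (qn n s v)) = \<Gamma> (\<beta>\<^sub>2 (qn n s v))"
      using \<beta>q[OF s v] \<Gamma>q[OF s] bc v by simp
  qed
  have step: "\<exists>C\<in>rmod_hom R (Mn p) (Ms X). \<exists>h'\<in>rmod_hom R (Mn n') (Ms X).
        (\<forall>x\<in>carrier (Mn n'). h x = C (\<Gamma> x) \<oplus>\<^bsub>Ms X\<^esub> h' (x \<star>\<^bsub>Mn n'\<^esub> s)) \<and>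
        (\<forall>x\<in>carrier (Mn n). h' (\<beta>\<^sub>1 x) = h' (\<beta>\<^sub>2 x))"
    if h: "h \<in> rmod_hom R (Mn n') (Ms X)" and rel: "\<forall>x\<in>carrier (Mn n). h (\<beta>\<^sub>1 x) = h (\<beta>\<^sub>2 x)"
      and s: "s \<in> T" for h :: "(nat \<Rightarrow> 'm) \<Rightarrow> 'x \<Rightarrow> 'm" and s
  proof -
    define t where "t = s \<otimes> \<sigma>"
    have t: "t \<in> T" and tR: "t \<in> carrier R" and sR: "s \<in> carrier R" and \<sigma>R: "\<sigma> \<in> carrier R"
      using s \<sigma> by (auto simp: t_def)
    have "\<exists>r\<in>rmod_hom R (free R n') (Rs X). \<forall>v\<in>carrier (free R n'). q X t (r v) = h (qn n' t v)"
    proof (rule free_lift[OF Rs.right_module_axioms Ms.right_module_axioms q_hom[OF t] rmod_hom_comp[OF q_hom[OF t] h]])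
      fix v assume v: "v \<in> carrier (free R n')"
      note qv = q_closed[OF t v]
      have "h (qn n' t v) \<star>\<^bsub>Ms X\<^esub> t = h (qn n' t (v \<star>\<^bsub>free R n'\<^esub> t))"
        using rmod_homD(3)[OF h qv tR] rmod_homD(3)[OF q_hom[OF t] v tR] by simp
      also have "\<dots> = \<zero>\<^bsub>Ms X\<^esub>"
        unfolding q_ract_self[OF t v] by (rule rmod_hom_zero[OF h Ms.right_module_axioms Ms.right_module_axioms])
      finally show "h (qn n' t v) \<in> q X t ` carrier (Rs X)" by (rule q_level[OF t rmod_homD(1)[OF h qv]])
    qed
    then obtain r where r: "r \<in> rmod_hom R (free R n') (Rs X)"
      and rq: "\<And>v. v \<in> carrier (free R n') \<Longrightarrow> q X t (r v) = h (qn n' t v)" by blast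
    have rq': "q X s (r v) = h (qn n' s v)" if v: "v \<in> carrier (free R n')" for v
      using rq[OF free.ract_closed[OF v \<sigma>R]] rmod_homD(3)[OF r v \<sigma>R] q_scale[OF s \<sigma> v]
        q_scale[OF s \<sigma> rmod_homD(1)[OF r v]] by (simp only: t_def)
    have r\<rho>: "q X t (r (\<rho> v)) = \<zero>\<^bsub>Ms X\<^esub>" if v: "v \<in> carrier (free R n)" for v
    proof -
      have "h (qn n' t (b\<^sub>1 v)) = h (qn n' t (b\<^sub>2 v))"
        using bspec[OF rel q_closed[OF t v]] unfolding \<beta>q[OF t v] .
      then show ?thesis
        using hom_\<rho>[OF Ms.right_module_axioms rmod_hom_comp[OF r q_hom[OF t]] v] rq bc[OF v]
          Ms.diff_eq_zero_iff[OF rmod_homD(1)[OF h q_closed[OF t bc(2)[OF v]]] rmod_homD(1)[OF h q_closed[OF t bc(2)[OF v]]]]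
        by (simp del: direct_sum_copies_simps)
    qed
    \<comment> \<open>For all but finitely many \<open>x\<close> the functional \<open>\<lambda>v. r v x\<close> is zero, and choosing \<open>c = 0\<close> for
      these makes the family of all \<open>c\<close> a map into the direct sum.\<close>
    have ex: "\<exists>c\<in>functionals R p. (\<forall>v\<in>carrier (free R n'). e s \<star>\<^bsub>M\<^esub> r v x = e s \<star>\<^bsub>M\<^esub> c (\<gamma> v)) \<and>
        ((\<forall>v\<in>carrier (free R n'). r v x = \<zero>) \<longrightarrow> c = (\<lambda>w. \<zero>))" if x: "x \<in> X" for x
    proof (cases "\<forall>v\<in>carrier (free R n'). r v x = \<zero>")
      case True
      then show ?thesis using functional_zero[of p] by (intro bexI[of _ "\<lambda>w. \<zero>"]) auto
    next
      case False
      have rx: "(\<lambda>v. r v x) \<in> functionals R n'"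
        by (rule rmod_hom_comp[OF r direct_sum_copies_proj[OF x]])
      note rxc = functionalD(1)[OF rx]
      have "e t \<star>\<^bsub>M\<^esub> r (\<rho> v) x = \<zero>\<^bsub>M\<^esub>" if v: "v \<in> carrier (free R n)" for v
        using fun_cong[OF r\<rho>[OF v], of x] x by (simp add: q_def)
      then obtain u z where u: "u \<in> T" and z: "z \<in> functionals R n"
        and uz: "\<And>v. v \<in> carrier (free R n) \<Longrightarrow> r (\<rho> v) x \<otimes> u = z v \<otimes> t \<otimes> u"
        using functional_lift[OF rmod_hom_comp[OF \<rho> rx] t] by blast
      have uR: "u \<in> carrier R" using u by simp
      have zc: "z v \<in> carrier R" if "v \<in> carrier (free R n)" for v by (rule functionalD(1)[OF z that])
      have "t \<otimes> u \<otimes> z v = u \<otimes> r (\<rho> v) x" if v: "v \<in> carrier (free R n)" for v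
        using uz[OF v] T_comm[OF T_mult[OF t u] zc[OF v]] T_comm[OF u rxc[OF \<rho>c[OF v]]] zc[OF v] tR uR
        by (simp add: m_assoc)
      then have "\<exists>t'\<in>T. \<exists>y\<in>functionals R n'. \<forall>v\<in>carrier (free R n). t' \<otimes> z v = y (\<rho> v)"
        using functional_scale[OF rx uR] T_mult[OF t u] by (intro bexI[of _ "t \<otimes> u"] bexI[of _ "\<lambda>v. u \<otimes> r v x"]) auto
      then obtain y where y: "y \<in> functionals R n'" and yz: "\<And>v. v \<in> carrier (free R n) \<Longrightarrow> \<sigma> \<otimes> z v = y (\<rho> v)"
        using sat[OF z] by blast
      note yc = functionalD(1)[OF y]
      \<comment> \<open>Up to the factor \<open>u\<close>, the relation gives \<open>r (\<rho> v) x = z v \<otimes> t = s \<otimes> (\<sigma> \<otimes> z v)\<close>, and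
        \<open>\<sigma> \<otimes> z v = y (\<rho> v)\<close>.\<close>
      define k where "k v = r v x \<oplus> (\<ominus> s) \<otimes> y v" for v
      have kF: "k \<in> functionals R n'" unfolding k_def by (rule functional_add[OF rx functional_scale[OF y]]) (simp add: sR)
      have "k (\<rho> v) \<otimes> u = \<zero>" if v: "v \<in> carrier (free R n)" for v
      proof -
        have "s \<otimes> y (\<rho> v) = z v \<otimes> t"
          using yz[OF v, symmetric] T_comm[OF t zc[OF v]] zc[OF v] sR \<sigma>R by (simp add: t_def m_assoc)
        then have "s \<otimes> y (\<rho> v) \<otimes> u = r (\<rho> v) x \<otimes> u" using uz[OF v] by simp
        then show ?thesis
          using rxc[OF \<rho>c[OF v]] yc[OF \<rho>c[OF v]] sR uR by (simp add: k_def l_distr l_minus R.r_neg)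
      qed
      then have "k \<in> K" using kF u by (auto simp: K_def)
      then obtain c where c: "c \<in> functionals R p" and kc: "\<And>v. v \<in> carrier (free R n') \<Longrightarrow> k v = c (\<gamma> v)"
        using onto by blast
      have "e s \<star>\<^bsub>M\<^esub> r v x = e s \<star>\<^bsub>M\<^esub> c (\<gamma> v)" if v: "v \<in> carrier (free R n')" for v
      proof -
        have "r v x = k v \<oplus> y v \<otimes> s"
          using rxc[OF v] yc[OF v] sR T_comm[OF s yc[OF v]] by (simp add: k_def l_minus R.a_assoc R.l_neg)
        then have "e s \<star>\<^bsub>M\<^esub> r v x = e s \<star>\<^bsub>M\<^esub> k v \<oplus>\<^bsub>M\<^esub> e s \<star>\<^bsub>M\<^esub> (y v \<otimes> s)"
          using e_closed[OF s] functionalD(1)[OF kF v] yc[OF v] sR by (simp add: ract_r_distr)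
        then show ?thesis using e_ract_self[OF s yc[OF v]] kc[OF v] e_closed[OF s] functionalD(1)[OF kF v] by simp
      qed
      then show ?thesis using c False by blast
    qed
    have "\<forall>x\<in>X. \<exists>c. c \<in> functionals R p \<and>
        (\<forall>v\<in>carrier (free R n'). e s \<star>\<^bsub>M\<^esub> r v x = e s \<star>\<^bsub>M\<^esub> c (\<gamma> v)) \<and>
        ((\<forall>v\<in>carrier (free R n'). r v x = \<zero>) \<longrightarrow> c = (\<lambda>w. \<zero>))"
      by (rule ballI) (use ex in \<open>simp only: Bex_def\<close>)
    from bchoice[OF this] obtain c where cc: "\<forall>x\<in>X. c x \<in> functionals R p \<and>
        (\<forall>v\<in>carrier (free R n'). e s \<star>\<^bsub>M\<^esub> r v x = e s \<star>\<^bsub>M\<^esub> c x (\<gamma> v)) \<and>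
        ((\<forall>v\<in>carrier (free R n'). r v x = \<zero>) \<longrightarrow> c x = (\<lambda>w. \<zero>))" ..
    have c: "c x \<in> functionals R p" if "x \<in> X" for x using cc that by blast
    have cr: "e s \<star>\<^bsub>M\<^esub> r v x = e s \<star>\<^bsub>M\<^esub> c x (\<gamma> v)" if "x \<in> X" "v \<in> carrier (free R n')" for x v
      using cc that by blast
    have c0: "c x = (\<lambda>w. \<zero>)" if "x \<in> X" "\<forall>v\<in>carrier (free R n'). r v x = \<zero>" for x
      using cc that by blast
    have "(\<lambda>w. \<lambda>x\<in>X. c x w) \<in> rmod_hom R (free R p) (Rs X)"
    proof (rule direct_sum_copies_hom_into[OF c])
      fix w show "finite {x \<in> X. c x w \<noteq> \<zero>\<^bsub>reg R\<^esub>}"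
        by (rule finite_subset[OF _ hom_from_free_finite_support[OF r]]) (use c0 in fastforce)
    qed
    from extend_hom[OF this] obtain C where C: "C \<in> rmod_hom R (Mn p) (Ms X)"
      and Cq: "\<And>s w. \<lbrakk>s \<in> T; w \<in> carrier (free R p)\<rbrakk> \<Longrightarrow> C (qn p s w) = q X s (\<lambda>x\<in>X. c x w)" by blast
    have C\<Gamma>: "(\<lambda>x. C (\<Gamma> x)) \<in> rmod_hom R (Mn n') (Ms X)" by (rule rmod_hom_comp[OF \<Gamma> C])
    have hd: "(\<lambda>x. h x \<ominus>\<^bsub>Ms X\<^esub> C (\<Gamma> x)) \<in> rmod_hom R (Mn n') (Ms X)"
      by (rule rmod_hom_sub[OF Ms.right_module_axioms h C\<Gamma>])
    have "h (qn n' s v) \<ominus>\<^bsub>Ms X\<^esub> C (\<Gamma> (qn n' s v)) = \<zero>\<^bsub>Ms X\<^esub>" if v: "v \<in> carrier (free R n')" for v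
    proof -
      have "h (qn n' s v) = C (\<Gamma> (qn n' s v))"
        using rq'[OF v, symmetric] \<Gamma>q[OF s v] Cq[OF s rmod_homD(1)[OF \<gamma> v]] cr[OF _ v]
        by (auto simp: q_def intro!: restrict_ext)
      then show ?thesis
        using Ms.diff_eq_zero_iff rmod_homD(1)[OF h q_closed[OF s v]] by metis
    qed
    then obtain h' where h': "h' \<in> rmod_hom R (Mn n') (Ms X)"
      and eq: "\<And>x. x \<in> carrier (Mn n') \<Longrightarrow> h x \<ominus>\<^bsub>Ms X\<^esub> C (\<Gamma> x) = h' (x \<star>\<^bsub>Mn n'\<^esub> s)"
      using divide_hom[OF Ms.right_module_axioms s hd] by blast
    have "h x = C (\<Gamma> x) \<oplus>\<^bsub>Ms X\<^esub> h' (x \<star>\<^bsub>Mn n'\<^esub> s)" if x: "x \<in> carrier (Mn n')" for x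
      unfolding eq[OF x, symmetric] a_minus_def
      using rmod_homD(1)[OF h x] rmod_homD(1)[OF C\<Gamma> x] by (simp del: direct_sum_copies_simps)
    moreover have "h' (\<beta>\<^sub>1 x) = h' (\<beta>\<^sub>2 x)" if x: "x \<in> carrier (Mn n)" for x
    proof -
      obtain x' where x': "x' \<in> carrier (Mn n)" "x' \<star>\<^bsub>Mn n\<^esub> s = x" using Ms_divisible[OF s x] by blast
      have "h' (\<beta> x) = h (\<beta> x') \<ominus>\<^bsub>Ms X\<^esub> C (\<Gamma> (\<beta> x'))" if "\<beta> \<in> rmod_hom R (Mn n) (Mn n')" for \<beta>
        using eq[OF rmod_homD(1)[OF that x'(1)]] rmod_homD(3)[OF that x'(1) sR] x'(2) by simp
      then show ?thesis using \<beta> rel x'(1) \<Gamma>\<beta>[OF x'(1)] by simp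
    qed
    ultimately show ?thesis using C h' by blast
  qed
  have "linear_lift n' p \<Gamma> \<gamma>" using \<gamma> \<Gamma>q by (auto simp: linear_lift_def)
  then show ?thesis using \<Gamma> \<Gamma>\<beta> step by blast
qed

section \<open>Exact factorization of homomorphisms\<close>

lemma linear_maps_id: "(\<lambda>x\<in>carrier (Mn n). x) \<in> linear_maps n n"
proof -
  have "(\<lambda>x. x) \<in> rmod_hom R (Mn n) (Mn n)" "(\<lambda>x. x) \<in> rmod_hom R (free R n) (free R n)"
    by (auto intro: rmod_homI)
  moreover have "linear_lift n n (\<lambda>x\<in>carrier (Mn n). x) (\<lambda>x. x)"
    using calculation(2) q_closed by (auto simp: linear_lift_def)
  moreover have "(\<lambda>x\<in>carrier (Mn n). x) \<in> rmod_hom R (Mn n) (Mn n)"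
    by (rule rmod_hom_cong[OF Ms.right_module_axioms calculation(1)]) simp
  ultimately show ?thesis unfolding linear_maps_def by auto
qed

lemma linear_maps_comp:
  assumes u: "u \<in> linear_maps l m" and v: "v \<in> linear_maps m n"
  shows "compose (carrier (Mn l)) v u \<in> linear_maps l n"
proof -
  obtain b c where b: "linear_lift l m u b" and c: "linear_lift m n v c"
    using u v by (auto simp: linear_maps_def)
  have bc: "b \<in> rmod_hom R (free R l) (free R m)" "c \<in> rmod_hom R (free R m) (free R n)"
    using b c by (auto simp: linear_lift_def)
  have "linear_lift l n (compose (carrier (Mn l)) v u) (\<lambda>x. c (b x))"
    using b c rmod_hom_comp[OF bc] q_closed rmod_homD(1)[OF bc(1)]
    by (auto simp: linear_lift_def compose_def)
  then show ?thesis
    unfolding linear_maps_def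
    using rmod_hom_compose[OF Ms.right_module_axioms linear_mapsD(1)[OF u] linear_mapsD(1)[OF v]] by auto
qed

lemma linear_maps_restrict:
  assumes \<beta>: "\<beta> \<in> rmod_hom R (Mn n) (Mn n')" and b: "linear_lift n n' \<beta> b"
  shows "restrict \<beta> (carrier (Mn n)) \<in> linear_maps n n'"
proof -
  have "linear_lift n n' (restrict \<beta> (carrier (Mn n))) b"
    using b q_closed by (auto simp: linear_lift_def)
  then show ?thesis
    unfolding linear_maps_def using rmod_hom_cong[OF Ms.right_module_axioms \<beta>] by auto
qed

text \<open>Let \<open>t\<^sub>0, t\<^sub>1, \<dots>\<close> enumerate \<open>T\<close> and put \<open>S\<^sub>i = t\<^sub>0 \<dots> t\<^sub>i\<^sub>-\<^sub>1\<close>. Repeating the approximation step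
  gives \<open>h = g\<^sub>i \<circ> \<Gamma> + k\<^sub>i \<circ> S\<^sub>i\<close>, where \<open>g\<^sub>i\<^sub>+\<^sub>1 - g\<^sub>i\<close> is a multiple of \<open>S\<^sub>i\<close>. Every
  element is killed by some member of \<open>T\<close>, hence by almost all \<open>S\<^sub>i\<close>. So on each element the
  sequence \<open>g\<^sub>i\<close> is eventually constant and the remainder eventually vanishes, and the limit \<open>k\<close>
  of the \<open>g\<^sub>i\<close> satisfies \<open>h = k \<circ> \<Gamma>\<close>.\<close>

lemma exact_factorization:
  assumes noeth: "left_noetherian R" and count: "countable T"
    and \<beta>: "\<beta>\<^sub>1 \<in> linear_maps n n'" "\<beta>\<^sub>2 \<in> linear_maps n n'"
    and h: "h \<in> rmod_hom R (Mn n') (Ms (X :: 'x set))"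
    and rel: "\<And>x. x \<in> carrier (Mn n) \<Longrightarrow> h (\<beta>\<^sub>1 x) = h (\<beta>\<^sub>2 x)"
  shows "\<exists>p. \<exists>\<Gamma>\<in>linear_maps n' p. \<exists>k\<in>rmod_hom R (Mn p) (Ms X).
    (\<forall>x\<in>carrier (Mn n'). h x = k (\<Gamma> x)) \<and> (\<forall>x\<in>carrier (Mn n). \<Gamma> (\<beta>\<^sub>1 x) = \<Gamma> (\<beta>\<^sub>2 x))"
proof -
  obtain b\<^sub>1 b\<^sub>2 where b: "linear_lift n n' \<beta>\<^sub>1 b\<^sub>1" "linear_lift n n' \<beta>\<^sub>2 b\<^sub>2"
    using \<beta> by (auto simp: linear_maps_def)
  note \<beta>h = linear_mapsD(1)[OF \<beta>(1)] linear_mapsD(1)[OF \<beta>(2)]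
  obtain p \<Gamma> g where \<Gamma>: "\<Gamma> \<in> rmod_hom R (Mn n') (Mn p)" and g: "linear_lift n' p \<Gamma> g"
    and \<Gamma>\<beta>: "\<And>x. x \<in> carrier (Mn n) \<Longrightarrow> \<Gamma> (\<beta>\<^sub>1 x) = \<Gamma> (\<beta>\<^sub>2 x)"
    and step: "\<forall>h\<in>rmod_hom R (Mn n') (Ms X). (\<forall>x\<in>carrier (Mn n). h (\<beta>\<^sub>1 x) = h (\<beta>\<^sub>2 x)) \<longrightarrow>
      (\<forall>s\<in>T. \<exists>C\<in>rmod_hom R (Mn p) (Ms X). \<exists>h'\<in>rmod_hom R (Mn n') (Ms X).
        (\<forall>x\<in>carrier (Mn n'). h x = C (\<Gamma> x) \<oplus>\<^bsub>Ms X\<^esub> h' (x \<star>\<^bsub>Mn n'\<^esub> s)) \<and>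
        (\<forall>x\<in>carrier (Mn n). h' (\<beta>\<^sub>1 x) = h' (\<beta>\<^sub>2 x)))"
    using approximate_factorization[OF noeth \<beta>h b, where X = X] by blast
  define t where "t = from_nat_into T"
  have T_ne: "T \<noteq> {}" using one_T by blast
  have t: "t i \<in> T" for i unfolding t_def by (rule from_nat_into[OF T_ne])
  have t_surj: "\<exists>i. u = t i" if "u \<in> T" for u
    unfolding t_def using from_nat_into_surj[OF count that] by metis
  define S where "S = rec_nat \<one> (\<lambda>i a. a \<otimes> t i)"
  have S0: "S 0 = \<one>" and SS: "\<And>i. S (Suc i) = S i \<otimes> t i" by (simp_all add: S_def)
  have ST: "S i \<in> T" for i by (induction i) (simp_all add: S0 SS t)
  have SR: "S i \<in> carrier R" and tR: "t i \<in> carrier R" for i using ST t by simp_all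
  have Sact: "x \<star>\<^bsub>Ms Y\<^esub> S (Suc i) = x \<star>\<^bsub>Ms Y\<^esub> S i \<star>\<^bsub>Ms Y\<^esub> t i" if "x \<in> carrier (Ms Y)"
    for x i and Y :: "'y set" unfolding SS by (rule Ms.ract_assoc[OF that SR tR])
  have torsion: "\<exists>i. x \<star>\<^bsub>Ms Y\<^esub> S i = \<zero>\<^bsub>Ms Y\<^esub>" if x: "x \<in> carrier (Ms Y)" for x and Y :: "'y set"
  proof -
    obtain u w where u: "u \<in> T" and w: "w \<in> carrier (Rs Y)" and xq: "x = q Y u w" using q_surj[OF x] by blast
    obtain i where i: "u = t i" using t_surj[OF u] by blast
    have "x \<star>\<^bsub>Ms Y\<^esub> S (Suc i) = x \<star>\<^bsub>Ms Y\<^esub> t i \<star>\<^bsub>Ms Y\<^esub> S i"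
      unfolding SS T_comm[OF t SR, symmetric, of i i] T_comm[OF ST tR] using Ms.ract_assoc[OF x tR SR] T_comm[OF ST tR] by metis
    moreover have "x \<star>\<^bsub>Ms Y\<^esub> t i = \<zero>\<^bsub>Ms Y\<^esub>"
      using rmod_homD(3)[OF q_hom[OF u] w, of u] q_ract_self[OF u w] u unfolding xq i[symmetric] by simp
    ultimately have "x \<star>\<^bsub>Ms Y\<^esub> S (Suc i) = \<zero>\<^bsub>Ms Y\<^esub>" using Ms.zero_ract[OF SR] by metis
    then show ?thesis by blast
  qed
  have stays: "x \<star>\<^bsub>Ms Y\<^esub> S j = \<zero>\<^bsub>Ms Y\<^esub>"
    if x: "x \<in> carrier (Ms Y)" and 0: "x \<star>\<^bsub>Ms Y\<^esub> S i = \<zero>\<^bsub>Ms Y\<^esub>" and ij: "i \<le> j" for x i j and Y :: "'y set"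
    using ij
  proof (induction j rule: dec_induct)
    case (step j) show ?case unfolding Sact[OF x] step.IH by (rule Ms.zero_ract[OF tR])
  qed (rule 0)
  \<comment> \<open>The state \<open>gk\<close> of the recursion is the pair of \<open>g\<^sub>i\<close> and \<open>k\<^sub>i\<close>.\<close>
  define P where "P i gk \<longleftrightarrow> fst gk \<in> rmod_hom R (Mn p) (Ms X) \<and> snd gk \<in> rmod_hom R (Mn n') (Ms X) \<and>
      (\<forall>x\<in>carrier (Mn n). snd gk (\<beta>\<^sub>1 x) = snd gk (\<beta>\<^sub>2 x)) \<and>
      (\<forall>x\<in>carrier (Mn n'). h x = fst gk (\<Gamma> x) \<oplus>\<^bsub>Ms X\<^esub> snd gk (x \<star>\<^bsub>Mn n'\<^esub> S i))" for i gk
  define Q where "Q i gk gk' \<longleftrightarrow> (\<forall>x\<in>carrier (Mn p). x \<star>\<^bsub>Mn p\<^esub> S i = \<zero>\<^bsub>Mn p\<^esub> \<longrightarrow> fst gk' x = fst gk x)"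
    for i and gk gk' :: "((nat \<Rightarrow> 'm) \<Rightarrow> 'x \<Rightarrow> 'm) \<times> ((nat \<Rightarrow> 'm) \<Rightarrow> 'x \<Rightarrow> 'm)"
  have "\<exists>F. \<forall>i. P i (F i) \<and> Q i (F i) (F (Suc i))"
  proof (rule dependent_nat_choice)
    have "h x = \<zero>\<^bsub>Ms X\<^esub> \<oplus>\<^bsub>Ms X\<^esub> h (x \<star>\<^bsub>Mn n'\<^esub> S 0)" if x: "x \<in> carrier (Mn n')" for x
      unfolding S0 Ms.ract_one[OF x] by (rule Ms.M.l_zero[OF rmod_homD(1)[OF h x], symmetric])
    then have "P 0 (\<lambda>x. \<zero>\<^bsub>Ms X\<^esub>, h)"
      unfolding P_def fst_conv snd_conv
      using rmod_hom_zero_map[OF Ms.right_module_axioms Ms.right_module_axioms] h rel by blast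
    then show "\<exists>gk. P 0 gk" by blast
  next
    fix gk i assume P: "P i gk"
    obtain g k where gk: "gk = (g, k)" by fastforce
    have g: "g \<in> rmod_hom R (Mn p) (Ms X)" and k: "k \<in> rmod_hom R (Mn n') (Ms X)"
      and krel: "\<forall>x\<in>carrier (Mn n). k (\<beta>\<^sub>1 x) = k (\<beta>\<^sub>2 x)"
      and hgk: "\<And>x. x \<in> carrier (Mn n') \<Longrightarrow> h x = g (\<Gamma> x) \<oplus>\<^bsub>Ms X\<^esub> k (x \<star>\<^bsub>Mn n'\<^esub> S i)"
      using P unfolding P_def gk by simp_all
    obtain C k' where C: "C \<in> rmod_hom R (Mn p) (Ms X)" and k': "k' \<in> rmod_hom R (Mn n') (Ms X)"
      and kC: "\<And>x. x \<in> carrier (Mn n') \<Longrightarrow> k x = C (\<Gamma> x) \<oplus>\<^bsub>Ms X\<^esub> k' (x \<star>\<^bsub>Mn n'\<^esub> t i)"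
      and k'rel: "\<forall>x\<in>carrier (Mn n). k' (\<beta>\<^sub>1 x) = k' (\<beta>\<^sub>2 x)"
      using step k krel t[of i] by blast
    define g' where "g' x = g x \<oplus>\<^bsub>Ms X\<^esub> C (x \<star>\<^bsub>Mn p\<^esub> S i)" for x
    have act: "(\<lambda>x. x \<star>\<^bsub>Mn p\<^esub> S i) \<in> rmod_hom R (Mn p) (Mn p)"
      by (rule central_act_hom[OF Ms.right_module_axioms ST])
    have g': "g' \<in> rmod_hom R (Mn p) (Ms X)"
      unfolding g'_def by (rule rmod_hom_add[OF Ms.right_module_axioms g rmod_hom_comp[OF act C]])
    have "h x = g' (\<Gamma> x) \<oplus>\<^bsub>Ms X\<^esub> k' (x \<star>\<^bsub>Mn n'\<^esub> S (Suc i))" if x: "x \<in> carrier (Mn n')" for x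
    proof -
      have xS: "x \<star>\<^bsub>Mn n'\<^esub> S i \<in> carrier (Mn n')" by (rule Ms.ract_closed[OF x SR])
      have "h x = g (\<Gamma> x) \<oplus>\<^bsub>Ms X\<^esub> (C (\<Gamma> x \<star>\<^bsub>Mn p\<^esub> S i) \<oplus>\<^bsub>Ms X\<^esub> k' (x \<star>\<^bsub>Mn n'\<^esub> S (Suc i)))"
        unfolding hgk[OF x] kC[OF xS] rmod_homD(3)[OF \<Gamma> x SR] Sact[OF x] ..
      also have "\<dots> = g' (\<Gamma> x) \<oplus>\<^bsub>Ms X\<^esub> k' (x \<star>\<^bsub>Mn n'\<^esub> S (Suc i))"
        unfolding g'_def
        by (rule Ms.M.a_assoc[symmetric]; intro rmod_homD(1)[OF g] rmod_homD(1)[OF C] rmod_homD(1)[OF k']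
            Ms.ract_closed rmod_homD(1)[OF \<Gamma>] x SR)
      finally show ?thesis .
    qed
    then have "P (Suc i) (g', k')" unfolding P_def fst_conv snd_conv using g' k' k'rel by blast
    moreover have "Q i gk (g', k')"
      unfolding Q_def gk fst_conv
    proof (intro ballI impI)
      fix x assume x: "x \<in> carrier (Mn p)" and 0: "x \<star>\<^bsub>Mn p\<^esub> S i = \<zero>\<^bsub>Mn p\<^esub>"
      show "g' x = g x"
        unfolding g'_def 0 rmod_hom_zero[OF C Ms.right_module_axioms Ms.right_module_axioms]
        by (rule Ms.M.r_zero[OF rmod_homD(1)[OF g x]])
    qed
    ultimately show "\<exists>gk'. P (Suc i) gk' \<and> Q i gk gk'" by blast
  qed
  then obtain F where FP: "\<And>i. P i (F i)" and FQ: "\<And>i. Q i (F i) (F (Suc i))" by blast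
  define G where "G i = fst (F i)" for i
  have G: "G i \<in> rmod_hom R (Mn p) (Ms X)" for i using FP by (simp add: P_def G_def)
  define N where "N x = (LEAST i. x \<star>\<^bsub>Mn p\<^esub> S i = \<zero>\<^bsub>Mn p\<^esub>)" for x
  have N: "x \<star>\<^bsub>Mn p\<^esub> S i = \<zero>\<^bsub>Mn p\<^esub>" if "x \<in> carrier (Mn p)" "N x \<le> i" for x i
    using stays[OF that(1) _ that(2)] LeastI_ex[OF torsion[OF that(1)]] unfolding N_def by blast
  define k where "k x = G (N x) x" for x
  have stable: "k x = G i x" if x: "x \<in> carrier (Mn p)" and i: "N x \<le> i" for x i
    using i
  proof (induction i rule: dec_induct)
    case base then show ?case by (simp add: k_def)
  next
    case (step i)
    then show ?case using FQ[of i] N[OF x step.hyps(1)] x by (simp add: Q_def G_def)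
  qed
  have k: "k \<in> rmod_hom R (Mn p) (Ms X)"
  proof (rule rmod_homI)
    fix x assume x: "x \<in> carrier (Mn p)"
    show "k x \<in> carrier (Ms X)" unfolding k_def by (rule rmod_homD(1)[OF G x])
    show "k (x \<star>\<^bsub>Mn p\<^esub> a) = k x \<star>\<^bsub>Ms X\<^esub> a" if a: "a \<in> carrier R" for a
      using stable[OF x, of "max (N x) (N (x \<star>\<^bsub>Mn p\<^esub> a))"]
        stable[OF Ms.ract_closed[OF x a], of "max (N x) (N (x \<star>\<^bsub>Mn p\<^esub> a))"] rmod_homD(3)[OF G x a] by simp
    fix y assume y: "y \<in> carrier (Mn p)"
    define m where "m = max (N x) (max (N y) (N (x \<oplus>\<^bsub>Mn p\<^esub> y)))"
    show "k (x \<oplus>\<^bsub>Mn p\<^esub> y) = k x \<oplus>\<^bsub>Ms X\<^esub> k y"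
      using stable[OF x, of m] stable[OF y, of m] stable[OF Ms.M.a_closed[OF x y], of m]
        rmod_homD(2)[OF G x y] by (simp add: m_def)
  qed
  have "h x = k (\<Gamma> x)" if x: "x \<in> carrier (Mn n')" for x
  proof -
    note \<Gamma>x = rmod_homD(1)[OF \<Gamma> x]
    obtain i where i: "x \<star>\<^bsub>Mn n'\<^esub> S i = \<zero>\<^bsub>Mn n'\<^esub>" using torsion[OF x] by blast
    define m where "m = max i (N (\<Gamma> x))"
    have "x \<star>\<^bsub>Mn n'\<^esub> S m = \<zero>\<^bsub>Mn n'\<^esub>" using stays[OF x i] by (simp add: m_def)
    moreover have "snd (F m) \<zero>\<^bsub>Mn n'\<^esub> = \<zero>\<^bsub>Ms X\<^esub>"
      by (rule rmod_hom_zero[OF _ Ms.right_module_axioms Ms.right_module_axioms]) (use FP in \<open>simp add: P_def\<close>)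
    moreover have "h x = G m (\<Gamma> x) \<oplus>\<^bsub>Ms X\<^esub> snd (F m) (x \<star>\<^bsub>Mn n'\<^esub> S m)"
      using FP[of m] x unfolding P_def G_def by blast
    ultimately have "h x = G m (\<Gamma> x)" using Ms.M.r_zero[OF rmod_homD(1)[OF G \<Gamma>x]] by metis
    then show ?thesis using stable[OF \<Gamma>x, of m] by (simp add: m_def)
  qed
  moreover have "\<beta>\<^sub>1 x \<in> carrier (Mn n')" "\<beta>\<^sub>2 x \<in> carrier (Mn n')" if "x \<in> carrier (Mn n)" for x
    using rmod_homD(1)[OF \<beta>h(1) that] rmod_homD(1)[OF \<beta>h(2) that] .
  ultimately show ?thesis
    using linear_maps_restrict[OF \<Gamma> g] k \<Gamma>\<beta>
    by (intro exI[of _ p] bexI[of _ "restrict \<Gamma> (carrier (Mn n'))"] bexI[of _ k]) auto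
qed

lemma q_push:
  assumes s: "s \<in> T"
  shows "q Y s (push f X Y (reg R) w) = push f X Y M (q X s w)"
  using e_closed[OF s] by (auto simp: q_def push_def inv_into_into intro!: restrict_ext)

lemma push_linear:
  assumes f: "inj_on f {..<n}" "f ` {..<n} \<subseteq> {..<n'}"
  shows "restrict (push f {..<n} {..<n'} M) (carrier (Mn n)) \<in> linear_maps n n'"
  by (rule linear_maps_restrict[OF push_hom[OF M_module f], of "push f {..<n} {..<n'} (reg R)"])
    (simp add: linear_lift_def q_push push_hom[OF reg_module f])

lemma pull_push_disjoint:
  assumes "f ` X \<inter> g ` Z = {}" "g ` Z \<subseteq> Y"
  shows "pull g Z (push f X Y M x) = \<zero>\<^bsub>Ms Z\<^esub>"
proof
  fix z
  have "push f X Y M x (g z) = \<zero>\<^bsub>M\<^esub>" if "z \<in> Z"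
    using that assms by (intro push_outside) auto
  then show "pull g Z (push f X Y M x) z = \<zero>\<^bsub>Ms Z\<^esub> z" by (simp add: pull_def)
qed

lemma linear_join:
  assumes D: "right_module R D" and h: "h \<in> rmod_hom R (Mn n) D" and h': "h' \<in> rmod_hom R (Mn n') D"
  shows "\<exists>\<iota>\<in>linear_maps n (n + n'). \<exists>\<iota>'\<in>linear_maps n' (n + n'). \<exists>k\<in>rmod_hom R (Mn (n + n')) D.
    (\<forall>x\<in>carrier (Mn n). k (\<iota> x) = h x) \<and> (\<forall>x\<in>carrier (Mn n'). k (\<iota>' x) = h' x)"
proof -
  interpret D: right_module R D by fact
  let ?N = "{..<n + n'}"
  have i: "inj_on id {..<n}" "id ` {..<n} \<subseteq> ?N" by auto
  have j: "inj_on ((+) n) {..<n'}" "(+) n ` {..<n'} \<subseteq> ?N" by auto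
  define k where "k x = h (pull id {..<n} x) \<oplus>\<^bsub>D\<^esub> h' (pull ((+) n) {..<n'} x)" for x
  have k: "k \<in> rmod_hom R (Mn (n + n')) D"
    unfolding k_def by (intro rmod_hom_add[OF D] rmod_hom_comp[OF pull_hom[OF i] h] rmod_hom_comp[OF pull_hom[OF j] h'])
  have 0: "h \<zero>\<^bsub>Mn n\<^esub> = \<zero>\<^bsub>D\<^esub>" "h' \<zero>\<^bsub>Mn n'\<^esub> = \<zero>\<^bsub>D\<^esub>"
    using rmod_hom_zero[OF h Ms.right_module_axioms D] rmod_hom_zero[OF h' Ms.right_module_axioms D] .
  have d: "id ` {..<n} \<inter> (+) n ` {..<n'} = {}" "(+) n ` {..<n'} \<inter> id ` {..<n} = {}" by auto
  have 1: "k (push id {..<n} ?N M x) = h x" if x: "x \<in> carrier (Mn n)" for x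
    unfolding k_def pull_push[OF i x] pull_push_disjoint[OF d(1) j(2)] 0
    by (rule D.M.r_zero[OF rmod_homD(1)[OF h x]])
  have 2: "k (push ((+) n) {..<n'} ?N M x) = h' x" if x: "x \<in> carrier (Mn n')" for x
    unfolding k_def pull_push[OF j x] pull_push_disjoint[OF d(2) i(2)] 0
    by (rule D.M.l_zero[OF rmod_homD(1)[OF h' x]])
  show ?thesis
    by (intro bexI[OF _ push_linear[OF i]] bexI[OF _ push_linear[OF j]] bexI[OF _ k]) (simp add: 1 2)
qed

end

locale summand_of_copies = unit_fractions R M T e
  for R :: "('r, 'k) ring_scheme" (structure) and M :: "('r, 'm) rmodule" and T e +
  fixes X :: "'x set" and D :: "('r, 'd) rmodule" and i \<pi>
  assumes noeth: "left_noetherian R" and count: "countable T"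
    and D: "right_module R D"
    and i: "i \<in> rmod_hom R D (Ms X)" and \<pi>: "\<pi> \<in> rmod_hom R (Ms X) D"
    and \<pi>_i: "d \<in> carrier D \<Longrightarrow> \<pi> (i d) = d"
begin

lemma factor_relation:
  assumes \<beta>: "\<beta>\<^sub>1 \<in> linear_maps n n'" "\<beta>\<^sub>2 \<in> linear_maps n n'"
    and h: "h \<in> rmod_hom R (Mn n') D" and rel: "\<And>x. x \<in> carrier (Mn n) \<Longrightarrow> h (\<beta>\<^sub>1 x) = h (\<beta>\<^sub>2 x)"
  shows "\<exists>p. \<exists>\<Gamma>\<in>linear_maps n' p. \<exists>k\<in>rmod_hom R (Mn p) D.
    (\<forall>x\<in>carrier (Mn n'). h x = k (\<Gamma> x)) \<and> (\<forall>x\<in>carrier (Mn n). \<Gamma> (\<beta>\<^sub>1 x) = \<Gamma> (\<beta>\<^sub>2 x))"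
proof -
  have "i (h (\<beta>\<^sub>1 x)) = i (h (\<beta>\<^sub>2 x))" if "x \<in> carrier (Mn n)" for x using rel[OF that] by simp
  from exact_factorization[OF noeth count \<beta> rmod_hom_comp[OF h i] this]
  obtain p \<Gamma> k where \<Gamma>: "\<Gamma> \<in> linear_maps n' p" and k: "k \<in> rmod_hom R (Mn p) (Ms X)"
    and ik: "\<And>x. x \<in> carrier (Mn n') \<Longrightarrow> i (h x) = k (\<Gamma> x)"
    and \<Gamma>\<beta>: "\<forall>x\<in>carrier (Mn n). \<Gamma> (\<beta>\<^sub>1 x) = \<Gamma> (\<beta>\<^sub>2 x)" by blast
  have "h x = \<pi> (k (\<Gamma> x))" if x: "x \<in> carrier (Mn n')" for x
    unfolding ik[OF x, symmetric] \<pi>_i[OF rmod_homD(1)[OF h x]] ..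
  then show ?thesis using \<Gamma>\<beta>
    by (intro exI[of _ p] bexI[OF _ \<Gamma>] bexI[OF _ rmod_hom_comp[OF k \<pi>]]) simp
qed

text \<open>An element \<open>v/s\<close> killed by \<open>h\<close> gives a relation of the kind treated before: the map
  \<open>h \<circ> v: M \<rightarrow> D\<close> kills \<open>1/s\<close>, hence equals \<open>g \<circ> s\<close> for some \<open>g\<close>, so the map
  \<open>(h, g): M\<^sup>n\<^sup>+\<^sup>1 \<rightarrow> D\<close> takes the same values on the columns \<open>(v, 0)\<close> and \<open>(0, s)\<close>. A matrix
  that identifies these columns sends \<open>(v/s, 0)\<close> to the image of \<open>(0, s/s) = 0\<close>.\<close>

lemma factor_kill:
  assumes h: "h \<in> rmod_hom R (Mn n) D" and x: "x \<in> carrier (Mn n)" and 0: "h x = \<zero>\<^bsub>D\<^esub>"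
  shows "\<exists>p. \<exists>\<Gamma>\<in>linear_maps n p. \<exists>k\<in>rmod_hom R (Mn p) D.
    (\<forall>x\<in>carrier (Mn n). h x = k (\<Gamma> x)) \<and> \<Gamma> x = \<zero>\<^bsub>Mn p\<^esub>"
proof -
  interpret D: right_module R D by (rule D)
  obtain s v where s: "s \<in> T" and v: "v \<in> carrier (free R n)" and xq: "x = qn n s v" using q_surj[OF x] by blast
  have sR: "s \<in> carrier R" using s by simp
  have "(\<lambda>c. v \<star>\<^bsub>free R n\<^esub> c) \<in> rmod_hom R (reg R) (free R n)"
    by (intro rmod_homI) (simp_all del: direct_sum_copies_simps add: free.ract_r_distr[OF v] free.ract_assoc[OF v] v)
  then have b: "(\<lambda>w. v \<star>\<^bsub>free R n\<^esub> w 0) \<in> rmod_hom R (free R 1) (free R n)"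
    by (rule rmod_hom_comp[rotated]) (rule direct_sum_copies_proj, simp)
  obtain \<beta> where \<beta>: "\<beta> \<in> rmod_hom R (Mn 1) (Mn n)"
    and \<beta>q: "\<And>s w. \<lbrakk>s \<in> T; w \<in> carrier (free R 1)\<rbrakk> \<Longrightarrow> \<beta> (qn 1 s w) = qn n s (v \<star>\<^bsub>free R n\<^esub> w 0)"
    using extend_hom[OF b] by blast
  define \<beta>' where "\<beta>' = restrict \<beta> (carrier (Mn 1))"
  have \<beta>': "\<beta>' \<in> linear_maps 1 n"
    unfolding \<beta>'_def
  proof (rule linear_maps_restrict[OF \<beta>])
    show "linear_lift 1 n \<beta> (\<lambda>w. v \<star>\<^bsub>free R n\<^esub> w 0)"
      unfolding linear_lift_def using b \<beta>q by blast
  qed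
  have h\<beta>: "(\<lambda>y. h (\<beta> y)) \<in> rmod_hom R (Mn 1) D" by (rule rmod_hom_comp[OF \<beta> h])
  have "h (\<beta> (qn 1 s w)) = \<zero>\<^bsub>D\<^esub>" if w: "w \<in> carrier (free R 1)" for w
  proof -
    have c: "w 0 \<in> carrier R" using Rs_coord[OF w] by simp
    have "h (\<beta> (qn 1 s w)) = h x \<star>\<^bsub>D\<^esub> w 0"
      unfolding \<beta>q[OF s w] rmod_homD(3)[OF q_hom[OF s] v c] xq[symmetric] by (rule rmod_homD(3)[OF h x c])
    then show ?thesis using 0 c by simp
  qed
  then obtain g where g: "g \<in> rmod_hom R (Mn 1) D"
    and hg: "\<And>y. y \<in> carrier (Mn 1) \<Longrightarrow> h (\<beta> y) = g (y \<star>\<^bsub>Mn 1\<^esub> s)"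
    using divide_hom[OF D s h\<beta>] by blast
  define \<tau> where "\<tau> = (\<lambda>y\<in>carrier (Mn 1). y \<star>\<^bsub>Mn 1\<^esub> s)"
  have \<tau>: "\<tau> \<in> linear_maps 1 1"
    unfolding \<tau>_def
  proof (rule linear_maps_restrict[OF central_act_hom[OF Ms.right_module_axioms s], of _ "\<lambda>w. w \<star>\<^bsub>free R 1\<^esub> s"])
    show "linear_lift 1 1 (\<lambda>y. y \<star>\<^bsub>Mn 1\<^esub> s) (\<lambda>w. w \<star>\<^bsub>free R 1\<^esub> s)"
      unfolding linear_lift_def
      using central_act_hom[OF free_module s] rmod_homD(3)[OF q_hom _ sR] by metis
  qed
  obtain \<iota> \<iota>' k where \<iota>: "\<iota> \<in> linear_maps n (n + 1)" and \<iota>': "\<iota>' \<in> linear_maps 1 (n + 1)"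
    and k: "k \<in> rmod_hom R (Mn (n + 1)) D"
    and k\<iota>: "\<And>y. y \<in> carrier (Mn n) \<Longrightarrow> k (\<iota> y) = h y" and k\<iota>': "\<And>y. y \<in> carrier (Mn 1) \<Longrightarrow> k (\<iota>' y) = g y"
    using linear_join[OF D h g] by blast
  let ?c = "compose (carrier (Mn 1))"
  have "k (?c \<iota> \<beta>' y) = k (?c \<iota>' \<tau> y)" if y: "y \<in> carrier (Mn 1)" for y
    using y k\<iota>[OF rmod_homD(1)[OF \<beta> y]] k\<iota>'[OF Ms.ract_closed[OF y sR]] hg[OF y]
    by (simp del: direct_sum_copies_simps add: compose_def \<beta>'_def \<tau>_def)
  from factor_relation[OF linear_maps_comp[OF \<beta>' \<iota>] linear_maps_comp[OF \<tau> \<iota>'] k this]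
  obtain p \<Gamma> l where \<Gamma>: "\<Gamma> \<in> linear_maps (n + 1) p" and l: "l \<in> rmod_hom R (Mn p) D"
    and kl: "\<And>y. y \<in> carrier (Mn (n + 1)) \<Longrightarrow> k y = l (\<Gamma> y)"
    and \<Gamma>eq: "\<And>y. y \<in> carrier (Mn 1) \<Longrightarrow> \<Gamma> (?c \<iota> \<beta>' y) = \<Gamma> (?c \<iota>' \<tau> y)" by blast
  define \<epsilon> where "\<epsilon> = qn 1 s (basis R 1 0)"
  have \<epsilon>c: "\<epsilon> \<in> carrier (Mn 1)" unfolding \<epsilon>_def by (rule q_closed[OF s basis_closed])
  have "\<beta> \<epsilon> = x"
    unfolding \<epsilon>_def \<beta>q[OF s basis_closed] xq using free.ract_one[OF v] by (simp add: single_def del: direct_sum_copies_simps)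
  then have "\<Gamma> (\<iota> x) = \<Gamma> (\<iota>' (\<epsilon> \<star>\<^bsub>Mn 1\<^esub> s))"
    using \<Gamma>eq[OF \<epsilon>c] \<epsilon>c by (simp del: direct_sum_copies_simps add: compose_def \<beta>'_def \<tau>_def)
  also have "\<epsilon> \<star>\<^bsub>Mn 1\<^esub> s = \<zero>\<^bsub>Mn 1\<^esub>"
    unfolding \<epsilon>_def rmod_homD(3)[OF q_hom[OF s] basis_closed sR, symmetric] by (rule q_ract_self[OF s basis_closed])
  also have "\<Gamma> (\<iota>' \<zero>\<^bsub>Mn 1\<^esub>) = \<zero>\<^bsub>Mn p\<^esub>"
    by (simp only: rmod_hom_zero[OF linear_mapsD(1)[OF \<iota>'] Ms.right_module_axioms Ms.right_module_axioms]
        rmod_hom_zero[OF linear_mapsD(1)[OF \<Gamma>] Ms.right_module_axioms Ms.right_module_axioms])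
  finally have "compose (carrier (Mn n)) \<Gamma> \<iota> x = \<zero>\<^bsub>Mn p\<^esub>" using x by (simp add: compose_def)
  moreover have "h y = l (compose (carrier (Mn n)) \<Gamma> \<iota> y)" if y: "y \<in> carrier (Mn n)" for y
    using y k\<iota>[OF y] kl[OF rmod_homD(1)[OF linear_mapsD(1)[OF \<iota>] y]] by (simp add: compose_def)
  ultimately show ?thesis using linear_maps_comp[OF \<iota> \<Gamma>] l by blast
qed

text \<open>An element of a direct sum lies in the sum of finitely many of the copies.\<close>

lemma reach:
  assumes d: "d \<in> carrier D"
  shows "\<exists>n. \<exists>h\<in>rmod_hom R (Mn n) D. \<exists>x\<in>carrier (Mn n). h x = d"
proof -
  note id = rmod_homD(1)[OF i d]
  define Y where "Y = {x \<in> X. i d x \<noteq> \<zero>\<^bsub>M\<^esub>}"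
  have "finite Y" using id by (simp add: Y_def carrier_direct_sum_copies)
  then obtain f where f: "bij_betw f {..<card Y} Y" using ex_bij_betw_nat_finite lessThan_atLeast0 by metis
  have f': "inj_on f {..<card Y}" "f ` {..<card Y} \<subseteq> X" using f by (auto simp: bij_betw_def Y_def)
  have "push f {..<card Y} X M (pull f {..<card Y} (i d)) = i d"
    by (rule push_pull[OF f' id]) (use f in \<open>auto simp: bij_betw_def Y_def\<close>)
  then have "\<pi> (push f {..<card Y} X M (pull f {..<card Y} (i d))) = d" using \<pi>_i[OF d] by simp
  then show ?thesis
    by (intro exI[of _ "card Y"] bexI[OF _ rmod_hom_comp[OF push_hom[OF M_module f'] \<pi>]]
        bexI[OF _ rmod_homD(1)[OF pull_hom[OF f'] id]])
qed

end

section \<open>Quotient modules\<close>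

lemma quotient_rmodule_simps [simp]:
  "carrier (quotient_rmodule N H) = a_rcosets\<^bsub>N\<^esub> H"
  "\<zero>\<^bsub>quotient_rmodule N H\<^esub> = H"
  "X \<oplus>\<^bsub>quotient_rmodule N H\<^esub> Y = X <+>\<^bsub>N\<^esub> Y"
  "X \<star>\<^bsub>quotient_rmodule N H\<^esub> a = (\<Union>x\<in>X. H +>\<^bsub>N\<^esub> (x \<star>\<^bsub>N\<^esub> a))"
  by (simp_all add: quotient_rmodule_def)

locale quotient_of_rmodule = right_module R N for R :: "('r, 'k) ring_scheme" and N :: "('r, 'a, 'm) rmodule_scheme" +
  fixes H assumes H: "rsubmodule R H N"
begin

sublocale abelian_subgroup H N
  using H by (intro abelian_subgroupI3 M.abelian_group_axioms additive_subgroup.intro) (simp_all add: rsubmodule_def)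

lemma coset_carrier: "a_rcosets\<^bsub>N\<^esub> H = (\<lambda>x. H +>\<^bsub>N\<^esub> x) ` carrier N"
  by (auto simp: A_RCOSETS_defs a_r_coset_def)

lemma coset_zero: "H +>\<^bsub>N\<^esub> \<zero>\<^bsub>N\<^esub> = H"
  using a_coset_add_zero rsubmodule_closed(1)[OF H] by blast

lemma coset_eq_iff:
  assumes "x \<in> carrier N" "y \<in> carrier N"
  shows "H +>\<^bsub>N\<^esub> x = H +>\<^bsub>N\<^esub> y \<longleftrightarrow> x \<ominus>\<^bsub>N\<^esub> y \<in> H"
  using a_rcos_module[OF assms(2,1)] a_repr_independence'[of x y] a_rcos_self[OF assms(1)] assms(2)
  by (auto simp: a_minus_def)

lemma coset_eq_H_iff:
  assumes "x \<in> carrier N" shows "H +>\<^bsub>N\<^esub> x = H \<longleftrightarrow> x \<in> H"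
proof -
  have "\<ominus>\<^bsub>N\<^esub> \<zero>\<^bsub>N\<^esub> = \<zero>\<^bsub>N\<^esub>" by (rule M.minus_equality) simp_all
  then have "x \<ominus>\<^bsub>N\<^esub> \<zero>\<^bsub>N\<^esub> = x" unfolding a_minus_def using M.r_zero[OF assms] by metis
  then show ?thesis using coset_eq_iff[OF assms M.zero_closed] unfolding coset_zero by metis
qed

text \<open>This is what makes the union over representatives in the definition of the action a single
  coset.\<close>

lemma coset_ract:
  assumes x: "x \<in> carrier N" and a: "a \<in> carrier R"
  shows "(\<Union>y\<in>H +>\<^bsub>N\<^esub> x. H +>\<^bsub>N\<^esub> (y \<star>\<^bsub>N\<^esub> a)) = H +>\<^bsub>N\<^esub> (x \<star>\<^bsub>N\<^esub> a)"
proof (rule SUP_eq_const)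
  show "H +>\<^bsub>N\<^esub> x \<noteq> {}" using a_rcos_self[OF x] by blast
  fix y assume y: "y \<in> H +>\<^bsub>N\<^esub> x"
  have yc: "y \<in> carrier N" using y x a_r_coset_subset_G rsubmodule_closed(1)[OF H] by blast
  have "y \<ominus>\<^bsub>N\<^esub> x \<in> H" using a_rcos_module_imp[OF x y] by (simp add: a_minus_def)
  then have "(y \<ominus>\<^bsub>N\<^esub> x) \<star>\<^bsub>N\<^esub> a \<in> H" by (rule rsubmodule_closed(4)[OF H _ a])
  then show "H +>\<^bsub>N\<^esub> (y \<star>\<^bsub>N\<^esub> a) = H +>\<^bsub>N\<^esub> (x \<star>\<^bsub>N\<^esub> a)"
    using coset_eq_iff x yc a by (simp add: diff_ract)
qed

lemma quotient_right_module: "right_module R (quotient_rmodule N H)"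
proof -
  let ?Q = "quotient_rmodule N H"
  note cs = coset_carrier a_rcos_sum coset_ract
  have "abelian_group ?Q"
  proof (rule abelian_groupI)
    fix X assume "X \<in> carrier ?Q"
    then obtain x where x: "x \<in> carrier N" "X = H +>\<^bsub>N\<^esub> x" by (auto simp: coset_carrier)
    show "\<zero>\<^bsub>?Q\<^esub> \<oplus>\<^bsub>?Q\<^esub> X = X"
      using a_rcos_sum[OF M.zero_closed x(1)] x coset_zero by simp
    have "(H +>\<^bsub>N\<^esub> (\<ominus>\<^bsub>N\<^esub> x)) \<oplus>\<^bsub>?Q\<^esub> X = \<zero>\<^bsub>?Q\<^esub>"
      using a_rcos_sum[OF M.a_inv_closed[OF x(1)] x(1)] x coset_zero by (simp add: M.l_neg)
    then show "\<exists>Y\<in>carrier ?Q. Y \<oplus>\<^bsub>?Q\<^esub> X = \<zero>\<^bsub>?Q\<^esub>"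
      by (rule bexI) (use x in \<open>simp add: coset_carrier\<close>)
  next
    fix X Y assume "X \<in> carrier ?Q" "Y \<in> carrier ?Q"
    then obtain x y where x: "x \<in> carrier N" "X = H +>\<^bsub>N\<^esub> x" "y \<in> carrier N" "Y = H +>\<^bsub>N\<^esub> y"
      by (auto simp: coset_carrier)
    then show "X \<oplus>\<^bsub>?Q\<^esub> Y \<in> carrier ?Q" "X \<oplus>\<^bsub>?Q\<^esub> Y = Y \<oplus>\<^bsub>?Q\<^esub> X"
      by (simp_all add: cs M.a_comm)
    fix Z assume "Z \<in> carrier ?Q"
    then obtain z where z: "z \<in> carrier N" "Z = H +>\<^bsub>N\<^esub> z" by (auto simp: coset_carrier)
    then show "X \<oplus>\<^bsub>?Q\<^esub> Y \<oplus>\<^bsub>?Q\<^esub> Z = X \<oplus>\<^bsub>?Q\<^esub> (Y \<oplus>\<^bsub>?Q\<^esub> Z)"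
      using x by (simp add: a_rcos_sum M.a_assoc)
  qed (use coset_zero in \<open>simp add: coset_carrier image_iff, metis M.zero_closed\<close>)
  moreover have "right_module_axioms R ?Q"
  proof (unfold_locales)
    fix X a assume X: "X \<in> carrier ?Q" and a: "a \<in> carrier R"
    obtain x where x: "x \<in> carrier N" "X = H +>\<^bsub>N\<^esub> x" using X by (auto simp: coset_carrier)
    show "X \<star>\<^bsub>?Q\<^esub> a \<in> carrier ?Q" using x a by (simp add: coset_ract, simp add: coset_carrier)
    show "X \<star>\<^bsub>?Q\<^esub> (a \<oplus>\<^bsub>R\<^esub> b) = X \<star>\<^bsub>?Q\<^esub> a \<oplus>\<^bsub>?Q\<^esub> X \<star>\<^bsub>?Q\<^esub> b" if b: "b \<in> carrier R" for b
      using x a b by (simp add: coset_ract ract_r_distr a_rcos_sum)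
    show "X \<star>\<^bsub>?Q\<^esub> (a \<otimes>\<^bsub>R\<^esub> b) = X \<star>\<^bsub>?Q\<^esub> a \<star>\<^bsub>?Q\<^esub> b" if b: "b \<in> carrier R" for b
      using x a b by (simp add: coset_ract ract_assoc)
    fix Y assume "Y \<in> carrier ?Q"
    then obtain y where y: "y \<in> carrier N" "Y = H +>\<^bsub>N\<^esub> y" by (auto simp: coset_carrier)
    show "(X \<oplus>\<^bsub>?Q\<^esub> Y) \<star>\<^bsub>?Q\<^esub> a = X \<star>\<^bsub>?Q\<^esub> a \<oplus>\<^bsub>?Q\<^esub> Y \<star>\<^bsub>?Q\<^esub> a"
      using x y a by (simp add: coset_ract ract_l_distr a_rcos_sum)
  next
    fix X assume X: "X \<in> carrier ?Q"
    then obtain x where x: "x \<in> carrier N" "X = H +>\<^bsub>N\<^esub> x" by (auto simp: coset_carrier)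
    then show "X \<star>\<^bsub>?Q\<^esub> \<one>\<^bsub>R\<^esub> = X" by (simp add: coset_ract)
  qed
  ultimately show ?thesis by (intro right_module.intro R.ring_axioms)
qed

end

section \<open>The localization and its cokernel\<close>

context central_subset
begin

text \<open>Products are normalized by moving central factors past arbitrary ones. Both orientations of
  each law are ordered rewrite rules, as either factor may be the central one.\<close>

lemma T_comm': "\<lbrakk>t \<in> T; a \<in> carrier R\<rbrakk> \<Longrightarrow> a \<otimes> t = t \<otimes> a"
  by (simp add: T_comm)

lemma T_lcomm: "\<lbrakk>t \<in> T; a \<in> carrier R; b \<in> carrier R\<rbrakk> \<Longrightarrow> t \<otimes> (a \<otimes> b) = a \<otimes> (t \<otimes> b)"
  using m_assoc[of t a b] m_assoc[of a t b] T_comm[of t a] by simp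

lemma T_lcomm': "\<lbrakk>t \<in> T; a \<in> carrier R; b \<in> carrier R\<rbrakk> \<Longrightarrow> a \<otimes> (t \<otimes> b) = t \<otimes> (a \<otimes> b)"
  by (simp add: T_lcomm)

lemmas T_ac = m_assoc T_comm T_comm' T_lcomm T_lcomm'

abbreviation fr where "fr \<equiv> frac R T"
abbreviation "Loc \<equiv> loc_rmodule R T"

lemma frac_rel_iff:
  "((a, s), (b, t)) \<in> frac_rel R T \<longleftrightarrow> a \<in> carrier R \<and> b \<in> carrier R \<and> s \<in> T \<and> t \<in> T \<and>
    (\<exists>u\<in>T. u \<otimes> (a \<otimes> t) = u \<otimes> (b \<otimes> s))"
  by (simp add: frac_rel_def)

lemma equiv_frac_rel: "equiv (carrier R \<times> T) (frac_rel R T)"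
proof (rule equivI)
  show "frac_rel R T \<subseteq> (carrier R \<times> T) \<times> (carrier R \<times> T)" by (auto simp: frac_rel_def)
  show "refl_on (carrier R \<times> T) (frac_rel R T)"
    by (rule refl_onI) (use one_T in \<open>auto simp: frac_rel_iff\<close>)
  show "sym (frac_rel R T)" by (rule symI) (auto simp: frac_rel_iff, metis)
  show "trans (frac_rel R T)"
  proof (rule transI, clarify)
    fix a s b t c r
    assume "((a, s), (b, t)) \<in> frac_rel R T" "((b, t), (c, r)) \<in> frac_rel R T"
    then obtain u v where c: "a \<in> carrier R" "b \<in> carrier R" "c \<in> carrier R" "s \<in> T" "t \<in> T" "r \<in> T" "u \<in> T" "v \<in> T"
      and u: "u \<otimes> (a \<otimes> t) = u \<otimes> (b \<otimes> s)" and v: "v \<otimes> (b \<otimes> r) = v \<otimes> (c \<otimes> t)"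
      by (auto simp: frac_rel_iff)
    have "u \<otimes> v \<otimes> t \<otimes> (a \<otimes> r) = v \<otimes> r \<otimes> (u \<otimes> (a \<otimes> t))" using c by (simp add: T_ac)
    also have "\<dots> = u \<otimes> s \<otimes> (v \<otimes> (b \<otimes> r))" unfolding u using c by (simp add: T_ac)
    also have "\<dots> = u \<otimes> v \<otimes> t \<otimes> (c \<otimes> s)" unfolding v using c by (simp add: T_ac)
    finally show "((a, s), (c, r)) \<in> frac_rel R T"
      using c by (auto simp: frac_rel_iff intro!: bexI[of _ "u \<otimes> v \<otimes> t"])
  qed
qed

lemma fr_eq_iff:
  assumes "a \<in> carrier R" "b \<in> carrier R" "s \<in> T" "t \<in> T"
  shows "fr a s = fr b t \<longleftrightarrow> (\<exists>u\<in>T. u \<otimes> (a \<otimes> t) = u \<otimes> (b \<otimes> s))"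
  unfolding frac_def using assms by (subst eq_equiv_class_iff[OF equiv_frac_rel]) (auto simp: frac_rel_iff)

lemma fr_eqI:
  assumes "a \<in> carrier R" "b \<in> carrier R" "s \<in> T" "t \<in> T" "a \<otimes> t = b \<otimes> s"
  shows "fr a s = fr b t"
  using fr_eq_iff[OF assms(1-4)] assms(5) one_T by metis

lemma in_fr_iff:
  assumes "a \<in> carrier R" "s \<in> T"
  shows "(b, t) \<in> fr a s \<longleftrightarrow> b \<in> carrier R \<and> t \<in> T \<and> fr b t = fr a s"
proof -
  have "(b, t) \<in> fr a s \<longleftrightarrow> ((a, s), (b, t)) \<in> frac_rel R T" by (simp add: frac_def)
  also have "\<dots> \<longleftrightarrow> b \<in> carrier R \<and> t \<in> T \<and> fr b t = fr a s"
    unfolding frac_rel_iff using assms fr_eq_iff[of b a t s] by (metis (no_types))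
  finally show ?thesis .
qed

lemma carrier_L: "carrier Loc = (\<lambda>(a, s). fr a s) ` (carrier R \<times> T)"
  by (auto simp: loc_rmodule_def localization_def ring.defs quotient_def frac_def)

lemma L_cases:
  assumes "x \<in> carrier Loc" obtains a s where "a \<in> carrier R" "s \<in> T" "x = fr a s"
  using assms by (auto simp: carrier_L)

lemma fr_closed: "\<lbrakk>a \<in> carrier R; s \<in> T\<rbrakk> \<Longrightarrow> fr a s \<in> carrier Loc"
  by (auto simp: carrier_L)

lemma zero_L: "\<zero>\<^bsub>Loc\<^esub> = fr \<zero> \<one>"
  by (simp add: loc_rmodule_def localization_def ring.defs)

lemma add_fr:
  assumes c: "a \<in> carrier R" "b \<in> carrier R" "s \<in> T" "t \<in> T"
  shows "fr a s \<oplus>\<^bsub>Loc\<^esub> fr b t = fr (a \<otimes> t \<oplus> b \<otimes> s) (s \<otimes> t)"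
proof -
  have *: "fr (a' \<otimes> t' \<oplus> b' \<otimes> s') (s' \<otimes> t') = fr (a \<otimes> t \<oplus> b \<otimes> s) (s \<otimes> t)"
    if as: "(a', s') \<in> fr a s" and bt: "(b', t') \<in> fr b t" for a' s' b' t'
  proof -
    have as': "a' \<in> carrier R" "s' \<in> T" "fr a' s' = fr a s" using as in_fr_iff[OF c(1,3)] by auto
    have bt': "b' \<in> carrier R" "t' \<in> T" "fr b' t' = fr b t" using bt in_fr_iff[OF c(2,4)] by auto
    obtain u where u: "u \<in> T" "u \<otimes> (a' \<otimes> s) = u \<otimes> (a \<otimes> s')"
      using as'(3) fr_eq_iff[OF as'(1) c(1) as'(2) c(3)] by auto
    obtain v where v: "v \<in> T" "v \<otimes> (b' \<otimes> t) = v \<otimes> (b \<otimes> t')"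
      using bt'(3) fr_eq_iff[OF bt'(1) c(2) bt'(2) c(4)] by auto
    note cc = c as'(1,2) bt'(1,2) u(1) v(1)
    have "u \<otimes> v \<otimes> ((a' \<otimes> t' \<oplus> b' \<otimes> s') \<otimes> (s \<otimes> t)) =
      v \<otimes> t \<otimes> t' \<otimes> (u \<otimes> (a' \<otimes> s)) \<oplus> u \<otimes> s \<otimes> s' \<otimes> (v \<otimes> (b' \<otimes> t))"
      using cc by (simp add: l_distr r_distr T_ac)
    also have "\<dots> = u \<otimes> v \<otimes> ((a \<otimes> t \<oplus> b \<otimes> s) \<otimes> (s' \<otimes> t'))"
      unfolding u v using cc by (simp add: l_distr r_distr T_ac)
    finally show ?thesis using cc by (subst fr_eq_iff) (auto intro!: bexI[of _ "u \<otimes> v"])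
  qed
  have ne: "(a, s) \<in> fr a s" "(b, t) \<in> fr b t" using c in_fr_iff by auto
  have "fr a s \<oplus>\<^bsub>Loc\<^esub> fr b t = (\<Union>(a', s')\<in>fr a s. \<Union>(b', t')\<in>fr b t. fr (a' \<otimes> t' \<oplus> b' \<otimes> s') (s' \<otimes> t'))"
    by (simp add: loc_rmodule_def localization_def ring.defs)
  also have "\<dots> = fr (a \<otimes> t \<oplus> b \<otimes> s) (s \<otimes> t)"
  proof (rule SUP_eq_const)
    show "fr a s \<noteq> {}" using ne by blast
    fix p assume p: "p \<in> fr a s"
    obtain a' s' where p': "p = (a', s')" by fastforce
    have "(\<Union>(b', t')\<in>fr b t. fr (a' \<otimes> t' \<oplus> b' \<otimes> s') (s' \<otimes> t')) = fr (a \<otimes> t \<oplus> b \<otimes> s) (s \<otimes> t)"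
    proof (rule SUP_eq_const)
      show "fr b t \<noteq> {}" using ne by blast
      fix z assume z: "z \<in> fr b t"
      obtain b' t' where z': "z = (b', t')" by fastforce
      show "(case z of (b', t') \<Rightarrow> fr (a' \<otimes> t' \<oplus> b' \<otimes> s') (s' \<otimes> t')) = fr (a \<otimes> t \<oplus> b \<otimes> s) (s \<otimes> t)"
        using *[of a' s' b' t'] p p' z z' by simp
    qed
    then show "(case p of (a', s') \<Rightarrow> \<Union>(b', t')\<in>fr b t. fr (a' \<otimes> t' \<oplus> b' \<otimes> s') (s' \<otimes> t')) =
      fr (a \<otimes> t \<oplus> b \<otimes> s) (s \<otimes> t)" by (simp add: p')
  qed
  finally show ?thesis .
qed

lemma ract_fr:
  assumes c: "a \<in> carrier R" "s \<in> T" "r \<in> carrier R"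
  shows "fr a s \<star>\<^bsub>Loc\<^esub> r = fr (a \<otimes> r) s"
proof -
  have *: "fr (a' \<otimes> b) (s' \<otimes> t) = fr (a \<otimes> r) s" if as: "(a', s') \<in> fr a s" and bt: "(b, t) \<in> fr r \<one>" for a' s' b t
  proof -
    have as': "a' \<in> carrier R" "s' \<in> T" "fr a' s' = fr a s" using as in_fr_iff[OF c(1,2)] by auto
    have bt': "b \<in> carrier R" "t \<in> T" "fr b t = fr r \<one>" using bt in_fr_iff[OF c(3) one_T] by auto
    obtain u where u: "u \<in> T" "u \<otimes> (a' \<otimes> s) = u \<otimes> (a \<otimes> s')"
      using as'(3) fr_eq_iff[OF as'(1) c(1) as'(2) c(2)] by auto
    obtain v where v: "v \<in> T" "v \<otimes> b = v \<otimes> (r \<otimes> t)"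
      using bt'(3) fr_eq_iff[OF bt'(1) c(3) bt'(2) one_T] bt'(1) by auto
    note cc = c as'(1,2) bt'(1,2) u(1) v(1)
    have "u \<otimes> v \<otimes> (a' \<otimes> b \<otimes> s) = u \<otimes> (a' \<otimes> s) \<otimes> (v \<otimes> b)" using cc by (simp add: T_ac)
    also have "\<dots> = u \<otimes> v \<otimes> (a \<otimes> r \<otimes> (s' \<otimes> t))" unfolding u v using cc by (simp add: T_ac)
    finally show ?thesis using cc by (subst fr_eq_iff) (auto intro!: bexI[of _ "u \<otimes> v"])
  qed
  have ne: "(a, s) \<in> fr a s" "(r, \<one>) \<in> fr r \<one>" using c in_fr_iff by auto
  have "fr a s \<star>\<^bsub>Loc\<^esub> r = (\<Union>(a', s')\<in>fr a s. \<Union>(b, t)\<in>fr r \<one>. fr (a' \<otimes> b) (s' \<otimes> t))"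
    by (simp add: loc_rmodule_def localization_def ring.defs loc_map_def)
  also have "\<dots> = fr (a \<otimes> r) s"
  proof (rule SUP_eq_const)
    show "fr a s \<noteq> {}" using ne by blast
    fix p assume p: "p \<in> fr a s"
    obtain a' s' where p': "p = (a', s')" by fastforce
    have "(\<Union>(b, t)\<in>fr r \<one>. fr (a' \<otimes> b) (s' \<otimes> t)) = fr (a \<otimes> r) s"
    proof (rule SUP_eq_const)
      show "fr r \<one> \<noteq> {}" using ne by blast
      fix z assume z: "z \<in> fr r \<one>"
      obtain b t where z': "z = (b, t)" by fastforce
      show "(case z of (b, t) \<Rightarrow> fr (a' \<otimes> b) (s' \<otimes> t)) = fr (a \<otimes> r) s"
        using *[of a' s' b t] p p' z z' by simp
    qed
    then show "(case p of (a', s') \<Rightarrow> \<Union>(b, t)\<in>fr r \<one>. fr (a' \<otimes> b) (s' \<otimes> t)) = fr (a \<otimes> r) s"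
      by (simp add: p')
  qed
  finally show ?thesis .
qed

lemma right_module_L: "right_module R Loc"
proof -
  have "abelian_group Loc"
  proof (rule abelian_groupI)
    fix x assume "x \<in> carrier Loc"
    then obtain a s where x: "a \<in> carrier R" "s \<in> T" "x = fr a s" by (rule L_cases)
    show "\<zero>\<^bsub>Loc\<^esub> \<oplus>\<^bsub>Loc\<^esub> x = x" using x by (simp add: zero_L add_fr)
    have "fr (\<ominus> a) s \<oplus>\<^bsub>Loc\<^esub> x = fr ((\<ominus> a) \<otimes> s \<oplus> a \<otimes> s) (s \<otimes> s)" using x by (simp add: add_fr)
    also have "\<dots> = \<zero>\<^bsub>Loc\<^esub>"
      unfolding zero_L using x by (intro fr_eqI) (simp_all add: l_minus l_neg)
    finally show "\<exists>y\<in>carrier Loc. y \<oplus>\<^bsub>Loc\<^esub> x = \<zero>\<^bsub>Loc\<^esub>" by (rule bexI) (use x in \<open>simp add: fr_closed\<close>)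
    fix y assume "y \<in> carrier Loc"
    then obtain b t where y: "b \<in> carrier R" "t \<in> T" "y = fr b t" by (rule L_cases)
    show "x \<oplus>\<^bsub>Loc\<^esub> y \<in> carrier Loc" using x y by (simp add: add_fr fr_closed)
    show "x \<oplus>\<^bsub>Loc\<^esub> y = y \<oplus>\<^bsub>Loc\<^esub> x"
      using x y by (simp add: add_fr a_comm[of "a \<otimes> t"] T_comm[of s t])
    fix z assume "z \<in> carrier Loc"
    then obtain c r where z: "c \<in> carrier R" "r \<in> T" "z = fr c r" by (rule L_cases)
    show "x \<oplus>\<^bsub>Loc\<^esub> y \<oplus>\<^bsub>Loc\<^esub> z = x \<oplus>\<^bsub>Loc\<^esub> (y \<oplus>\<^bsub>Loc\<^esub> z)"
      using x y z by (simp add: add_fr) (intro fr_eqI; simp add: l_distr r_distr a_assoc T_ac)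
  qed (simp add: zero_L fr_closed)
  moreover have "right_module_axioms R Loc"
  proof (unfold_locales)
    fix x r assume xL: "x \<in> carrier Loc" and r: "r \<in> carrier R"
    obtain a s where x: "a \<in> carrier R" "s \<in> T" "x = fr a s" using xL by (rule L_cases)
    show "x \<star>\<^bsub>Loc\<^esub> r \<in> carrier Loc" using x r by (simp add: ract_fr fr_closed)
    fix r' assume r': "r' \<in> carrier R"
    show "x \<star>\<^bsub>Loc\<^esub> (r \<oplus> r') = x \<star>\<^bsub>Loc\<^esub> r \<oplus>\<^bsub>Loc\<^esub> x \<star>\<^bsub>Loc\<^esub> r'"
      using x r r' by (simp add: ract_fr add_fr) (intro fr_eqI; simp add: l_distr r_distr T_ac)
    show "x \<star>\<^bsub>Loc\<^esub> (r \<otimes> r') = x \<star>\<^bsub>Loc\<^esub> r \<star>\<^bsub>Loc\<^esub> r'"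
      using x r r' by (simp add: ract_fr m_assoc)
  next
    fix x y r assume xy: "x \<in> carrier Loc" "y \<in> carrier Loc" and r: "r \<in> carrier R"
    obtain a s where a: "a \<in> carrier R" "s \<in> T" "x = fr a s" using xy(1) by (rule L_cases)
    obtain b t where b: "b \<in> carrier R" "t \<in> T" "y = fr b t" using xy(2) by (rule L_cases)
    note x = a b
    show "(x \<oplus>\<^bsub>Loc\<^esub> y) \<star>\<^bsub>Loc\<^esub> r = x \<star>\<^bsub>Loc\<^esub> r \<oplus>\<^bsub>Loc\<^esub> y \<star>\<^bsub>Loc\<^esub> r"
      using x r by (simp add: ract_fr add_fr) (intro fr_eqI; simp add: l_distr r_distr T_ac)
  next
    fix x assume "x \<in> carrier Loc"
    then obtain a s where x: "a \<in> carrier R" "s \<in> T" "x = fr a s" by (rule L_cases)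
    then show "x \<star>\<^bsub>Loc\<^esub> \<one> = x" by (simp add: ract_fr)
  qed
  ultimately show ?thesis by (intro right_module.intro ring_axioms)
qed

abbreviation integral where "integral \<equiv> loc_map R T ` carrier R"

lemma rsubmodule_integral: "rsubmodule R integral Loc"
proof (rule rsubmoduleI[OF right_module_L])
  show "integral \<subseteq> carrier Loc" by (auto simp: loc_map_def fr_closed)
  show "\<zero>\<^bsub>Loc\<^esub> \<in> integral" by (auto simp: loc_map_def zero_L)
  fix x a assume "x \<in> integral" and a: "a \<in> carrier R"
  then obtain b where b: "b \<in> carrier R" "x = fr b \<one>" by (auto simp: loc_map_def)
  then show "x \<star>\<^bsub>Loc\<^esub> a \<in> integral" using a by (auto simp: ract_fr loc_map_def)
next
  fix x y assume "x \<in> integral" "y \<in> integral"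
  then obtain a b where "a \<in> carrier R" "x = fr a \<one>" "b \<in> carrier R" "y = fr b \<one>" by (auto simp: loc_map_def)
  then show "x \<oplus>\<^bsub>Loc\<^esub> y \<in> integral" by (auto simp: add_fr loc_map_def)
qed

text \<open>The relations among the classes of unit fractions are read off from equality of fractions: the
  class of \<open>a/s\<close> vanishes if and only if \<open>a/s = c/1\<close> for some \<open>c\<close>.\<close>

lemma loc_cokernel_unit_fractions:
  "unit_fractions R (loc_cokernel R T) T (\<lambda>s. integral +>\<^bsub>Loc\<^esub> fr \<one> s)"
proof -
  interpret Loc: right_module R Loc by (rule right_module_L)
  interpret Q: quotient_of_rmodule R Loc integral
    by (intro quotient_of_rmodule.intro right_module_L quotient_of_rmodule_axioms.intro rsubmodule_integral)
  have Q: "loc_cokernel R T = quotient_rmodule Loc integral" by (simp add: loc_cokernel_def)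
  have act: "(integral +>\<^bsub>Loc\<^esub> fr \<one> s) \<star>\<^bsub>loc_cokernel R T\<^esub> a = integral +>\<^bsub>Loc\<^esub> fr a s" if "s \<in> T" "a \<in> carrier R" for s a
    using that by (simp add: Q Q.coset_ract fr_closed ract_fr)
  show ?thesis
  proof (intro unit_fractions.intro unit_fractions_axioms.intro central_subset_axioms)
    show "right_module R (loc_cokernel R T)" unfolding Q by (rule Q.quotient_right_module)
    fix s assume s: "s \<in> T"
    show "integral +>\<^bsub>Loc\<^esub> fr \<one> s \<in> carrier (loc_cokernel R T)"
      using s by (simp add: Q Q.coset_carrier fr_closed)
    show "(integral +>\<^bsub>Loc\<^esub> fr \<one> (s \<otimes> u)) \<star>\<^bsub>loc_cokernel R T\<^esub> u = integral +>\<^bsub>Loc\<^esub> fr \<one> s" if u: "u \<in> T" for u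
    proof -
      have "fr u (s \<otimes> u) = fr \<one> s" using s u by (intro fr_eqI) (simp_all add: T_comm)
      then show ?thesis using act[of "s \<otimes> u" u] s u by simp
    qed
    fix a assume a: "a \<in> carrier R"
    have "(integral +>\<^bsub>Loc\<^esub> fr \<one> s) \<star>\<^bsub>loc_cokernel R T\<^esub> a = \<zero>\<^bsub>loc_cokernel R T\<^esub> \<longleftrightarrow> fr a s \<in> integral"
      unfolding act[OF s a] using Q.coset_eq_H_iff[OF fr_closed[OF a s]] by (simp add: Q)
    also have "\<dots> \<longleftrightarrow> (\<exists>c\<in>carrier R. fr a s = fr c \<one>)" by (auto simp: loc_map_def)
    also have "\<dots> \<longleftrightarrow> (\<exists>c\<in>carrier R. \<exists>u\<in>T. a \<otimes> u = c \<otimes> s \<otimes> u)"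
      using a s by (intro bex_cong refl) (simp add: fr_eq_iff T_comm[of _ a] T_comm[of _ "_ \<otimes> s"] cong: bex_cong)
    finally show "(integral +>\<^bsub>Loc\<^esub> fr \<one> s) \<star>\<^bsub>loc_cokernel R T\<^esub> a = \<zero>\<^bsub>loc_cokernel R T\<^esub> \<longleftrightarrow>
      (\<exists>u\<in>T. \<exists>c\<in>carrier R. a \<otimes> u = c \<otimes> s \<otimes> u)" by blast
  next
    fix m assume "m \<in> carrier (loc_cokernel R T)"
    then obtain a s where "a \<in> carrier R" "s \<in> T" "m = integral +>\<^bsub>Loc\<^esub> fr a s"
      by (auto simp: Q Q.coset_carrier elim!: L_cases)
    then show "\<exists>s\<in>T. \<exists>a\<in>carrier R. m = (integral +>\<^bsub>Loc\<^esub> fr \<one> s) \<star>\<^bsub>loc_cokernel R T\<^esub> a"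
      using act by metis
  qed
qed

end

section \<open>Transport of modules and of direct systems\<close>

text \<open>The module structure on the image of an injective map that makes the map an isomorphism.\<close>

definition image_rmodule :: "('a \<Rightarrow> 'u) \<Rightarrow> ('r, 'a) rmodule \<Rightarrow> ('r, 'u) rmodule"
  where "image_rmodule g A =
    \<lparr>carrier = g ` carrier A, mult = undefined, one = undefined, zero = g \<zero>\<^bsub>A\<^esub>,
     add = (\<lambda>x y. g (inv_into (carrier A) g x \<oplus>\<^bsub>A\<^esub> inv_into (carrier A) g y)),
     ract = (\<lambda>x a. g (inv_into (carrier A) g x \<star>\<^bsub>A\<^esub> a))\<rparr>"

lemma image_rmodule:
  assumes A: "right_module R A" and g: "inj_on g (carrier A)"
  shows "right_module R (image_rmodule g A)"
    and "g \<in> rmod_hom R A (image_rmodule g A)"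
    and "inv_into (carrier A) g \<in> rmod_hom R (image_rmodule g A) A"
proof -
  interpret A: right_module R A by fact
  let ?B = "image_rmodule g A"
  have c: "carrier ?B = g ` carrier A" and z: "\<zero>\<^bsub>?B\<^esub> = g \<zero>\<^bsub>A\<^esub>" by (simp_all add: image_rmodule_def)
  have add: "g x \<oplus>\<^bsub>?B\<^esub> g y = g (x \<oplus>\<^bsub>A\<^esub> y)" if "x \<in> carrier A" "y \<in> carrier A" for x y
    using that g by (simp add: image_rmodule_def)
  have act: "g x \<star>\<^bsub>?B\<^esub> a = g (x \<star>\<^bsub>A\<^esub> a)" if "x \<in> carrier A" for x a
    using that g by (simp add: image_rmodule_def)
  have "abelian_group ?B"
  proof (rule abelian_groupI)
    fix x assume "x \<in> carrier ?B"
    then obtain x' where x: "x' \<in> carrier A" "x = g x'" by (auto simp: c)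
    show "\<zero>\<^bsub>?B\<^esub> \<oplus>\<^bsub>?B\<^esub> x = x" using x by (simp add: z add)
    have "g (\<ominus>\<^bsub>A\<^esub> x') \<oplus>\<^bsub>?B\<^esub> x = \<zero>\<^bsub>?B\<^esub>" using x by (simp add: z add A.M.l_neg)
    then show "\<exists>y\<in>carrier ?B. y \<oplus>\<^bsub>?B\<^esub> x = \<zero>\<^bsub>?B\<^esub>" by (rule bexI) (use x in \<open>simp add: c\<close>)
    fix y assume "y \<in> carrier ?B"
    then obtain y' where y: "y' \<in> carrier A" "y = g y'" by (auto simp: c)
    show "x \<oplus>\<^bsub>?B\<^esub> y \<in> carrier ?B" using x y by (simp add: add, simp add: c)
    show "x \<oplus>\<^bsub>?B\<^esub> y = y \<oplus>\<^bsub>?B\<^esub> x" using x y by (simp add: add A.M.a_comm)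
    fix w assume "w \<in> carrier ?B"
    then obtain w' where w: "w' \<in> carrier A" "w = g w'" by (auto simp: c)
    show "x \<oplus>\<^bsub>?B\<^esub> y \<oplus>\<^bsub>?B\<^esub> w = x \<oplus>\<^bsub>?B\<^esub> (y \<oplus>\<^bsub>?B\<^esub> w)" using x y w by (simp add: add A.M.a_assoc)
  qed (simp add: c z)
  moreover have "right_module_axioms R ?B"
    by unfold_locales (auto simp: c add act A.ract_l_distr A.ract_r_distr A.ract_assoc)
  ultimately show "right_module R ?B" by (intro right_module.intro A.R.ring_axioms)
  show h: "g \<in> rmod_hom R A ?B" by (rule rmod_homI) (simp_all add: c add act)
  show "inv_into (carrier A) g \<in> rmod_hom R ?B A"
    by (rule rmod_hom_inv_into[OF A h]) (simp add: c bij_betw_def g)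
qed

lemma transport_direct_system:
  fixes P :: "'p set" and G :: "'p \<Rightarrow> ('r, 'a) rmodule" and c :: "'p \<Rightarrow> 'u" and g :: "'p \<Rightarrow> 'a \<Rightarrow> 'u"
  assumes sys: "direct_system R P r G f" and coc: "dirlim_cocone R P r G f N \<phi>"
    and c: "inj_on c P" and g: "\<And>p. p \<in> P \<Longrightarrow> inj_on (g p) (carrier (G p))"
  shows "\<exists>r' D' f' \<phi>'. direct_system R (c ` P) r' D' f' \<and> dirlim_cocone R (c ` P) r' D' f' N \<phi>' \<and>
    (\<forall>p\<in>P. D' (c p) = image_rmodule (g p) (G p))"
proof -
  interpret S: directed_system R P r G f by unfold_locales (rule sys)
  define d where "d = inv_into P c"
  have dc [simp]: "d (c p) = p" if "p \<in> P" for p using that c by (simp add: d_def)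
  define r' where "r' = (\<lambda>(p, q). (c p, c q)) ` r"
  define b where "b p = inv_into (carrier (G p)) (g p)" for p
  define D' where "D' i = image_rmodule (g (d i)) (G (d i))" for i
  define f' where "f' i j x = g (d j) (f (d i) (d j) (b (d i) x))" for i j x
  define \<phi>' where "\<phi>' i x = \<phi> (d i) (b (d i) x)" for i x
  have r'_iff: "(c p, c q) \<in> r' \<longleftrightarrow> (p, q) \<in> r" if "p \<in> P" "q \<in> P" for p q
  proof
    assume "(c p, c q) \<in> r'"
    then obtain p' q' where pq: "(p', q') \<in> r" "c p = c p'" "c q = c q'" by (auto simp: r'_def)
    then have "p = p'" "q = q'" using S.in_index[OF pq(1)] that c by (auto dest: inj_onD)
    then show "(p, q) \<in> r" using pq(1) by simp
  qed (auto simp: r'_def)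
  have r'_cases: "\<exists>p q. i = c p \<and> j = c q \<and> (p, q) \<in> r \<and> p \<in> P \<and> q \<in> P" if "(i, j) \<in> r'" for i j
    using that S.in_index by (auto simp: r'_def)
  have D': "D' (c p) = image_rmodule (g p) (G p)" if "p \<in> P" for p using that by (simp add: D'_def)
  note im = image_rmodule[OF S.modules g]
  have gh: "g p \<in> rmod_hom R (G p) (D' (c p))" and bh: "b p \<in> rmod_hom R (D' (c p)) (G p)" if "p \<in> P" for p
    using im(2,3)[OF that that] that by (simp_all add: D' b_def)
  have bg: "b p (g p x) = x" if "p \<in> P" "x \<in> carrier (G p)" for p x
    using g that by (simp add: b_def)
  have gb: "g p (b p x) = x" if "p \<in> P" "x \<in> carrier (D' (c p))" for p x
    using that by (simp add: b_def D' image_rmodule_def f_inv_into_f)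
  have mod: "right_module R (D' (c p))" if "p \<in> P" for p using im(1)[OF that that] D'[OF that] by simp
  have "direct_system R (c ` P) r' D' f'"
    unfolding direct_system_def
  proof (intro conjI ballI allI impI)
    show "directed_poset (c ` P) r'"
      unfolding directed_poset_def partial_order_on_def preorder_on_def
    proof (intro conjI ballI)
      show "r' \<subseteq> c ` P \<times> c ` P" using S.in_index by (auto simp: r'_def)
      show "refl_on (c ` P) r'" by (rule refl_onI) (auto simp: r'_iff S.idx_refl)
      show "trans r'"
      proof (rule transI)
        fix i j k assume ij: "(i, j) \<in> r'" and jk: "(j, k) \<in> r'"
        obtain p q where p: "i = c p" "j = c q" "(p, q) \<in> r" "p \<in> P" "q \<in> P" using r'_cases[OF ij] by blast
        obtain s where s: "k = c s" "s \<in> P" using r'_cases[OF jk] by blast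
        have "(q, s) \<in> r" using jk p s r'_iff by simp
        then show "(i, k) \<in> r'" using p s r'_iff S.idx_trans by blast
      qed
      show "antisym r'"
      proof (rule antisymI)
        fix i j assume ij: "(i, j) \<in> r'" and ji: "(j, i) \<in> r'"
        obtain p q where p: "i = c p" "j = c q" "(p, q) \<in> r" "p \<in> P" "q \<in> P" using r'_cases[OF ij] by blast
        have "(q, p) \<in> r" using ji p r'_iff by simp
        moreover have "antisym r" using sys by (simp add: direct_system_def directed_poset_def partial_order_on_def)
        ultimately show "i = j" using p by (auto dest: antisymD)
      qed
      show "c ` P \<noteq> {}" using sys by (auto simp: direct_system_def directed_poset_def)
      fix i j assume "i \<in> c ` P" "j \<in> c ` P"
      then obtain p q where p: "p \<in> P" "i = c p" "q \<in> P" "j = c q" by blast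
      obtain k where "(p, k) \<in> r" "(q, k) \<in> r" using S.upper_bound[OF p(1,3)] by blast
      then show "\<exists>k. (i, k) \<in> r' \<and> (j, k) \<in> r'" using p by (auto simp: r'_def)
    qed
    show "right_module R (D' i)" if "i \<in> c ` P" for i using that mod by blast
    fix z assume z: "z \<in> r'"
    obtain i j where zij: "z = (i, j)" by fastforce
    obtain p q where p: "i = c p" "j = c q" "(p, q) \<in> r" "p \<in> P" "q \<in> P" using r'_cases z zij by blast
    have "f' i j \<in> rmod_hom R (D' i) (D' j)"
      unfolding f'_def p(1,2) dc[OF p(4)] dc[OF p(5)]
      by (rule rmod_hom_comp[OF rmod_hom_comp[OF bh[OF p(4)] S.maps[OF p(3)]] gh[OF p(5)]])
    then show "case z of (i, j) \<Rightarrow> f' i j \<in> rmod_hom R (D' i) (D' j)" by (simp add: zij)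
  next
    fix i x assume "i \<in> c ` P" "x \<in> carrier (D' i)"
    then obtain p where p: "p \<in> P" "i = c p" "x \<in> carrier (D' (c p))" by blast
    show "f' i i x = x"
      using p(1,2) S.map_id[OF p(1) rmod_homD(1)[OF bh[OF p(1)] p(3)]] gb[OF p(1,3)] by (simp add: f'_def)
  next
    fix i j k x assume ij: "(i, j) \<in> r'" and jk: "(j, k) \<in> r'" and x: "x \<in> carrier (D' i)"
    obtain p q where p: "i = c p" "j = c q" "(p, q) \<in> r" "p \<in> P" "q \<in> P" using r'_cases[OF ij] by blast
    obtain s where s: "k = c s" "s \<in> P" using r'_cases[OF jk] by blast
    have qs: "(q, s) \<in> r" using jk p s r'_iff by simp
    have bx: "b p x \<in> carrier (G p)" using rmod_homD(1)[OF bh[OF p(4)]] x p(1) by simp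
    show "f' j k (f' i j x) = f' i k x"
      using S.map_comp[OF p(3) qs bx] bg[OF p(5) S.map_closed[OF p(3) bx]] p(1,2,4,5) s by (simp add: f'_def)
  qed
  moreover have "dirlim_cocone R (c ` P) r' D' f' N \<phi>'"
    unfolding dirlim_cocone_def
  proof (intro conjI ballI impI)
    fix i assume "i \<in> c ` P"
    then obtain p where p: "p \<in> P" "i = c p" by blast
    show "\<phi>' i \<in> rmod_hom R (D' i) N"
      unfolding \<phi>'_def p(2) dc[OF p(1)] by (rule rmod_hom_comp[OF bh[OF p(1)] dirlim_coconeD(1)[OF coc p(1)]])
    fix x assume x: "x \<in> carrier (D' i)" and 0: "\<phi>' i x = \<zero>\<^bsub>N\<^esub>"
    have bx: "b p x \<in> carrier (G p)" using rmod_homD(1)[OF bh[OF p(1)]] x p(2) by simp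
    obtain q where q: "(p, q) \<in> r" "f p q (b p x) = \<zero>\<^bsub>G q\<^esub>"
      using dirlim_coconeD(4)[OF coc p(1) bx] 0 p by (auto simp: \<phi>'_def)
    have qP: "q \<in> P" using S.in_index[OF q(1)] by simp
    have "f' i (c q) x = \<zero>\<^bsub>D' (c q)\<^esub>"
      using q(2) p qP rmod_hom_zero[OF gh[OF qP] S.modules[OF qP] mod[OF qP]] by (simp add: f'_def)
    then show "\<exists>j. (i, j) \<in> r' \<and> f' i j x = \<zero>\<^bsub>D' j\<^esub>" using q(1) p(2) by (auto simp: r'_def)
  next
    fix z assume z: "z \<in> r'"
    obtain i j where zij: "z = (i, j)" by fastforce
    obtain p q where p: "i = c p" "j = c q" "(p, q) \<in> r" "p \<in> P" "q \<in> P" using r'_cases z zij by blast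
    have "\<phi>' j (f' i j x) = \<phi>' i x" if x: "x \<in> carrier (D' i)" for x
    proof -
      have bx: "b p x \<in> carrier (G p)" using rmod_homD(1)[OF bh[OF p(4)]] x p(1) by simp
      show ?thesis
        using dirlim_coconeD(2)[OF coc p(3) bx] bg[OF p(5) S.map_closed[OF p(3) bx]] p by (simp add: \<phi>'_def f'_def)
    qed
    then show "case z of (i, j) \<Rightarrow> \<forall>x\<in>carrier (D' i). \<phi>' j (f' i j x) = \<phi>' i x" by (simp add: zij)
  next
    fix y assume "y \<in> carrier N"
    then obtain p x where p: "p \<in> P" and x: "x \<in> carrier (G p)" "\<phi> p x = y" using dirlim_coconeD(3)[OF coc] by blast
    have "\<phi>' (c p) (g p x) = y" using p x bg[OF p x(1)] by (simp add: \<phi>'_def)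
    then show "\<exists>i\<in>c ` P. \<exists>x\<in>carrier (D' i). \<phi>' i x = y" using p rmod_homD(1)[OF gh[OF p] x(1)] by blast
  qed
  ultimately show ?thesis using D' by blast
qed

section \<open>Codes in the universe\<close>

text \<open>The type \<open>('r, 'v) univ\<close> has injective codes for natural numbers, ring elements, and
  sequences and finite sets of its own members. For sequences the natural number in each triple absorbs the
  index.\<close>

definition code_nat :: "nat \<Rightarrow> ('r, 'v) univ"
  where "code_nat n = UNIV \<times> {n} \<times> UNIV"

definition code_scalar :: "'r \<Rightarrow> ('r, 'v) univ"
  where "code_scalar r = {r} \<times> UNIV \<times> UNIV"

definition code_seq :: "(nat \<Rightarrow> ('r, 'v) univ) \<Rightarrow> ('r, 'v) univ"
  where "code_seq F = {(r, m, v). (r, snd (prod_decode m), v) \<in> F (fst (prod_decode m))}"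

definition code_pair :: "('r, 'v) univ \<Rightarrow> ('r, 'v) univ \<Rightarrow> ('r, 'v) univ"
  where "code_pair x y = code_seq (\<lambda>n. if n = 0 then x else y)"

definition code_list :: "('r, 'v) univ list \<Rightarrow> ('r, 'v) univ"
  where "code_list xs = code_pair (code_nat (length xs)) (code_seq (\<lambda>n. if n < length xs then xs ! n else {}))"

definition code_finite :: "('r, 'v) univ set \<Rightarrow> ('r, 'v) univ"
  where "code_finite A = code_list (SOME xs. set xs = A)"

lemma code_nat_eq [simp]: "code_nat m = code_nat n \<longleftrightarrow> m = n"
  by (auto simp: code_nat_def times_eq_iff)

lemma code_scalar_eq [simp]: "code_scalar r = code_scalar s \<longleftrightarrow> r = s"
  by (auto simp: code_scalar_def times_eq_iff)

lemma code_seq_eq [simp]: "code_seq F = code_seq F' \<longleftrightarrow> F = F'"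
proof
  assume eq: "code_seq F = code_seq F'"
  have "F k = {(r, n, v). (r, prod_encode (k, n), v) \<in> code_seq F}" for F :: "nat \<Rightarrow> ('r, 'v) univ" and k
    by (auto simp: code_seq_def)
  then show "F = F'" using eq by (metis (no_types, lifting) ext)
qed simp

lemma code_pair_eq [simp]: "code_pair x y = code_pair x' y' \<longleftrightarrow> x = x' \<and> y = y'"
  unfolding code_pair_def code_seq_eq by (auto simp: fun_eq_iff split: if_splits)

lemma code_list_eq: "code_list xs = code_list ys \<Longrightarrow> xs = ys"
proof (rule nth_equalityI)
  assume eq: "code_list xs = code_list ys"
  then show len: "length xs = length ys" by (simp add: code_list_def)
  fix i assume "i < length xs"
  then show "xs ! i = ys ! i" using eq len by (auto simp: code_list_def fun_eq_iff split: if_splits)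
qed

lemma code_finite_eq:
  assumes "finite A" "finite B" "code_finite A = code_finite B" shows "A = B"
proof -
  have "set (SOME xs. set xs = C) = C" if "finite C" for C :: "('r, 'v) univ set"
    using someI_ex[OF finite_list[OF that]] .
  then show ?thesis using assms code_list_eq unfolding code_finite_def by metis
qed

section \<open>Replacing infinite by finite direct sums in a direct limit\<close>

text \<open>A direct limit \<open>N\<close> of summands \<open>D i\<close> of direct sums of copies of \<open>M\<close> over arbitrary index
  sets \<open>X i\<close>.\<close>

locale limit_of_summands = unit_fractions R M T e + directed_system R I r D f
  for R :: "('r, 'k) ring_scheme" (structure) and M :: "('r, 'm) rmodule" and T e
    and I :: "'i set" and r and D :: "'i \<Rightarrow> ('r, 'd) rmodule" and f +
  fixes N :: "('r, 'n) rmodule" and \<phi> and X :: "'i \<Rightarrow> 'x set"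
  assumes noeth: "left_noetherian R" and count: "countable T"
    and N: "right_module R N" and cocone: "dirlim_cocone R I r D f N \<phi>"
    and summands: "i \<in> I \<Longrightarrow> is_direct_summand R (D i) (direct_sum_copies (X i) M)"
begin

text \<open>The objects stand for the elements \<open>(h\<^sub>1, \<dots>, h\<^sub>n)\<close> of finite powers of
  \<open>lim Hom(M, D i)\<close>, and the arrows are the matrices that carry one tuple to another. An arrow only has to be
  compatible with the two homomorphisms after passing to a common later stage \<open>k\<close>.\<close>

definition objects :: "(nat \<times> 'i \<times> ((nat \<Rightarrow> 'm) \<Rightarrow> 'd)) set"
  where "objects = {(n, i, h). i \<in> I \<and> h \<in> rmod_hom R (Mn n) (D i) \<and> h \<in> extensional (carrier (Mn n))}"

definition arrows :: "nat \<times> 'i \<times> ((nat \<Rightarrow> 'm) \<Rightarrow> 'd) \<Rightarrow> nat \<times> 'i \<times> ((nat \<Rightarrow> 'm) \<Rightarrow> 'd) \<Rightarrow> ((nat \<Rightarrow> 'm) \<Rightarrow> nat \<Rightarrow> 'm) set"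
  where "arrows = (\<lambda>(n, i, h) (n', i', h'). {\<beta> \<in> linear_maps n n'.
    \<exists>k. (i, k) \<in> r \<and> (i', k) \<in> r \<and> (\<forall>x\<in>carrier (Mn n). f i k (h x) = f i' k (h' (\<beta> x)))})"

lemma arrowsI:
  assumes "\<beta> \<in> linear_maps n n'" "(i, k) \<in> r" "(i', k) \<in> r"
    and "\<And>x. x \<in> carrier (Mn n) \<Longrightarrow> f i k (h x) = f i' k (h' (\<beta> x))"
  shows "\<beta> \<in> arrows (n, i, h) (n', i', h')"
  using assms by (auto simp: arrows_def)

lemma summand_instance:
  assumes "i \<in> I"
  shows "\<exists>\<iota> \<pi>. summand_of_copies R M T e (X i) (D i) \<iota> \<pi>"
proof -
  from summands[OF assms, unfolded is_direct_summand_iff_retract[OF modules[OF assms] Ms.right_module_axioms]]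
  obtain \<iota> \<pi> where "\<iota> \<in> rmod_hom R (D i) (Ms (X i))" "\<pi> \<in> rmod_hom R (Ms (X i)) (D i)"
    "\<And>d. d \<in> carrier (D i) \<Longrightarrow> \<pi> (\<iota> d) = d" by blast
  then have "summand_of_copies_axioms R M T (X i) (D i) \<iota> \<pi>"
    using noeth count modules[OF assms] by (intro summand_of_copies_axioms.intro)
  then show ?thesis
    using summand_of_copies.intro[OF unit_fractions_axioms] by blast
qed

lemma object_restrict:
  assumes "i \<in> I" "h \<in> rmod_hom R (Mn n) (D i)"
  shows "(n, i, restrict h (carrier (Mn n))) \<in> objects"
  using assms rmod_hom_cong[OF Ms.right_module_axioms assms(2)] by (auto simp: objects_def)

lemma push_forward: "\<lbrakk>h \<in> rmod_hom R (Mn n) (D i); (i, k) \<in> r\<rbrakk> \<Longrightarrow> (\<lambda>x. f i k (h x)) \<in> rmod_hom R (Mn n) (D k)"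
  by (rule rmod_hom_comp[OF _ maps])

text \<open>Compatibility at one stage persists at all later ones.\<close>

lemma arrow_at:
  assumes a: "(n, i, h) \<in> objects" and b: "(n', i', h') \<in> objects"
    and \<beta>: "\<beta> \<in> arrows (n, i, h) (n', i', h')"
  shows "\<exists>k. (i, k) \<in> r \<and> (i', k) \<in> r \<and>
    (\<forall>l. (k, l) \<in> r \<longrightarrow> (\<forall>x\<in>carrier (Mn n). f i l (h x) = f i' l (h' (\<beta> x))))"
proof -
  obtain k where k: "(i, k) \<in> r" "(i', k) \<in> r" and eq: "\<And>x. x \<in> carrier (Mn n) \<Longrightarrow> f i k (h x) = f i' k (h' (\<beta> x))"
    and lin: "\<beta> \<in> linear_maps n n'"
    using \<beta> by (auto simp: arrows_def)
  have hc: "h \<in> rmod_hom R (Mn n) (D i)" and hc': "h' \<in> rmod_hom R (Mn n') (D i')"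
    using a b by (auto simp: objects_def)
  have "f i l (h x) = f i' l (h' (\<beta> x))" if l: "(k, l) \<in> r" and x: "x \<in> carrier (Mn n)" for l x
    using map_comp[OF k(1) l rmod_homD(1)[OF hc x]] eq[OF x]
      map_comp[OF k(2) l rmod_homD(1)[OF hc' rmod_homD(1)[OF linear_mapsD(1)[OF lin] x]]] by simp
  then show ?thesis using k by blast
qed

text \<open>Arrows are equalized by \<open>factor_relation\<close> and elements vanishing in \<open>N\<close> are killed by
  \<open>factor_kill\<close>, both applied to the module \<open>D k\<close> at a stage \<open>k\<close> where the relation holds.\<close>

lemma filtered: "filtered_presentation R N objects (\<lambda>(n, i, h). Mn n) arrows (\<lambda>(n, i, h) x. \<phi> i (h x))"
proof (rule filtered_presentation.intro, unfold split_paired_all prod.case)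
  show "right_module R N" by (rule N)
  fix n i h assume a: "(n, i, h) \<in> objects"
  have i: "i \<in> I" and h: "h \<in> rmod_hom R (Mn n) (D i)" and hext: "h \<in> extensional (carrier (Mn n))"
    using a by (auto simp: objects_def)
  show "right_module R (Mn n)" by (rule Ms.right_module_axioms)
  show "(\<lambda>x\<in>carrier (Mn n). x) \<in> arrows (n, i, h) (n, i, h)"
    by (rule arrowsI[OF linear_maps_id idx_refl[OF i] idx_refl[OF i]]) simp
  show "(\<lambda>x. \<phi> i (h x)) \<in> rmod_hom R (Mn n) N"
    by (rule rmod_hom_comp[OF h dirlim_coconeD(1)[OF cocone i]])
  {
    fix x assume x: "x \<in> carrier (Mn n)" and 0: "\<phi> i (h x) = \<zero>\<^bsub>N\<^esub>"
    obtain j where j: "(i, j) \<in> r" "f i j (h x) = \<zero>\<^bsub>D j\<^esub>"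
      using dirlim_coconeD(4)[OF cocone i rmod_homD(1)[OF h x] 0] by blast
    have jI: "j \<in> I" using in_index[OF j(1)] by simp
    obtain \<iota> \<pi> where S: "summand_of_copies R M T e (X j) (D j) \<iota> \<pi>"
      using summand_instance[OF jI] by blast
    obtain p \<Gamma> k where \<Gamma>: "\<Gamma> \<in> linear_maps n p" and k: "k \<in> rmod_hom R (Mn p) (D j)"
      and hk: "\<And>x. x \<in> carrier (Mn n) \<Longrightarrow> f i j (h x) = k (\<Gamma> x)" and \<Gamma>x: "\<Gamma> x = \<zero>\<^bsub>Mn p\<^esub>"
      using summand_of_copies.factor_kill[OF S push_forward[OF h j(1)] x j(2)] by blast
    have "\<Gamma> \<in> arrows (n, i, h) (p, j, restrict k (carrier (Mn p)))"
    proof (rule arrowsI[OF \<Gamma> j(1) idx_refl[OF jI]])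
      fix x assume x: "x \<in> carrier (Mn n)"
      note \<Gamma>c = rmod_homD(1)[OF linear_mapsD(1)[OF \<Gamma>] x]
      show "f i j (h x) = f j j (restrict k (carrier (Mn p)) (\<Gamma> x))"
        using hk[OF x] map_id[OF jI rmod_homD(1)[OF k \<Gamma>c]] \<Gamma>c by simp
    qed
    then show "\<exists>b\<in>objects. \<exists>u\<in>arrows (n, i, h) b. u x = \<zero>\<^bsub>(case b of (n, i, h) \<Rightarrow> Mn n)\<^esub>"
      using object_restrict[OF jI k] \<Gamma>x by (intro bexI[of _ "(p, j, restrict k (carrier (Mn p)))"] bexI[of _ \<Gamma>]) simp_all
  }
  fix n' i' h' assume b: "(n', i', h') \<in> objects"
  have i': "i' \<in> I" and h': "h' \<in> rmod_hom R (Mn n') (D i')" using b by (auto simp: objects_def)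
  {
    obtain k where k: "(i, k) \<in> r" "(i', k) \<in> r" using upper_bound[OF i i'] by blast
    have kI: "k \<in> I" using in_index[OF k(1)] by simp
    obtain \<iota> \<iota>' g where \<iota>: "\<iota> \<in> linear_maps n (n + n')" and \<iota>': "\<iota>' \<in> linear_maps n' (n + n')"
      and g: "g \<in> rmod_hom R (Mn (n + n')) (D k)"
      and g\<iota>: "\<And>x. x \<in> carrier (Mn n) \<Longrightarrow> g (\<iota> x) = f i k (h x)"
      and g\<iota>': "\<And>x. x \<in> carrier (Mn n') \<Longrightarrow> g (\<iota>' x) = f i' k (h' x)"
      using linear_join[OF modules[OF kI] push_forward[OF h k(1)] push_forward[OF h' k(2)]] by blast
    let ?g = "restrict g (carrier (Mn (n + n')))"
    have "\<iota> \<in> arrows (n, i, h) (n + n', k, ?g)"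
    proof (rule arrowsI[OF \<iota> k(1) idx_refl[OF kI]])
      fix x assume x: "x \<in> carrier (Mn n)"
      note \<iota>c = rmod_homD(1)[OF linear_mapsD(1)[OF \<iota>] x]
      show "f i k (h x) = f k k (?g (\<iota> x))" using g\<iota>[OF x] map_id[OF kI rmod_homD(1)[OF g \<iota>c]] \<iota>c by simp
    qed
    moreover have "\<iota>' \<in> arrows (n', i', h') (n + n', k, ?g)"
    proof (rule arrowsI[OF \<iota>' k(2) idx_refl[OF kI]])
      fix x assume x: "x \<in> carrier (Mn n')"
      note \<iota>c = rmod_homD(1)[OF linear_mapsD(1)[OF \<iota>'] x]
      show "f i' k (h' x) = f k k (?g (\<iota>' x))" using g\<iota>'[OF x] map_id[OF kI rmod_homD(1)[OF g \<iota>c]] \<iota>c by simp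
    qed
    ultimately show "\<exists>c\<in>objects. arrows (n, i, h) c \<noteq> {} \<and> arrows (n', i', h') c \<noteq> {}"
      using object_restrict[OF kI g] by blast
  }
  {
    fix u v assume u: "u \<in> arrows (n, i, h) (n', i', h')" and v: "v \<in> arrows (n, i, h) (n', i', h')"
    have uv: "u \<in> linear_maps n n'" "v \<in> linear_maps n n'" using u v by (auto simp: arrows_def)
    obtain k1 where k1: "(i', k1) \<in> r" "\<And>l x. \<lbrakk>(k1, l) \<in> r; x \<in> carrier (Mn n)\<rbrakk> \<Longrightarrow> f i l (h x) = f i' l (h' (u x))"
      using arrow_at[OF a b u] by blast
    obtain k2 where k2: "(i', k2) \<in> r" "\<And>l x. \<lbrakk>(k2, l) \<in> r; x \<in> carrier (Mn n)\<rbrakk> \<Longrightarrow> f i l (h x) = f i' l (h' (v x))"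
      using arrow_at[OF a b v] by blast
    obtain k where k: "(k1, k) \<in> r" "(k2, k) \<in> r" using upper_bound in_index k1(1) k2(1) by meson
    have i'k: "(i', k) \<in> r" by (rule idx_trans[OF k1(1) k(1)])
    have kI: "k \<in> I" using in_index[OF k(1)] by simp
    obtain \<iota> \<pi> where S: "summand_of_copies R M T e (X k) (D k) \<iota> \<pi>"
      using summand_instance[OF kI] by blast
    have "f i' k (h' (u x)) = f i' k (h' (v x))" if "x \<in> carrier (Mn n)" for x
      using k1(2)[OF k(1) that] k2(2)[OF k(2) that] by simp
    from summand_of_copies.factor_relation[OF S uv push_forward[OF h' i'k] this]
    obtain p \<Gamma> g where \<Gamma>: "\<Gamma> \<in> linear_maps n' p" and g: "g \<in> rmod_hom R (Mn p) (D k)"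
      and hg: "\<And>x. x \<in> carrier (Mn n') \<Longrightarrow> f i' k (h' x) = g (\<Gamma> x)"
      and \<Gamma>uv: "\<And>x. x \<in> carrier (Mn n) \<Longrightarrow> \<Gamma> (u x) = \<Gamma> (v x)" by blast
    have "\<Gamma> \<in> arrows (n', i', h') (p, k, restrict g (carrier (Mn p)))"
    proof (rule arrowsI[OF \<Gamma> i'k idx_refl[OF kI]])
      fix x assume x: "x \<in> carrier (Mn n')"
      note \<Gamma>c = rmod_homD(1)[OF linear_mapsD(1)[OF \<Gamma>] x]
      show "f i' k (h' x) = f k k (restrict g (carrier (Mn p)) (\<Gamma> x))"
        using hg[OF x] map_id[OF kI rmod_homD(1)[OF g \<Gamma>c]] \<Gamma>c by simp
    qed
    then show "\<exists>c\<in>objects. \<exists>w\<in>arrows (n', i', h') c. \<forall>x\<in>carrier (Mn n). w (u x) = w (v x)"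
      using object_restrict[OF kI g] \<Gamma>uv by blast
  }
  fix u assume u: "u \<in> arrows (n, i, h) (n', i', h')"
  have ul: "u \<in> linear_maps n n'" using u by (auto simp: arrows_def)
  note uc = rmod_homD(1)[OF linear_mapsD(1)[OF ul]]
  show "u \<in> rmod_hom R (Mn n) (Mn n')" "u \<in> extensional (carrier (Mn n))" using linear_mapsD[OF ul] .
  obtain k where k: "(i, k) \<in> r" "(i', k) \<in> r"
    "\<And>l x. \<lbrakk>(k, l) \<in> r; x \<in> carrier (Mn n)\<rbrakk> \<Longrightarrow> f i l (h x) = f i' l (h' (u x))"
    using arrow_at[OF a b u] by blast
  have kI: "k \<in> I" using in_index[OF k(1)] by simp
  show "\<phi> i' (h' (u x)) = \<phi> i (h x)" if x: "x \<in> carrier (Mn n)" for x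
    using dirlim_coconeD(2)[OF cocone k(1) rmod_homD(1)[OF h x]]
      dirlim_coconeD(2)[OF cocone k(2) rmod_homD(1)[OF h' uc[OF x]]] k(3)[OF idx_refl[OF kI] x] by simp
  fix n'' i'' h'' v
  assume c: "(n'', i'', h'') \<in> objects" and v: "v \<in> arrows (n', i', h') (n'', i'', h'')"
  have vl: "v \<in> linear_maps n' n''" using v by (auto simp: arrows_def)
  obtain l where l: "(i'', l) \<in> r"
    "\<And>m x. \<lbrakk>(l, m) \<in> r; x \<in> carrier (Mn n')\<rbrakk> \<Longrightarrow> f i' m (h' x) = f i'' m (h'' (v x))"
    using arrow_at[OF b c v] by blast
  obtain m where m: "(k, m) \<in> r" "(l, m) \<in> r" using upper_bound in_index k(1) l(1) by meson
  show "compose (carrier (Mn n)) v u \<in> arrows (n, i, h) (n'', i'', h'')"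
  proof (rule arrowsI[OF linear_maps_comp[OF ul vl] idx_trans[OF k(1) m(1)] idx_trans[OF l(1) m(2)]])
    fix x assume x: "x \<in> carrier (Mn n)"
    show "f i m (h x) = f i'' m (h'' (compose (carrier (Mn n)) v u x))"
      using k(3)[OF m(1) x] l(2)[OF m(2) uc[OF x]] x by (simp add: compose_def)
  qed
next
  fix y assume "y \<in> carrier N"
  then obtain i d where i: "i \<in> I" and d: "d \<in> carrier (D i)" "\<phi> i d = y"
    using dirlim_coconeD(3)[OF cocone] by blast
  obtain \<iota> \<pi> where S: "summand_of_copies R M T e (X i) (D i) \<iota> \<pi>"
    using summand_instance[OF i] by blast
  obtain n h x where h: "h \<in> rmod_hom R (Mn n) (D i)" and x: "x \<in> carrier (Mn n)" "h x = d"
    using summand_of_copies.reach[OF S d(1)] by blast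
  show "\<exists>a\<in>objects. \<exists>x\<in>carrier (case a of (n, i, h) \<Rightarrow> Mn n). (case a of (n, i, h) \<Rightarrow> \<lambda>x. \<phi> i (h x)) x = y"
    using object_restrict[OF i h] x d(2)
    by (intro bexI[of _ "(n, i, restrict h (carrier (Mn n)))"] bexI[of _ x]) simp_all
qed

end

context unit_fractions
begin

text \<open>An element \<open>a/s\<close> of \<open>M\<close> is coded by the ring elements \<open>s\<close> and \<open>a\<close> of a chosen
  representation.\<close>

definition code_elem :: "'m \<Rightarrow> ('r, 'v) univ"
  where "code_elem m = (let p = SOME p. fst p \<in> T \<and> snd p \<in> carrier R \<and> m = e (fst p) \<star>\<^bsub>M\<^esub> snd p
    in code_pair (code_scalar (fst p)) (code_scalar (snd p)))"

definition code_vec :: "(nat \<Rightarrow> 'm) \<Rightarrow> ('r, 'v) univ"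
  where "code_vec x = code_seq (\<lambda>j. code_elem (x j))"

lemma code_elem_eq:
  assumes m: "m \<in> carrier M" and m': "m' \<in> carrier M"
    and eq: "(code_elem m :: ('r, 'v) univ) = code_elem m'"
  shows "m = m'"
proof -
  define P where "P m p \<longleftrightarrow> fst p \<in> T \<and> snd p \<in> carrier R \<and> m = e (fst p) \<star>\<^bsub>M\<^esub> snd p" for m p
  have rep: "P m (SOME p. P m p)" if "m \<in> carrier M" for m
  proof (rule someI_ex)
    obtain s a where "s \<in> T" "a \<in> carrier R" "m = e s \<star>\<^bsub>M\<^esub> a" using e_gen[OF \<open>m \<in> carrier M\<close>] by blast
    then show "\<exists>p. P m p" by (intro exI[of _ "(s, a)"]) (simp add: P_def)
  qed
  have code: "(code_elem m :: ('r, 'v) univ) =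
      code_pair (code_scalar (fst (SOME p. P m p))) (code_scalar (snd (SOME p. P m p)))" for m
    by (simp add: code_elem_def P_def Let_def)
  have "(SOME p. P m p) = (SOME p. P m' p)"
    using eq unfolding code code_pair_eq code_scalar_eq by (intro prod_eqI) simp_all
  then show ?thesis using rep[OF m] rep[OF m'] by (simp add: P_def)
qed

lemma code_vec_eq:
  assumes x: "x \<in> carrier (Mn n)" and y: "y \<in> carrier (Mn n)"
    and eq: "(code_vec x :: ('r, 'v) univ) = code_vec y"
  shows "x = y"
proof (rule direct_sum_copies_eqI[OF x y])
  fix j assume j: "j \<in> {..<n}"
  have "(code_elem (x j) :: ('r, 'v) univ) = code_elem (y j)"
    using eq by (simp add: code_vec_def fun_eq_iff)
  then show "x j = y j" by (rule code_elem_eq[OF direct_sum_copies_coord[OF x j] direct_sum_copies_coord[OF y j]])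
qed

text \<open>As \<open>T\<close> is countable, \<open>M\<^sup>n\<close> is countably generated, so that a homomorphism out of it is
  determined by a sequence of values.\<close>

definition gen :: "nat \<Rightarrow> nat \<Rightarrow> nat \<Rightarrow> 'm"
  where "gen n k = qn n (from_nat_into T (fst (prod_decode k))) (basis R n (snd (prod_decode k)))"

lemma gen_closed: "gen n k \<in> carrier (Mn n)"
proof -
  have "T \<noteq> {}" using one_T by blast
  then show ?thesis unfolding gen_def by (intro q_closed from_nat_into basis_closed)
qed

lemma hom_eqI_gen:
  assumes count: "countable T" and B: "right_module R B"
    and h: "h \<in> rmod_hom R (Mn n) B" "h \<in> extensional (carrier (Mn n))"
    and h': "h' \<in> rmod_hom R (Mn n) B" "h' \<in> extensional (carrier (Mn n))"
    and eq: "\<And>k. h (gen n k) = h' (gen n k)"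
  shows "h = h'"
proof (rule extensionalityI[OF h(2) h'(2)])
  fix x assume "x \<in> carrier (Mn n)"
  then show "h x = h' x"
  proof (rule Ms_hom_eqI[rotated])
    fix s w assume s: "s \<in> T" and w: "w \<in> carrier (free R n)"
    note hq = rmod_hom_comp[OF q_hom[OF s] h(1)] and hq' = rmod_hom_comp[OF q_hom[OF s] h'(1)]
    show "h (qn n s w) = h' (qn n s w)"
    proof (rule free_span[of w n "\<lambda>w. h (qn n s w) = h' (qn n s w)", OF w])
      show "h (qn n s \<zero>\<^bsub>free R n\<^esub>) = h' (qn n s \<zero>\<^bsub>free R n\<^esub>)"
        using rmod_hom_zero[OF hq free_module B] rmod_hom_zero[OF hq' free_module B] by (rule trans_sym)
      fix i assume "i < n"
      obtain j where "from_nat_into T j = s" using from_nat_into_surj[OF count s] by blast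
      then show "h (qn n s (basis R n i)) = h' (qn n s (basis R n i))"
        using eq[of "prod_encode (j, i)"] by (simp add: gen_def)
    qed (simp_all only: rmod_homD(2,3)[OF hq] rmod_homD(2,3)[OF hq'])
  qed
qed

text \<open>Objects and arrows of the filtered diagram are coded by their values on the sequence \<open>gen\<close>, and
  stages by the finite sets of codes of their arrows and the codes of their distinguished
  objects. The code of an arrow determines the arrow only
  together with its target; within a stage all arrows have the same target.\<close>

lemma limit_of_Add_in_limit_of_add:
  fixes D :: "('r, 'v) univ \<Rightarrow> ('r, ('r, 'v) univ) rmodule" and N :: "('r, 'n) rmodule"
  assumes noeth: "left_noetherian R" and count: "countable T" and N: "right_module R N"
    and sys: "direct_system R I r D f" and coc: "dirlim_cocone R I r D f N \<phi>"
    and D: "\<And>i. i \<in> I \<Longrightarrow> D i \<in> AddM R M"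
  shows "N \<in> direct_limits R (addM R M :: ('r, ('r, 'v) univ) rmodule set)"
proof -
  have "\<forall>i\<in>I. \<exists>X :: ('r, 'v) univ set. is_direct_summand R (D i) (direct_sum_copies X M)"
    using D by (simp add: AddM_def)
  from bchoice[OF this] obtain X :: "('r, 'v) univ \<Rightarrow> ('r, 'v) univ set"
    where X: "\<forall>i\<in>I. is_direct_summand R (D i) (direct_sum_copies (X i) M)" ..
  interpret L: limit_of_summands R M T e I r D f N \<phi> X
    by (intro limit_of_summands.intro limit_of_summands_axioms.intro directed_system.intro
        unit_fractions_axioms sys noeth count N coc) (use X in blast)
  interpret F: filtered_presentation R N L.objects "\<lambda>(n, i, h). Mn n" L.arrows "\<lambda>(n, i, h) x. \<phi> i (h x)"
    by (rule L.filtered)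
  define code_ob :: "nat \<times> ('r, 'v) univ \<times> ((nat \<Rightarrow> 'm) \<Rightarrow> ('r, 'v) univ) \<Rightarrow> ('r, 'v) univ"
    where "code_ob = (\<lambda>(n, i, h). code_pair (code_nat n) (code_pair i (code_seq (\<lambda>k. h (gen n k)))))"
  define code_key where "code_key y = code_pair (code_ob (fst y)) (code_nat (snd y))" for y
  define code_arrow :: "_ \<Rightarrow> ('r, 'v) univ"
    where "code_arrow yu = code_pair (code_key (fst yu)) (code_seq (\<lambda>k. code_vec (snd yu (gen (fst (fst (fst yu))) k))))" for yu
  define code_stage where "code_stage p = code_pair (code_finite (code_arrow ` fst p)) (code_key (snd p))" for p
  have ob: "a = b" if a: "a \<in> L.objects" and b: "b \<in> L.objects" and eq: "code_ob a = code_ob b" for a b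
  proof -
    obtain n i h where a': "a = (n, i, h)" by (metis prod_cases3)
    obtain n' i' h' where b': "b = (n', i', h')" by (metis prod_cases3)
    have ni: "n' = n" "i' = i" and hh: "\<And>k. h (gen n k) = h' (gen n k)"
      using eq by (auto simp: a' b' code_ob_def fun_eq_iff)
    have i: "i \<in> I" and hom: "h \<in> rmod_hom R (Mn n) (D i)" "h \<in> extensional (carrier (Mn n))"
      and hom': "h' \<in> rmod_hom R (Mn n) (D i)" "h' \<in> extensional (carrier (Mn n))"
      using a b by (simp_all add: a' b' ni L.objects_def)
    have "h = h'" by (rule hom_eqI_gen[OF count L.modules[OF i] hom hom' hh])
    then show ?thesis by (simp add: a' b' ni)
  qed
  have key: "y = y'" if "fst y \<in> L.objects" "fst y' \<in> L.objects" "code_key y = code_key y'" for y y'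
  proof (rule prod_eqI)
    show "fst y = fst y'" by (rule ob[OF that(1,2)]) (use that(3) in \<open>simp add: code_key_def\<close>)
    show "snd y = snd y'" using that(3) by (simp add: code_key_def)
  qed
  have arrow: "yu = yu'" if yu: "fst (fst yu) \<in> L.objects" "snd yu \<in> L.arrows (fst (fst yu)) b"
    and yu': "fst (fst yu') \<in> L.objects" "snd yu' \<in> L.arrows (fst (fst yu')) b"
    and b: "b \<in> L.objects" and eq: "code_arrow yu = code_arrow yu'" for yu yu' b
  proof -
    have y: "fst yu = fst yu'" using key[OF yu(1) yu'(1)] eq by (simp add: code_arrow_def)
    obtain n i h where a: "fst (fst yu) = (n, i, h)" by (metis prod_cases3)
    obtain n' i' h' where b': "b = (n', i', h')" by (metis prod_cases3)
    have lin: "snd yu \<in> linear_maps n n'" "snd yu' \<in> linear_maps n n'"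
      using yu(2) yu'(2) a y by (auto simp: b' L.arrows_def)
    note uD = linear_mapsD[OF lin(1)] and uD' = linear_mapsD[OF lin(2)]
    have "snd yu (gen n k) = snd yu' (gen n k)" for k
    proof (rule code_vec_eq)
      show "snd yu (gen n k) \<in> carrier (Mn n')" "snd yu' (gen n k) \<in> carrier (Mn n')"
        using rmod_homD(1)[OF uD(1) gen_closed] rmod_homD(1)[OF uD'(1) gen_closed] .
      show "(code_vec (snd yu (gen n k)) :: ('r, 'v) univ) = code_vec (snd yu' (gen n k))"
        using eq y a by (simp add: code_arrow_def fun_eq_iff)
    qed
    then have "snd yu = snd yu'" by (rule hom_eqI_gen[OF count Ms.right_module_axioms uD uD'])
    then show ?thesis using y by (simp add: prod_eq_iff)
  qed
  have inj: "inj_on code_stage F.stages"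
  proof (rule inj_onI)
    fix p p' assume p: "p \<in> F.stages" and p': "p' \<in> F.stages" and eq: "code_stage p = code_stage p'"
    have q: "snd p = snd p'"
      using key[OF F.stagesD(4)[OF p] F.stagesD(4)[OF p']] eq by (simp add: code_stage_def)
    have im: "code_arrow ` fst p = code_arrow ` fst p'"
      by (rule code_finite_eq) (use eq F.stagesD(1)[OF p] F.stagesD(1)[OF p'] in \<open>simp_all add: code_stage_def\<close>)
    let ?b = "fst (snd p)"
    have in1: "fst (fst yu) \<in> L.objects \<and> snd yu \<in> L.arrows (fst (fst yu)) ?b" if "yu \<in> fst p \<union> fst p'" for yu
      using that F.stagesD(5)[OF p, of "fst yu" "snd yu"] F.stagesD(5)[OF p', of "fst yu" "snd yu"] q by auto
    have "inj_on code_arrow (fst p \<union> fst p')"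
    proof (rule inj_onI)
      fix yu yu' assume 1: "yu \<in> fst p \<union> fst p'" and 2: "yu' \<in> fst p \<union> fst p'" and e: "code_arrow yu = code_arrow yu'"
      show "yu = yu'"
        using in1[OF 1] in1[OF 2] arrow[OF _ _ _ _ F.stagesD(4)[OF p] e] by blast
    qed
    then have "fst p = fst p'" using im by (simp add: inj_on_Un_image_eq_iff)
    then show "p = p'" using q by (simp add: prod_eq_iff)
  qed
  have inj_vec: "inj_on (code_vec :: _ \<Rightarrow> ('r, 'v) univ) (carrier (case fst (snd p) of (n, i, h) \<Rightarrow> Mn n))"
    if "p \<in> F.stages" for p
    by (rule inj_onI) (auto split: prod.splits intro: code_vec_eq)
  have "\<exists>r' D' f' \<phi>'. direct_system R (code_stage ` F.stages) r' D' f' \<and>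
    dirlim_cocone R (code_stage ` F.stages) r' D' f' N \<phi>' \<and>
    (\<forall>p\<in>F.stages. D' (code_stage p) = image_rmodule (code_vec :: _ \<Rightarrow> ('r, 'v) univ) (case fst (snd p) of (n, i, h) \<Rightarrow> Mn n))"
    by (rule transport_direct_system[OF F.stages_system F.stages_cocone inj, where g = "\<lambda>_. code_vec :: _ \<Rightarrow> ('r, 'v) univ"])
      (rule inj_vec)
  then obtain r' D' f' \<phi>' where sys': "direct_system R (code_stage ` F.stages) r' D' f'"
    and coc': "dirlim_cocone R (code_stage ` F.stages) r' D' f' N \<phi>'"
    and D': "\<And>p. p \<in> F.stages \<Longrightarrow> D' (code_stage p) = image_rmodule (code_vec :: _ \<Rightarrow> ('r, 'v) univ) (case fst (snd p) of (n, i, h) \<Rightarrow> Mn n)"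
    by blast
  have add: "D' j \<in> addM R M" if j: "j \<in> code_stage ` F.stages" for j
  proof -
    obtain p where p: "p \<in> F.stages" "j = code_stage p" using j by blast
    obtain n i h where nih: "fst (snd p) = (n, i, h)" by (metis prod_cases3)
    have Dj: "D' j = image_rmodule code_vec (Mn n)" using D'[OF p(1)] p(2) nih by simp
    have inj_n: "inj_on (code_vec :: _ \<Rightarrow> ('r, 'v) univ) (carrier (Mn n))" by (rule inj_onI) (rule code_vec_eq)
    note im = image_rmodule[OF Ms.right_module_axioms inj_n]
    have "code_vec (inv_into (carrier (Mn n)) code_vec x) = x" if "x \<in> carrier (D' j)" for x
      using that by (simp add: Dj image_rmodule_def f_inv_into_f)
    then have "is_direct_summand R (D' j) (Mn n)"
      unfolding is_direct_summand_iff_retract[OF im(1)[folded Dj] Ms.right_module_axioms]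
      using im(2,3) by (intro bexI[OF _ im(3)[folded Dj]] bexI[OF _ im(2)[folded Dj]]) simp
    then show ?thesis using im(1) by (auto simp: addM_def Dj)
  qed
  show ?thesis
    unfolding direct_limits_iff_cocone
    by (intro conjI exI[of _ "code_stage ` F.stages"] exI[of _ r'] exI[of _ D'] exI[of _ f'] exI[of _ \<phi>']
        N sys' coc' ballI add)
qed

lemma addM_subset_AddM: "(addM R M :: ('r, ('r, 'v) univ) rmodule set) \<subseteq> AddM R M"
proof
  fix L :: "('r, ('r, 'v) univ) rmodule"
  assume "L \<in> addM R M"
  then obtain n where L: "right_module R L" and sum: "is_direct_summand R L (Mn n)" by (auto simp: addM_def)
  obtain i \<pi> where i: "i \<in> rmod_hom R L (Mn n)" and \<pi>: "\<pi> \<in> rmod_hom R (Mn n) L"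
    and \<pi>i: "\<And>x. x \<in> carrier L \<Longrightarrow> \<pi> (i x) = x"
    using sum[unfolded is_direct_summand_iff_retract[OF L Ms.right_module_axioms]] by blast
  define X :: "('r, 'v) univ set" where "X = code_nat ` {..<n}"
  have c: "inj_on (code_nat :: nat \<Rightarrow> ('r, 'v) univ) {..<n}" "code_nat ` {..<n} \<subseteq> X"
    by (auto simp: X_def inj_on_def)
  have "\<pi> (pull code_nat {..<n} (push code_nat {..<n} X M (i x))) = x" if x: "x \<in> carrier L" for x
    using pull_push[OF c rmod_homD(1)[OF i x]] \<pi>i[OF x] by simp
  then have "is_direct_summand R L (direct_sum_copies X M)"
    unfolding is_direct_summand_iff_retract[OF L Ms.right_module_axioms]
    by (intro bexI[OF _ rmod_hom_comp[OF i push_hom[OF M_module c]]] bexI[OF _ rmod_hom_comp[OF pull_hom[OF c] \<pi>]]) simp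
  then show "L \<in> AddM R M" using L by (auto simp: AddM_def)
qed

end

theorem proposition5p8:
  fixes R :: "('r, 'k) ring_scheme" and T :: "'r set"
  assumes "left_noetherian R"
    and "central_mult_subset T R"
    and "countable T"
  shows "(direct_limits R (addM R (loc_cokernel R T) :: ('r, ('r, 'v) univ) rmodule set)
            :: ('r, 'n) rmodule set)
       = direct_limits R (AddM R (loc_cokernel R T) :: ('r, ('r, 'v) univ) rmodule set)"
proof -
  have "ring R" using assms(1) by (simp add: left_noetherian_def)
  then interpret C: central_subset R T
    by (intro central_subset.intro central_subset_axioms.intro assms(2))
  interpret M: unit_fractions R "loc_cokernel R T" T "\<lambda>s. C.integral +>\<^bsub>C.Loc\<^esub> C.fr \<one>\<^bsub>R\<^esub> s"
    by (rule C.loc_cokernel_unit_fractions)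
  show ?thesis
  proof (rule equalityI)
    show "(direct_limits R (addM R (loc_cokernel R T) :: ('r, ('r, 'v) univ) rmodule set)
            :: ('r, 'n) rmodule set)
       \<subseteq> direct_limits R (AddM R (loc_cokernel R T) :: ('r, ('r, 'v) univ) rmodule set)"
      using M.addM_subset_AddM unfolding direct_limits_def by blast
    show "(direct_limits R (AddM R (loc_cokernel R T) :: ('r, ('r, 'v) univ) rmodule set)
            :: ('r, 'n) rmodule set)
       \<subseteq> direct_limits R (addM R (loc_cokernel R T) :: ('r, ('r, 'v) univ) rmodule set)"
    proof
      fix N :: "('r, 'n) rmodule"
      assume "N \<in> direct_limits R (AddM R (loc_cokernel R T) :: ('r, ('r, 'v) univ) rmodule set)"
      then obtain I r and D :: "('r, 'v) univ \<Rightarrow> ('r, ('r, 'v) univ) rmodule" and f \<phi>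
        where "right_module R N" "direct_system R I r D f" "dirlim_cocone R I r D f N \<phi>"
          "\<And>i. i \<in> I \<Longrightarrow> D i \<in> AddM R (loc_cokernel R T)"
        unfolding direct_limits_iff_cocone by blast
      then show "N \<in> direct_limits R (addM R (loc_cokernel R T) :: ('r, ('r, 'v) univ) rmodule set)"
        by (intro M.limit_of_Add_in_limit_of_add[OF assms(1,3)])
    qed
  qed
qed

end
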